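(* In the setting described in the context, suppose that Assumptions 1 and 2 (stated in full in the context) hold and that there is a deterministic constant $m\in(0,\infty)$ such that $\lambda(x,\eta_1)<m$ for all $x\in\mathcal S$. Fix $a\in(0,1)$. Then the estimator $Z_{1,\Delta}$ defined in the context is a strongly efficient estimator of $\phi(\Delta)$: under the sampling distribution used to generate it, it is unbiased, i.e. its expectation equals $\phi(\Delta)$, and its second moment is $O(\phi(\Delta)^2)$ as $\Delta\searrow0$.
   Context: Model. $X=(X_n:n\ge 0)$ is a Markov chain with finite state space $\mathcal S$ and transition matrix $(K(x,y):x,y\in\mathcal S)$, started from $X_0=x_0$. $((\xi_n,\eta_n):n\ge1)$ is a sequence of i.i.d. two-dimensional random variables independent of $X$. $\gamma(x,z)$ and $\lambda(x,z)$ ($x\in\mathcal S$, $z\in\mathbb R$) are deterministic real-valued functions, with $\lambda\ge 0$. For $\Delta>0$ put $S_0=0$, $D_0=0$, $S_{k+1}=S_k+\gamma(X_{k+1},\xi_{k+1})$, $D_{k+1}=D_k+\Delta\,\lambda(X_{k+1},\eta_{k+1})e^{S_{k+1}}$, $D_\infty=\lim_n D_n$ (these depend on $\Delta$), and $\phi(\Delta)=P(D_\infty>1\mid S_0=0,D_0=0,X_0=x_0)$. These are the nominal (original) dynamics. Notation. $E_x$ is expectation given $X_0=x$. Let $\exp(\chi(x,\theta))=E\exp(\theta\gamma(x,\xi_1))$ and $Q_\theta(x,y)=K(x,y)\exp(\chi(y,\theta))$. For $\theta$ such that $\chi(\cdot,\theta)$ is finite, $\exp(\psi(\theta))$ denotes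 the Perron–Frobenius eigenvalue of $Q_\theta$, with strictly positive eigenvector $u_\theta$ (unique up to scaling): $Q_\theta u_\theta=e^{\psi(\theta)}u_\theta$. Otherwise $\psi(\theta)=\infty$. Assumption 1: $X$ is irreducible on the finite state space $\mathcal S$, and $\sup_{x\in\mathcal S,\theta\in\mathcal N}E\exp(\theta\gamma(x,\xi_1))<\infty$ for some neighborhood $\mathcal N$ of the origin. Assumption 2 (Cramér's condition): there exists $\theta_*>0$ with $\psi(\theta_* )=0$, and there exists $\theta>\theta_*$ with $\psi(\theta)<\infty$. Estimator. Let $T_{\Delta/a}=\inf\{n\ge0:D_n>a\}$. The process $(S_n,D_n,X_n)$, started at $(0,0,x_0)$, is simulated as follows. Up to time $T_{\Delta/a}$, each transition from current chain state $x$ is generated by: (1) drawing the next chain state $y$ from the stochastic matrix $K_{\theta_*}(x,y)=K(x,y)\exp(\chi(y,\theta_* )-\psi(\theta_* ))u_{\theta_*}(y)/u_{\theta_*}(x)$; (2) given $y$, drawing the increment $\gamma(y,\xi)$ from the tilted law $e^{\theta_* z-\chi(y,\theta_* )}P(\gamma(y,\xi_1)\in dz)$; (3) given $y$ and $\gamma(y,\xi)=z$, drawing $\lambda(y,\eta)$ from its nominal conditional law given $\gamma(y,\xi)=z$. After time $T_{\Delta/a}$ the process evolves according to the nominal dynamics. The estimator is $$Z_{1,\Delta}=\exp(-\theta_*S_{T_{\Delta/a}})\,\frac{u_{\theta_*}(x_0)}{u_{\theta_*}(X_{T_{\Delta/a}})}\,I(D_\infty>1),$$ (equal to $0$ when $D_\infty\le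 1$, in particular when $T_{\Delta/a}=\infty$). *)

theory Defs
  imports "HOL-Probability.Probability"
begin

section \<open>Finite-state Markov chains and Perron-Frobenius eigenvalues\<close>

text \<open>The finite state space is a type of class \<open>finite\<close>; matrices are functions of two states.\<close>

definition stochastic_matrix :: "('x::finite \<Rightarrow> 'x \<Rightarrow> real) \<Rightarrow> bool" where
  "stochastic_matrix K \<longleftrightarrow> (\<forall>x y. 0 \<le> K x y) \<and> (\<forall>x. (\<Sum>y\<in>UNIV. K x y) = 1)"

primrec matrix_pow :: "('x::finite \<Rightarrow> 'x \<Rightarrow> real) \<Rightarrow> nat \<Rightarrow> 'x \<Rightarrow> 'x \<Rightarrow> real" where
  "matrix_pow K 0 x y = (if x = y then 1 else 0)"
| "matrix_pow K (Suc n) x y = (\<Sum>z\<in>UNIV. K x z * matrix_pow K n z y)"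

definition irreducible_matrix :: "('x::finite \<Rightarrow> 'x \<Rightarrow> real) \<Rightarrow> bool" where
  "irreducible_matrix K \<longleftrightarrow> (\<forall>x y. \<exists>n. 0 < matrix_pow K n x y)"

definition markov_chain ::
    "'a measure \<Rightarrow> ('x::finite \<Rightarrow> 'x \<Rightarrow> real) \<Rightarrow> 'x \<Rightarrow> (nat \<Rightarrow> 'a \<Rightarrow> 'x) \<Rightarrow> bool" where
  "markov_chain M K x0 X \<longleftrightarrow>
     (\<forall>n. X n \<in> measurable M (count_space UNIV)) \<and>
     (AE \<omega> in M. X 0 \<omega> = x0) \<and>
     (\<forall>n s. measure M {\<omega> \<in> space M. \<forall>k\<le>Suc n. X k \<omega> = s k} =
            measure M {\<omega> \<in> space M. \<forall>k\<le>n. X k \<omega> = s k} * K (s n) (s (Suc n)))"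

definition complex_eigenvalue :: "('x::finite \<Rightarrow> 'x \<Rightarrow> real) \<Rightarrow> complex \<Rightarrow> bool" where
  "complex_eigenvalue Q \<mu> \<longleftrightarrow>
     (\<exists>v. v \<noteq> (\<lambda>_. 0) \<and> (\<forall>x. (\<Sum>y\<in>UNIV. of_real (Q x y) * v y) = \<mu> * v x))"

text \<open>The Perron-Frobenius eigenvalue of an irreducible nonnegative matrix is its spectral radius.\<close>

definition perron_root :: "('x::finite \<Rightarrow> 'x \<Rightarrow> real) \<Rightarrow> real" where
  "perron_root Q = Sup {cmod \<mu> | \<mu>. complex_eigenvalue Q \<mu>}"

section \<open>The nominal model\<close>

text \<open>\<open>M\<close> carries a Markov chain \<open>X\<close> started from \<open>x0\<close> and an independent i.i.d. sequence of pairs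
  \<open>(\<xi> n, \<eta> n)\<close>, \<open>n \<ge> 1\<close>; for a given \<open>n\<close>, \<open>\<xi> n\<close> and \<open>\<eta> n\<close> may be dependent.
  (The sigma-algebras are compared by \<open>indep_set\<close>, since \<open>indep_var\<close> needs a common codomain.)\<close>

definition nominal_model ::
    "'a measure \<Rightarrow> ('x::finite \<Rightarrow> 'x \<Rightarrow> real) \<Rightarrow> 'x \<Rightarrow> (nat \<Rightarrow> 'a \<Rightarrow> 'x) \<Rightarrow>
     (nat \<Rightarrow> 'a \<Rightarrow> real) \<Rightarrow> (nat \<Rightarrow> 'a \<Rightarrow> real) \<Rightarrow> bool" where
  "nominal_model M K x0 X \<xi> \<eta> \<longleftrightarrow>
     prob_space M \<and> stochastic_matrix K \<and> markov_chain M K x0 X \<and>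
     prob_space.indep_vars M (\<lambda>_. borel) (\<lambda>n \<omega>. (\<xi> n \<omega>, \<eta> n \<omega>)) {1..} \<and>
     (\<forall>n\<ge>1. distr M borel (\<lambda>\<omega>. (\<xi> n \<omega>, \<eta> n \<omega>)) = distr M borel (\<lambda>\<omega>. (\<xi> 1 \<omega>, \<eta> 1 \<omega>))) \<and>
     prob_space.indep_set M
       (sets (vimage_algebra (space M) (\<lambda>\<omega> n. X n \<omega>) (PiM UNIV (\<lambda>_. count_space UNIV))))
       (sets (vimage_algebra (space M) (\<lambda>\<omega>. \<lambda>n\<in>{1..}. (\<xi> n \<omega>, \<eta> n \<omega>)) (PiM {1..} (\<lambda>_. borel))))"

text \<open>Pathwise functionals of the increments \<open>g k\<close> (the values of \<open>\<gamma>\<close>) and \<open>l k\<close>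
  (the values of \<open>\<lambda>\<close>), \<open>k \<ge> 1\<close>; entries at index 0 are never used.\<close>

primrec S_path :: "(nat \<Rightarrow> real) \<Rightarrow> nat \<Rightarrow> real" where
  "S_path g 0 = 0"
| "S_path g (Suc k) = S_path g k + g (Suc k)"

primrec D_path :: "real \<Rightarrow> (nat \<Rightarrow> real) \<Rightarrow> (nat \<Rightarrow> real) \<Rightarrow> nat \<Rightarrow> real" where
  "D_path \<Delta> g l 0 = 0"
| "D_path \<Delta> g l (Suc k) = D_path \<Delta> g l k + \<Delta> * l (Suc k) * exp (S_path g (Suc k))"

text \<open>The limit is taken in the extended reals, as it may be infinite.\<close>

definition D_inf :: "real \<Rightarrow> (nat \<Rightarrow> real) \<Rightarrow> (nat \<Rightarrow> real) \<Rightarrow> ereal" where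
  "D_inf \<Delta> g l = lim (\<lambda>n. ereal (D_path \<Delta> g l n))"

definition hit_time :: "real \<Rightarrow> real \<Rightarrow> (nat \<Rightarrow> real) \<Rightarrow> (nat \<Rightarrow> real) \<Rightarrow> enat" where
  "hit_time a \<Delta> g l = Inf (enat ` {n. a < D_path \<Delta> g l n})"

definition phi ::
    "'a measure \<Rightarrow> (nat \<Rightarrow> 'a \<Rightarrow> 'x) \<Rightarrow> (nat \<Rightarrow> 'a \<Rightarrow> real) \<Rightarrow> (nat \<Rightarrow> 'a \<Rightarrow> real) \<Rightarrow>
     ('x \<Rightarrow> real \<Rightarrow> real) \<Rightarrow> ('x \<Rightarrow> real \<Rightarrow> real) \<Rightarrow> real \<Rightarrow> real" where
  "phi M X \<xi> \<eta> \<gamma> lam \<Delta> =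
     measure M {\<omega> \<in> space M.
       1 < D_inf \<Delta> (\<lambda>k. \<gamma> (X k \<omega>) (\<xi> k \<omega>)) (\<lambda>k. lam (X k \<omega>) (\<eta> k \<omega>))}"

section \<open>Exponential tilting\<close>

text \<open>In the following, \<open>\<xi>1\<close> and \<open>\<eta>1\<close> are the random variables \<open>\<xi> 1\<close> and \<open>\<eta> 1\<close>.
  The moment generating function takes values in \<open>[0,\<infinity>]\<close>; \<open>chi\<close> is meaningful only
  where it is finite.\<close>

definition mgf :: "'a measure \<Rightarrow> ('a \<Rightarrow> real) \<Rightarrow> ('x \<Rightarrow> real \<Rightarrow> real) \<Rightarrow> 'x \<Rightarrow> real \<Rightarrow> ennreal" where
  "mgf M \<xi>1 \<gamma> x \<theta> = (\<integral>\<^sup>+\<omega>. ennreal (exp (\<theta> * \<gamma> x (\<xi>1 \<omega>))) \<partial>M)"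

definition chi :: "'a measure \<Rightarrow> ('a \<Rightarrow> real) \<Rightarrow> ('x \<Rightarrow> real \<Rightarrow> real) \<Rightarrow> 'x \<Rightarrow> real \<Rightarrow> real" where
  "chi M \<xi>1 \<gamma> x \<theta> = ln (enn2real (mgf M \<xi>1 \<gamma> x \<theta>))"

definition Q_matrix ::
    "'a measure \<Rightarrow> ('a \<Rightarrow> real) \<Rightarrow> ('x \<Rightarrow> real \<Rightarrow> real) \<Rightarrow> ('x \<Rightarrow> 'x \<Rightarrow> real) \<Rightarrow> real \<Rightarrow> 'x \<Rightarrow> 'x \<Rightarrow> real" where
  "Q_matrix M \<xi>1 \<gamma> K \<theta> x y = K x y * exp (chi M \<xi>1 \<gamma> y \<theta>)"

definition psi ::
    "'a measure \<Rightarrow> ('a \<Rightarrow> real) \<Rightarrow> ('x::finite \<Rightarrow> real \<Rightarrow> real) \<Rightarrow> ('x \<Rightarrow> 'x \<Rightarrow> real) \<Rightarrow> real \<Rightarrow> ereal" where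
  "psi M \<xi>1 \<gamma> K \<theta> =
     (if \<forall>x. mgf M \<xi>1 \<gamma> x \<theta> < \<infinity> then ereal (ln (perron_root (Q_matrix M \<xi>1 \<gamma> K \<theta>))) else \<infinity>)"

definition positive_eigenvector ::
    "'a measure \<Rightarrow> ('a \<Rightarrow> real) \<Rightarrow> ('x::finite \<Rightarrow> real \<Rightarrow> real) \<Rightarrow> ('x \<Rightarrow> 'x \<Rightarrow> real) \<Rightarrow> real \<Rightarrow>
     ('x \<Rightarrow> real) \<Rightarrow> bool" where
  "positive_eigenvector M \<xi>1 \<gamma> K \<theta> u \<longleftrightarrow>
     (\<forall>x. 0 < u x) \<and>
     (\<forall>x. (\<Sum>y\<in>UNIV. Q_matrix M \<xi>1 \<gamma> K \<theta> x y * u y) =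
          exp (real_of_ereal (psi M \<xi>1 \<gamma> K \<theta>)) * u x)"

definition K_tilted ::
    "'a measure \<Rightarrow> ('a \<Rightarrow> real) \<Rightarrow> ('x::finite \<Rightarrow> real \<Rightarrow> real) \<Rightarrow> ('x \<Rightarrow> 'x \<Rightarrow> real) \<Rightarrow> real \<Rightarrow>
     ('x \<Rightarrow> real) \<Rightarrow> 'x \<Rightarrow> 'x \<Rightarrow> real" where
  "K_tilted M \<xi>1 \<gamma> K \<theta> u x y =
     K x y * exp (chi M \<xi>1 \<gamma> y \<theta> - real_of_ereal (psi M \<xi>1 \<gamma> K \<theta>)) * u y / u x"

section \<open>The sampling dynamics\<close>

abbreviation step_space :: "('x \<times> real \<times> real) measure" where
  "step_space \<equiv> count_space UNIV \<Otimes>\<^sub>M borel \<Otimes>\<^sub>M borel"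

definition inc_law ::
    "'a measure \<Rightarrow> ('a \<Rightarrow> real) \<Rightarrow> ('a \<Rightarrow> real) \<Rightarrow> ('x \<Rightarrow> real \<Rightarrow> real) \<Rightarrow> ('x \<Rightarrow> real \<Rightarrow> real) \<Rightarrow>
     'x \<Rightarrow> (real \<times> real) measure" where
  "inc_law M \<xi>1 \<eta>1 \<gamma> lam y =
     distr M (borel \<Otimes>\<^sub>M borel) (\<lambda>\<omega>. (\<gamma> y (\<xi>1 \<omega>), lam y (\<eta>1 \<omega>)))"

text \<open>\<open>\<kappa> y z\<close> is a (regular) conditional law of \<open>lam y \<eta>1\<close> given \<open>\<gamma> y \<xi>1 = z\<close>.\<close>

definition conditional_lam_law ::
    "'a measure \<Rightarrow> ('a \<Rightarrow> real) \<Rightarrow> ('a \<Rightarrow> real) \<Rightarrow> ('x \<Rightarrow> real \<Rightarrow> real) \<Rightarrow> ('x \<Rightarrow> real \<Rightarrow> real) \<Rightarrow>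
     ('x \<Rightarrow> real \<Rightarrow> real measure) \<Rightarrow> bool" where
  "conditional_lam_law M \<xi>1 \<eta>1 \<gamma> lam \<kappa> \<longleftrightarrow>
     (\<forall>y. \<kappa> y \<in> measurable borel (prob_algebra borel) \<and>
          inc_law M \<xi>1 \<eta>1 \<gamma> lam y =
            distr M borel (\<lambda>\<omega>. \<gamma> y (\<xi>1 \<omega>)) \<bind>
              (\<lambda>z. \<kappa> y z \<bind> (\<lambda>l. return (borel \<Otimes>\<^sub>M borel) (z, l))))"

text \<open>Laws of (next chain state, \<open>\<gamma>\<close>-increment, \<open>\<lambda>\<close>-value) given the current chain state \<open>x\<close>.\<close>

definition nominal_step ::
    "'a measure \<Rightarrow> ('a \<Rightarrow> real) \<Rightarrow> ('a \<Rightarrow> real) \<Rightarrow> ('x \<Rightarrow> real \<Rightarrow> real) \<Rightarrow> ('x \<Rightarrow> real \<Rightarrow> real) \<Rightarrow>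
     ('x::finite \<Rightarrow> 'x \<Rightarrow> real) \<Rightarrow> 'x \<Rightarrow> ('x \<times> real \<times> real) measure" where
  "nominal_step M \<xi>1 \<eta>1 \<gamma> lam K x =
     point_measure UNIV (\<lambda>y. ennreal (K x y)) \<bind>
       (\<lambda>y. inc_law M \<xi>1 \<eta>1 \<gamma> lam y \<bind> (\<lambda>(z, l). return step_space (y, z, l)))"

definition tilted_step ::
    "'a measure \<Rightarrow> ('a \<Rightarrow> real) \<Rightarrow> ('x \<Rightarrow> real \<Rightarrow> real) \<Rightarrow> ('x::finite \<Rightarrow> 'x \<Rightarrow> real) \<Rightarrow>
     real \<Rightarrow> ('x \<Rightarrow> real) \<Rightarrow> ('x \<Rightarrow> real \<Rightarrow> real measure) \<Rightarrow> 'x \<Rightarrow> ('x \<times> real \<times> real) measure" where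
  "tilted_step M \<xi>1 \<gamma> K \<theta> u \<kappa> x =
     point_measure UNIV (\<lambda>y. ennreal (K_tilted M \<xi>1 \<gamma> K \<theta> u x y)) \<bind>
       (\<lambda>y. density (distr M borel (\<lambda>\<omega>. \<gamma> y (\<xi>1 \<omega>))) (\<lambda>z. ennreal (exp (\<theta> * z - chi M \<xi>1 \<gamma> y \<theta>))) \<bind>
         (\<lambda>z. \<kappa> y z \<bind>
           (\<lambda>l. return step_space (y, z, l))))"

definition has_conditional_law ::
    "'w measure \<Rightarrow> 'w measure \<Rightarrow> 'b measure \<Rightarrow> ('w \<Rightarrow> 'b) \<Rightarrow> ('w \<Rightarrow> 'b measure) \<Rightarrow> bool" where
  "has_conditional_law N F E Y \<rho> \<longleftrightarrow>
     Y \<in> measurable N E \<and>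
     (\<forall>A\<in>sets F. \<forall>B\<in>sets E.
        emeasure N {\<omega> \<in> A. Y \<omega> \<in> B} = (\<integral>\<^sup>+\<omega>\<in>A. emeasure (\<rho> \<omega>) B \<partial>N))"

text \<open>The sigma-algebra generated by \<open>(X k, S k, D k)\<close>, \<open>k \<le> n\<close>.\<close>

definition history ::
    "'w measure \<Rightarrow> real \<Rightarrow> (nat \<Rightarrow> 'w \<Rightarrow> 'x) \<Rightarrow> (nat \<Rightarrow> 'w \<Rightarrow> real) \<Rightarrow> (nat \<Rightarrow> 'w \<Rightarrow> real) \<Rightarrow> nat \<Rightarrow> 'w measure" where
  "history N \<Delta> Y G L n =
     vimage_algebra (space N)
       (\<lambda>\<omega>. \<lambda>k\<in>{..n}. (Y k \<omega>, S_path (\<lambda>j. G j \<omega>) k, D_path \<Delta> (\<lambda>j. G j \<omega>) (\<lambda>j. L j \<omega>) k))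
       (PiM {..n} (\<lambda>_. step_space))"

text \<open>A process on \<open>N\<close> with chain \<open>Y\<close>, \<open>\<gamma>\<close>-increments \<open>G\<close> and \<open>\<lambda>\<close>-values \<open>L\<close>, whose
  transition from time \<open>n\<close> to \<open>n + 1\<close> has law \<open>tilted\<close> if \<open>n\<close> precedes the first time the
  process \<open>D\<close> exceeds \<open>a\<close>, and law \<open>nominal\<close> otherwise.\<close>

definition sampled_process ::
    "'w measure \<Rightarrow> ('x \<Rightarrow> ('x \<times> real \<times> real) measure) \<Rightarrow> ('x \<Rightarrow> ('x \<times> real \<times> real) measure) \<Rightarrow>
     real \<Rightarrow> real \<Rightarrow> 'x \<Rightarrow>
     (nat \<Rightarrow> 'w \<Rightarrow> 'x) \<Rightarrow> (nat \<Rightarrow> 'w \<Rightarrow> real) \<Rightarrow> (nat \<Rightarrow> 'w \<Rightarrow> real) \<Rightarrow> bool" where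
  "sampled_process N tilted nominal a \<Delta> x0 Y G L \<longleftrightarrow>
     prob_space N \<and>
     Y 0 \<in> measurable N (count_space UNIV) \<and>
     (AE \<omega> in N. Y 0 \<omega> = x0) \<and>
     (\<forall>n. has_conditional_law N (history N \<Delta> Y G L n) step_space
            (\<lambda>\<omega>. (Y (Suc n) \<omega>, G (Suc n) \<omega>, L (Suc n) \<omega>))
            (\<lambda>\<omega>. if enat n < hit_time a \<Delta> (\<lambda>j. G j \<omega>) (\<lambda>j. L j \<omega>)
                  then tilted (Y n \<omega>) else nominal (Y n \<omega>)))"

text \<open>If the hitting time is infinite, then \<open>the_enat\<close> is unspecified, but for \<open>a < 1\<close> the
  indicator vanishes.\<close>

definition Z1 ::
    "real \<Rightarrow> ('x \<Rightarrow> real) \<Rightarrow> 'x \<Rightarrow> real \<Rightarrow> real \<Rightarrow>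
     (nat \<Rightarrow> 'w \<Rightarrow> 'x) \<Rightarrow> (nat \<Rightarrow> 'w \<Rightarrow> real) \<Rightarrow> (nat \<Rightarrow> 'w \<Rightarrow> real) \<Rightarrow> 'w \<Rightarrow> real" where
  "Z1 \<theta> u x0 a \<Delta> Y G L \<omega> =
     (let g = (\<lambda>j. G j \<omega>); l = (\<lambda>j. L j \<omega>); T = the_enat (hit_time a \<Delta> g l)
      in exp (- \<theta> * S_path g T) * (u x0 / u (Y T \<omega>)) * (if 1 < D_inf \<Delta> g l then 1 else 0))"

text \<open>\<open>Z \<Delta>\<close> on \<open>N \<Delta>\<close> estimates \<open>p \<Delta>\<close>. Integrability is explicit because the Bochner integral
  of a non-integrable function is 0.\<close>

definition strongly_efficient ::
    "(real \<Rightarrow> 'w measure) \<Rightarrow> (real \<Rightarrow> 'w \<Rightarrow> real) \<Rightarrow> (real \<Rightarrow> real) \<Rightarrow> bool" where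
  "strongly_efficient N Z p \<longleftrightarrow>
     (\<forall>\<Delta>>0. integrable (N \<Delta>) (Z \<Delta>) \<and> (LINT \<omega>|N \<Delta>. Z \<Delta> \<omega>) = p \<Delta>) \<and>
     (\<forall>\<^sub>F \<Delta> in at_right 0. integrable (N \<Delta>) (\<lambda>\<omega>. (Z \<Delta> \<omega>)\<^sup>2)) \<and>
     (\<lambda>\<Delta>. LINT \<omega>|N \<Delta>. (Z \<Delta> \<omega>)\<^sup>2) \<in> O[at_right 0](\<lambda>\<Delta>. (p \<Delta>)\<^sup>2)"

end

theory Submission
  imports Defs
begin

text \<open>
  Let \<open>M\<^sub>n = exp (\<theta> S\<^sub>n) u (X\<^sub>n) / u x0\<close> with \<open>\<theta> = \<theta>s\<close>. This is a martingale of the nominal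
  process, and the sampling law is the nominal law tilted by \<open>M\<close> up to the time \<open>T\<close> at which \<open>D\<close>
  passes \<open>a\<close> (\<open>tilted_eq_density\<close>). The estimator is the likelihood ratio \<open>1 / M\<^sub>T\<close> on the event
  \<open>D\<^sub>\<infinity> > 1\<close>. Undoing the tilting step by step gives unbiasedness (\<open>weighted_tail_invariant\<close>,
  \<open>nominal_tail\<close>).

  For the second moment, note that at time \<open>T\<close> the bounded loads leave \<open>D\<^sub>T \<le> a + m \<Delta> exp S\<^sub>T\<close>. So
  if \<open>S\<^sub>T\<close> is small, which makes \<open>1 / M\<^sub>T\<close> large, the nominal process still has to bring \<open>D\<close> from
  about \<open>a\<close> to \<open>1\<close>, and the probability of this is \<open>O((\<Delta> exp S\<^sub>T)\<^sup>\<theta>)\<close>. Hence one factor of \<open>1 / M\<^sub>T\<close>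
  is compensated up to \<open>\<Delta>\<^sup>\<theta>\<close> (\<open>overshoot_bound\<close>). The other factor turns sampling
  probabilities back into nominal ones, and what remains is
  \<open>O(\<Delta>\<^sup>\<theta>)\<close> times the nominal probability that \<open>D\<close> ever passes \<open>a\<close>, that is, \<open>O(\<Delta>\<^sup>2\<^sup>\<theta>)\<close>
  (\<open>estimator_second_moment\<close>).

  It remains to know that nominal tail probabilities are of exact order \<open>\<Delta>\<^sup>\<theta>\<close>
  (\<open>exceed_upper_bound\<close>, \<open>exceed_lower_bound\<close>). Instead of renewal theory, the proof uses
  super- and subsolutions of the first-step recursion: \<open>u r\<^sup>\<theta> - v r\<^sup>p\<close> for the upper bound and
  \<open>u t\<^sup>\<theta> + v t\<^sup>p - k t\<^sup>q\<close> for the lower bound, where \<open>\<theta> < p < q\<close> and \<open>v\<close> is a strictly subharmonic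
  function for the exponent \<open>p\<close>. Such a \<open>v\<close> comes from Jensen's inequality applied to
  \<open>u powr (p / \<theta>)\<close>, made strict at every state by irreducibility (\<open>strictly_sub_superharmonic\<close>), so that no
  spectral theory is involved.

  Jensen's inequality is strict at some state unless \<open>M\<close> is almost surely constant. In this exceptional
  case \<open>S\<close> is bounded, the estimator is the indicator of \<open>D\<^sub>\<infinity> > 1\<close>, and its probability
  is \<open>0\<close> or \<open>1\<close>, according to whether the loads vanish (\<open>exceed_null_load\<close>,
  \<open>exceed_tendsto_1_degenerate\<close>).
\<close>

section \<open>Irreducible nonnegative matrices\<close>

definition matrix_apply :: "('x::finite \<Rightarrow> 'x \<Rightarrow> real) \<Rightarrow> ('x \<Rightarrow> real) \<Rightarrow> 'x \<Rightarrow> real" where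
  "matrix_apply R f x = (\<Sum>y\<in>UNIV. R x y * f y)"

lemma matrix_apply_power_nonneg:
  assumes "\<And>x y. 0 \<le> R x y" and "\<And>x. 0 \<le> f x"
  shows "0 \<le> (matrix_apply R ^^ j) f x"
  by (induction j arbitrary: x) (auto simp: assms matrix_apply_def intro!: sum_nonneg mult_nonneg_nonneg)

text \<open>Positivity of \<open>c\<close> at \<open>x0\<close> travels backwards along a path of positive entries of \<open>R\<close>, so at
  every state some iterate is positive; finitely many states share one horizon.\<close>

lemma irreducible_orbit_sum_pos:
  fixes R :: "'x::finite \<Rightarrow> 'x \<Rightarrow> real"
  assumes R: "\<And>x y. 0 \<le> R x y" and irr: "\<And>x y. (x, y) \<in> {(x, y). 0 < R x y}\<^sup>*"
    and c: "\<And>x. 0 \<le> c x" "0 < c x0"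
  shows "\<exists>n>0. \<forall>x. 0 < (\<Sum>j<n. (matrix_apply R ^^ j) c x)"
proof -
  have "\<exists>j. 0 < (matrix_apply R ^^ j) c x" for x
    using irr[of x x0]
  proof (induction rule: converse_rtrancl_induct)
    case base
    show ?case by (rule exI[of _ 0]) (simp add: c)
  next
    case (step x y)
    then obtain j where j: "0 < (matrix_apply R ^^ j) c y" by blast
    have "0 < R x y * (matrix_apply R ^^ j) c y" using step(1) j by simp
    also have "\<dots> \<le> (matrix_apply R ^^ Suc j) c x"
      using member_le_sum[of y UNIV "\<lambda>y. R x y * (matrix_apply R ^^ j) c y"]
      by (simp add: matrix_apply_def R matrix_apply_power_nonneg c)
    finally show ?case by blast
  qed
  then obtain J where J: "\<And>x. 0 < (matrix_apply R ^^ J x) c x" by metis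
  define n where "n = Suc (Max (range J))"
  have "0 < (\<Sum>j<n. (matrix_apply R ^^ j) c x)" for x
  proof (rule sum_pos2[of _ "J x"])
    show "J x \<in> {..<n}" by (simp add: n_def less_Suc_eq_le)
  qed (auto simp: J matrix_apply_power_nonneg R c)
  then show ?thesis by (intro exI[of _ n]) (auto simp: n_def)
qed

lemma finite_pos_lower_bound:
  fixes f :: "'x::finite \<Rightarrow> real"
  assumes "\<And>x. 0 < f x"
  obtains d where "0 < d" "\<And>x. d \<le> f x"
proof
  have "Min (range f) \<in> range f" by (rule Min_in) auto
  then show "0 < Min (range f)" using assms by auto
qed simp

text \<open>A gap that is strict at one state becomes strict at all states. For
  \<open>v = f + R f + \<dots> + R\<^sup>n\<^sup>-\<^sup>1 f\<close> the gap \<open>R v - v = R\<^sup>n f - f\<close> telescopes into the orbit sum of the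
  gap of \<open>f\<close>, which is everywhere positive once \<open>n\<close> is large. The sign \<open>\<sigma>\<close> covers subharmonic
  and superharmonic functions at once. In the applications this replaces the Perron-Frobenius
  eigenvector of \<open>R\<close>.\<close>

lemma strict_spread:
  fixes R :: "'x::finite \<Rightarrow> 'x \<Rightarrow> real" and \<sigma> :: real
  assumes R: "\<And>x y. 0 \<le> R x y" and irr: "\<And>x y. (x, y) \<in> {(x, y). 0 < R x y}\<^sup>*"
    and f: "\<And>x. 0 < f x"
    and ge: "\<And>x. 0 \<le> \<sigma> * (matrix_apply R f x - f x)"
    and strict: "0 < \<sigma> * (matrix_apply R f x0 - f x0)"
  obtains v d where "0 < d" "\<And>x. 0 < v x" "\<And>x. d * v x \<le> \<sigma> * (matrix_apply R v x - v x)"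
proof -
  define c where "c x = \<sigma> * (matrix_apply R f x - f x)" for x
  obtain n where n: "n > 0" "\<And>x. 0 < (\<Sum>j<n. (matrix_apply R ^^ j) c x)"
    using irreducible_orbit_sum_pos[OF R irr, of c x0] ge strict unfolding c_def by auto
  define v where "v x = (\<Sum>j<n. (matrix_apply R ^^ j) f x)" for x
  have cj: "(matrix_apply R ^^ j) c x
      = \<sigma> * ((matrix_apply R ^^ Suc j) f x - (matrix_apply R ^^ j) f x)" for j x
  proof (induction j arbitrary: x)
    case (Suc j)
    have "(matrix_apply R ^^ Suc j) c x = matrix_apply R ((matrix_apply R ^^ j) c) x" by simp
    also have "(matrix_apply R ^^ j) c
        = (\<lambda>x. \<sigma> * ((matrix_apply R ^^ Suc j) f x - (matrix_apply R ^^ j) f x))"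
      using Suc by blast
    also have "matrix_apply R \<dots> x = \<sigma> * (matrix_apply R ((matrix_apply R ^^ Suc j) f) x
        - matrix_apply R ((matrix_apply R ^^ j) f) x)"
      unfolding matrix_apply_def
      by (simp add: sum_distrib_left sum_subtractf[symmetric] algebra_simps)
    finally show ?case by simp
  qed (simp add: c_def)
  have Rv: "matrix_apply R v x = (\<Sum>j<n. (matrix_apply R ^^ Suc j) f x)" for x
    unfolding v_def matrix_apply_def funpow.simps comp_apply sum_distrib_left
    by (subst sum.swap) simp
  have gap: "\<sigma> * (matrix_apply R v x - v x) = (\<Sum>j<n. (matrix_apply R ^^ j) c x)" for x
    unfolding Rv v_def by (simp add: cj sum_subtractf sum_distrib_left algebra_simps)
  have v: "0 < v x" for x
    unfolding v_def using n(1)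
    by (intro sum_pos2[of _ 0]) (auto simp: f matrix_apply_power_nonneg R less_imp_le)
  obtain d where d: "0 < d" "\<And>x. d \<le> \<sigma> * (matrix_apply R v x - v x) / v x"
    using finite_pos_lower_bound[of "\<lambda>x. \<sigma> * (matrix_apply R v x - v x) / v x"] n(2) v
    unfolding gap by (metis divide_pos_pos)
  show ?thesis
    using d(2) v by (intro that[OF d(1), of v]) (simp_all add: pos_le_divide_eq)
qed

section \<open>Strict Jensen inequality for powers\<close>

text \<open>Strict convexity of \<open>exp\<close> on the chord from \<open>0\<close> to \<open>L\<close>: both end points lie strictly
  above the tangent at \<open>s * L\<close>.\<close>

lemma exp_mult_less_convex:
  fixes s L :: real
  assumes "0 < s" "s < 1" "L \<noteq> 0"
  shows "exp (s * L) < s * exp L + (1 - s)"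
proof -
  have strict: "1 + a < exp a" if "a \<noteq> 0" for a :: real
    using exp_minus_greater[of "- a"] that by simp
  have "s * (exp (s * L) * (1 + (1 - s) * L)) < s * exp L"
  proof -
    have "exp (s * L) * (1 + (1 - s) * L) < exp (s * L) * exp ((1 - s) * L)"
      using strict[of "(1 - s) * L"] assms by (intro mult_strict_left_mono) auto
    also have "\<dots> = exp L" by (simp add: mult_exp_exp algebra_simps)
    finally show ?thesis using assms by simp
  qed
  moreover have "(1 - s) * (exp (s * L) * (1 + - (s * L))) < (1 - s) * 1"
  proof -
    have "exp (s * L) * (1 + - (s * L)) < exp (s * L) * exp (- (s * L))"
      using strict[of "- (s * L)"] assms by (intro mult_strict_left_mono) auto
    also have "\<dots> = 1" by (simp add: exp_minus)
    finally show ?thesis using assms by simp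
  qed
  ultimately show ?thesis by (simp add: algebra_simps)
qed

text \<open>The graph of \<open>t powr s\<close> lies above its tangent at \<open>1\<close> for \<open>s > 1\<close> and below it for
  \<open>s < 1\<close>; the factor \<open>sgn\<close> makes one statement of both.\<close>

lemma powr_bernoulli:
  fixes s t :: real
  assumes "0 < s" "s \<noteq> 1" "0 < t" "t \<noteq> 1"
  shows "0 < sgn (s - 1) * (t powr s - 1 - s * (t - 1))"
proof (cases "s < 1")
  case True
  then show ?thesis
    using exp_mult_less_convex[of s "ln t"] assms by (simp add: powr_def algebra_simps)
next
  case False
  then have "exp (1 / s * (s * ln t)) < 1 / s * exp (s * ln t) + (1 - 1 / s)"
    using assms by (intro exp_mult_less_convex) auto
  then have "s * t < s * (1 / s * exp (s * ln t) + (1 - 1 / s))" using assms by simp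
  also have "\<dots> = t powr s + s - 1" using assms by (simp add: powr_def field_simps)
  finally show ?thesis using False assms by (simp add: algebra_simps)
qed

text \<open>The function \<open>W\<close> below is the signed distance of \<open>f powr s\<close> from the tangent at the mean. It
  is nonnegative and vanishes only where \<open>f\<close> equals its mean, so its expectation, which is the
  Jensen gap, is zero only if \<open>f\<close> is almost surely constant.\<close>

lemma (in prob_space) powr_jensen:
  fixes f :: "'a \<Rightarrow> real" and s \<mu> :: real
  assumes f: "\<And>x. 0 < f x" "integrable M f" "integrable M (\<lambda>x. f x powr s)" "expectation f = \<mu>"
    and s: "0 < s" "s \<noteq> 1"
  shows "0 \<le> sgn (s - 1) * (expectation (\<lambda>x. f x powr s) - \<mu> powr s)"
    and "\<not> (AE x in M. f x = \<mu>) \<Longrightarrow>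
      0 < sgn (s - 1) * (expectation (\<lambda>x. f x powr s) - \<mu> powr s)"
proof -
  have \<mu>: "0 < \<mu>"
  proof -
    have "\<mu> \<ge> 0" using f(1) unfolding f(4)[symmetric] by (intro integral_nonneg_AE) (auto simp: less_imp_le)
    moreover have "\<mu> \<noteq> 0"
    proof
      assume "\<mu> = 0"
      then have "AE x in M. f x = 0"
        using integral_nonneg_eq_0_iff_AE[OF f(2)] f(1,4) by (simp add: less_imp_le)
      then have "AE x in M. False"
        by eventually_elim (use f(1) less_irrefl in metis)
      then show False by simp
    qed
    ultimately show ?thesis by simp
  qed
  define W where "W x = sgn (s - 1) * (f x powr s - \<mu> powr s - s * \<mu> powr (s - 1) * (f x - \<mu>))" for x
  have W_eq: "W x = \<mu> powr s * (sgn (s - 1) * ((f x / \<mu>) powr s - 1 - s * (f x / \<mu> - 1)))" for x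
    using \<mu> f(1)[of x] unfolding W_def by (simp add: powr_divide powr_diff field_simps)
  have W_pos: "0 < W x" if "f x \<noteq> \<mu>" for x
    unfolding W_eq using \<mu> f(1)[of x] that s by (intro mult_pos_pos powr_bernoulli) (auto simp: field_simps)
  have W_nonneg: "0 \<le> W x" for x
    using W_pos[of x] by (cases "f x = \<mu>") (auto simp: W_def)
  have W_int: "integrable M W" unfolding W_def using f by auto
  have E: "expectation W = sgn (s - 1) * (expectation (\<lambda>x. f x powr s) - \<mu> powr s)"
    unfolding W_def using f by (simp add: prob_space)
  show "0 \<le> sgn (s - 1) * (expectation (\<lambda>x. f x powr s) - \<mu> powr s)"
    unfolding E[symmetric] using W_nonneg by simp
  assume "\<not> (AE x in M. f x = \<mu>)"
  then have "\<not> (AE x in M. W x = 0)"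
  proof (rule contrapos_nn)
    assume "AE x in M. W x = 0"
    then show "AE x in M. f x = \<mu>"
      by eventually_elim (use W_pos less_irrefl in metis)
  qed
  then have "expectation W \<noteq> 0"
    using integral_nonneg_eq_0_iff_AE[OF W_int] W_nonneg by auto
  then show "0 < sgn (s - 1) * (expectation (\<lambda>x. f x powr s) - \<mu> powr s)"
    using W_nonneg E integral_nonneg_AE[of W M] by (auto simp: order_less_le)
qed

section \<open>First passage for Markov additive kernels\<close>

lemma integral_indicator_pos:
  fixes g :: "'b \<Rightarrow> real"
  assumes "integrable M (\<lambda>w. g w * indicator A w)" "\<And>w. 0 < g w" "A \<in> sets M" "measure M A > 0"
  shows "0 < (\<integral>w. g w * indicator A w \<partial>M)"
proof -
  have "(\<integral>w. g w * indicator A w \<partial>M) \<noteq> 0"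
  proof
    assume "(\<integral>w. g w * indicator A w \<partial>M) = 0"
    then have "AE w in M. g w * indicator A w = 0"
      using assms integral_nonneg_eq_0_iff_AE[OF assms(1)] by (auto simp: less_imp_le)
    then have "AE w in M. w \<notin> A"
      by eventually_elim (use assms(2) in \<open>auto simp: indicator_def less_le split: if_splits\<close>)
    then have "emeasure M A = 0"
      using assms(3) AE_iff_null_sets by blast
    then show False using assms(4) by (simp add: measure_def)
  qed
  moreover have "(\<integral>w. g w * indicator A w \<partial>M) \<ge> 0"
    using assms(2) by (intro integral_nonneg_AE) (auto simp: less_imp_le)
  ultimately show ?thesis by simp
qed

abbreviation jump :: "'x \<times> real \<times> real \<Rightarrow> real" where "jump w \<equiv> fst (snd w)"
abbreviation load :: "'x \<times> real \<times> real \<Rightarrow> real" where "load w \<equiv> snd (snd w)"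

text \<open>\<open>P x\<close> is the law of one transition from the state \<open>x\<close> of a Markov additive process: the next
  state, the jump of the random walk \<open>S\<close>, and the load, which enters \<open>D\<close> with the
  factor \<open>\<Delta> exp S\<close>.\<close>

locale additive_kernel =
  fixes P :: "'x::finite \<Rightarrow> ('x \<times> real \<times> real) measure" and m :: real
  assumes prob_P: "prob_space (P x)"
    and sets_P [measurable_cong]: "sets (P x) = sets step_space"
    and irreducible: "(x, y) \<in> {(x, y). 0 < measure (P x) {w. fst w = y}}\<^sup>*"
    and load_range: "AE w in P x. 0 \<le> load w \<and> load w < m"
begin

lemma space_P [simp]: "space (P x) = UNIV"
  using sets_eq_imp_space_eq[OF sets_P[of x]] by (simp add: space_pair_measure)

lemma next_measurable [measurable]: "fst \<in> measurable (P x) (count_space UNIV)"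
  by measurable

lemma sets_next [measurable]: "{w. fst w = y} \<in> sets (P x)"
proof -
  have "fst -` {y} \<inter> space (P x) \<in> sets (P x)" by (rule measurable_sets[OF next_measurable]) auto
  then show ?thesis by (simp add: vimage_def)
qed

lemma next_fun_measurable [measurable]: "(\<lambda>w. f (fst w)) \<in> borel_measurable (P x)"
  for f :: "'x \<Rightarrow> real"
  by (rule measurable_compose[OF next_measurable]) auto

text \<open>Integrals of a weight times a function of the next state are products with a matrix, so the
  results on irreducible matrices apply to tilted kernels.\<close>

lemma weighted_matrix:
  fixes g :: "'x \<times> real \<times> real \<Rightarrow> real"
  assumes g: "integrable (P x) g"
  shows "integrable (P x) (\<lambda>w. g w * f (fst w))"
    and "matrix_apply (\<lambda>x y. \<integral>w. g w * indicator {w. fst w = y} w \<partial>P x) f x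
      = (\<integral>w. g w * f (fst w) \<partial>P x)"
proof -
  have eq: "g w * f (fst w) = (\<Sum>y\<in>UNIV. g w * indicator {w. fst w = y} w * f y)" for w
  proof -
    have "(\<Sum>y\<in>UNIV. g w * indicator {w. fst w = y} w * f y)
        = (\<Sum>y\<in>UNIV. if y = fst w then g w * f y else 0)"
      by (intro sum.cong) auto
    then show ?thesis by simp
  qed
  have int: "integrable (P x) (\<lambda>w. g w * indicator {w. fst w = y} w)" for y
    by (intro integrable_mult_indicator[where 'b=real, simplified mult.commute real_scaleR_def] g sets_next)
  show "integrable (P x) (\<lambda>w. g w * f (fst w))"
    unfolding eq by (intro Bochner_Integration.integrable_sum integrable_mult_left int)
  show "matrix_apply (\<lambda>x y. \<integral>w. g w * indicator {w. fst w = y} w \<partial>P x) f x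
      = (\<integral>w. g w * f (fst w) \<partial>P x)"
    unfolding eq matrix_apply_def using int
    by (subst Bochner_Integration.integral_sum) auto
qed

lemma weighted_matrix_irreducible:
  fixes g :: "'x \<times> real \<times> real \<Rightarrow> real"
  assumes g: "\<And>x. integrable (P x) g" "\<And>w. 0 < g w"
  shows "0 \<le> (\<integral>w. g w * indicator {w. fst w = y} w \<partial>P x)"
    and "(x, y) \<in> {(x, y). 0 < (\<integral>w. g w * indicator {w. fst w = y} w \<partial>P x)}\<^sup>*"
proof -
  have int: "integrable (P x) (\<lambda>w. g w * indicator {w. fst w = y} w)" for x y
    by (intro integrable_mult_indicator[where 'b=real, simplified mult.commute real_scaleR_def] g sets_next)
  show "0 \<le> (\<integral>w. g w * indicator {w. fst w = y} w \<partial>P x)"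
    using g(2) by (intro integral_nonneg_AE) (auto simp: less_imp_le)
  have "{(x, y). 0 < measure (P x) {w. fst w = y}}
      \<subseteq> {(x, y). 0 < (\<integral>w. g w * indicator {w. fst w = y} w \<partial>P x)}"
    using integral_indicator_pos[OF int g(2) sets_next] by auto
  from rtrancl_mono[OF this]
  show "(x, y) \<in> {(x, y). 0 < (\<integral>w. g w * indicator {w. fst w = y} w \<partial>P x)}\<^sup>*"
    using irreducible by blast
qed

text \<open>\<open>exceed n x c e\<close> is the probability that \<open>n\<close> transitions from \<open>x\<close> bring the sum of
  \<open>load * c * exp S\<close> above \<open>e\<close>, computed by conditioning on the first transition. The scale
  \<open>c = \<Delta> exp S\<close> and the residual level \<open>e = b - D\<close> carry everything that the future needs to know of
  the past, so the recursion does not mention \<open>\<Delta>\<close> or the level \<open>b\<close>.\<close>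

primrec exceed :: "nat \<Rightarrow> 'x \<Rightarrow> real \<Rightarrow> real \<Rightarrow> real" where
  "exceed 0 x c e = (if e < 0 then 1 else 0)"
| "exceed (Suc n) x c e =
    (\<integral>w. exceed n (fst w) (c * exp (jump w)) (e - load w * (c * exp (jump w))) \<partial>P x)"

abbreviation "exceed_next n c e w \<equiv> exceed n (fst w) (c * exp (jump w)) (e - load w * (c * exp (jump w)))"

declare exceed.simps(2) [simp del]

lemma exceed_measurable_joint:
  "(\<lambda>w. exceed n (fst w) (jump w) (load w)) \<in> borel_measurable step_space"
proof (induction n)
  case (Suc n)
  have *: "(\<lambda>w. \<integral>w'. exceed n (fst w') (jump w * exp (jump w'))
      (load w - load w' * (jump w * exp (jump w'))) \<partial>P x) \<in> borel_measurable step_space" for x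
  proof -
    interpret prob_space "P x" by (rule prob_P)
    have "(\<lambda>v. (fst (snd v), jump (fst v) * exp (jump (snd v)),
         load (fst v) - load (snd v) * (jump (fst v) * exp (jump (snd v)))))
       \<in> measurable (step_space \<Otimes>\<^sub>M P x) step_space" by measurable
    from measurable_compose[OF this Suc]
    have "(\<lambda>(w, w'). exceed n (fst w') (jump w * exp (jump w'))
      (load w - load w' * (jump w * exp (jump w')))) \<in> borel_measurable (step_space \<Otimes>\<^sub>M P x)"
      by (simp add: split_beta')
    from borel_measurable_lebesgue_integral[OF this] show ?thesis .
  qed
  show ?case
    unfolding exceed.simps(2)
    by (rule measurable_compose_countable[where g = fst
        and f = "\<lambda>x w. \<integral>w'. exceed n (fst w') (jump w * exp (jump w'))
          (load w - load w' * (jump w * exp (jump w'))) \<partial>P x", OF *]) simp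
qed simp

lemma exceed_measurable [measurable (raw)]:
  assumes "X \<in> measurable M (count_space UNIV)" "c \<in> borel_measurable M" "e \<in> borel_measurable M"
  shows "(\<lambda>\<omega>. exceed n (X \<omega>) (c \<omega>) (e \<omega>)) \<in> borel_measurable M"
proof -
  have "(\<lambda>\<omega>. (X \<omega>, c \<omega>, e \<omega>)) \<in> measurable M step_space" using assms by measurable
  from measurable_compose[OF this exceed_measurable_joint[of n]] show ?thesis by simp
qed

lemma exceed_bounds: "0 \<le> exceed n x c e" "exceed n x c e \<le> 1"
  and exceed_step_integrable:
    "integrable (P x) (\<lambda>w. exceed_next n c e w)"
proof -
  have *: "0 \<le> exceed n x c e \<and> exceed n x c e \<le> 1 \<and> integrable (P x)
     (\<lambda>w. exceed_next n c e w)"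
  proof (induction n arbitrary: x c e)
    case 0
    interpret prob_space "P x" by (rule prob_P)
    show ?case by (auto intro!: integrable_const_bound[of _ 1])
  next
    case (Suc n)
    have le1: "exceed (Suc n) x c e \<le> 1 \<and> 0 \<le> exceed (Suc n) x c e" for x c e
    proof -
      interpret prob_space "P x" by (rule prob_P)
      show ?thesis using Suc by (auto simp: exceed.simps(2) intro!: integral_le_const)
    qed
    interpret prob_space "P x" by (rule prob_P)
    show ?case using le1
      by (intro conjI integrable_const_bound[of _ 1]) auto
  qed
  then show "0 \<le> exceed n x c e" "exceed n x c e \<le> 1"
    "integrable (P x) (\<lambda>w. exceed_next n c e w)"
    by blast+
qed

text \<open>Loads are nonnegative, so a level once exceeded stays exceeded.\<close>

lemma exceed_mono_Suc: "0 \<le> c \<Longrightarrow> exceed n x c e \<le> exceed (Suc n) x c e"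
proof (induction n arbitrary: x c e)
  case 0
  interpret prob_space "P x" by (rule prob_P)
  show ?case
  proof (cases "e < 0")
    case True
    have "AE w in P x. exceed_next 0 c e w = 1"
      using load_range[of x]
    proof eventually_elim
      case (elim w)
      then have "0 \<le> load w * (c * exp (jump w))" using 0 by auto
      then show ?case using True by auto
    qed
    then have "exceed (Suc 0) x c e = (\<integral>w. 1 \<partial>P x)"
      unfolding exceed.simps(2) by (intro integral_cong_AE) auto
    then show ?thesis using True prob_space by simp
  next
    case False
    then show ?thesis using exceed_bounds(1)[of "Suc 0"] by simp
  qed
next
  case (Suc n)
  show ?case
    by (subst (1 2) exceed.simps(2), rule integral_mono)
      (use Suc in \<open>auto intro: exceed_step_integrable\<close>)
qed

lemma exceed_mono: "0 \<le> c \<Longrightarrow> n \<le> k \<Longrightarrow> exceed n x c e \<le> exceed k x c e"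
  by (rule lift_Suc_mono_le[of "\<lambda>n. exceed n x c e"]) (auto intro: exceed_mono_Suc)

end

section \<open>Strictly sub- and superharmonic functions\<close>

lemma finite_upper_bound:
  fixes f :: "'x::finite \<Rightarrow> real"
  obtains b where "0 < b" "\<And>x. f x \<le> b"
proof
  show "f x \<le> max 1 (Max (range f))" for x by (intro max.coboundedI2) simp
qed simp

text \<open>The eigenvector equation at the Cramer exponent \<open>\<theta>\<close> says that \<open>exp (\<theta> S\<^sub>n) u (X\<^sub>n)\<close> is a
  martingale; some larger exponent \<open>\<theta>'\<close> still has finite moments.\<close>

locale cramer_kernel = additive_kernel P m
  for P :: "'x::finite \<Rightarrow> ('x \<times> real \<times> real) measure" and m :: real +
  fixes \<theta> \<theta>' :: real and u :: "'x \<Rightarrow> real"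
  assumes theta: "0 < \<theta>" "\<theta> < \<theta>'"
    and u_pos: "0 < u x"
    and harmonic: "(\<integral>w. exp (\<theta> * jump w) * u (fst w) \<partial>P x) = u x"
    and exp_moment: "integrable (P x) (\<lambda>w. exp (\<theta>' * jump w))"
begin

lemma exp_integrable:
  assumes "0 \<le> p" "p \<le> \<theta>'"
  shows "integrable (P x) (\<lambda>w. exp (p * jump w))"
proof -
  interpret prob_space "P x" by (rule prob_P)
  have bound: "exp (p * z) \<le> 1 + exp (\<theta>' * z)" for z :: real
  proof (cases "0 \<le> z")
    case True
    then have "p * z \<le> \<theta>' * z" using assms by (intro mult_right_mono) auto
    then have "exp (p * z) \<le> exp (\<theta>' * z)" by simp
    then show ?thesis by (simp add: add_increasing)
  next
    case False
    then have "p * z \<le> 0" using assms by (intro mult_nonneg_nonpos) auto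
    then have "exp (p * z) \<le> 1" by simp
    then show ?thesis by (simp add: add_increasing2)
  qed
  show ?thesis
  proof (rule Bochner_Integration.integrable_bound)
    show "integrable (P x) (\<lambda>w. 1 + exp (\<theta>' * jump w))" by (simp add: exp_moment)
  qed (use bound in \<open>auto simp: add_pos_pos\<close>)
qed

text \<open>The martingale \<open>exp (\<theta> S\<^sub>n) u (X\<^sub>n)\<close> is almost surely constant. Then \<open>S\<close> is a function of the
  initial and the current state, and the spectral radius equals \<open>1\<close> for every exponent between \<open>0\<close> and \<open>\<theta>\<close>.\<close>

definition degenerate :: bool where
  "degenerate \<longleftrightarrow> (\<forall>x. AE w in P x. exp (\<theta> * jump w) * u (fst w) = u x)"

text \<open>This is the elementary substitute for strict convexity of the logarithm of the spectral radius.
  By Jensen's inequality the power \<open>u powr (p / \<theta>)\<close> is subharmonic for the kernel with weight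
  \<open>exp (p * jump)\<close> if \<open>p > \<theta>\<close> and superharmonic if \<open>p < \<theta>\<close>. Outside the degenerate case one state
  has a strict gap, and irreducibility spreads it.\<close>

lemma strictly_sub_superharmonic:
  assumes "\<not> degenerate" "0 < p" "p < \<theta>'" "p \<noteq> \<theta>"
  obtains v d where "0 < d" "\<And>x. 0 < v x"
    "\<And>x. d * v x \<le> sgn (p - \<theta>) * ((\<integral>w. exp (p * jump w) * v (fst w) \<partial>P x) - v x)"
proof -
  define s where "s = p / \<theta>"
  define R where "R x y = (\<integral>w. exp (p * jump w) * indicator {w. fst w = y} w \<partial>P x)" for x y
  have int: "integrable (P x) (\<lambda>w. exp (p * jump w))" for x
    using assms by (intro exp_integrable) auto
  have R: "0 \<le> R x y" "(x, y) \<in> {(x, y). 0 < R x y}\<^sup>*" for x y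
    unfolding R_def using weighted_matrix_irreducible[OF int] by simp_all
  have R_apply: "matrix_apply R f x = (\<integral>w. exp (p * jump w) * f (fst w) \<partial>P x)" for f x
    using weighted_matrix(2)[OF int] unfolding R_def by blast
  have s: "0 < s" "s \<noteq> 1" "sgn (p - \<theta>) = sgn (s - 1)"
    using assms theta by (auto simp: s_def sgn_if field_simps)
  have powr_eq: "(exp (\<theta> * jump w) * u (fst w)) powr s = exp (p * jump w) * u (fst w) powr s" for w
    using theta u_pos by (simp add: powr_mult s_def less_imp_le exp_powr_real)
  have jensen: "0 \<le> sgn (p - \<theta>) * (matrix_apply R (\<lambda>y. u y powr s) x - u x powr s)"
    "\<not> (AE w in P x. exp (\<theta> * jump w) * u (fst w) = u x) \<Longrightarrow>
      0 < sgn (p - \<theta>) * (matrix_apply R (\<lambda>y. u y powr s) x - u x powr s)" for x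
  proof -
    interpret prob_space "P x" by (rule prob_P)
    have f: "integrable (P x) (\<lambda>w. exp (\<theta> * jump w) * u (fst w))"
      using theta by (intro weighted_matrix exp_integrable) auto
    have fs: "integrable (P x) (\<lambda>w. (exp (\<theta> * jump w) * u (fst w)) powr s)"
      unfolding powr_eq by (rule weighted_matrix(1)[OF int])
    note J = powr_jensen[OF _ f fs harmonic s(1,2)]
    show "0 \<le> sgn (p - \<theta>) * (matrix_apply R (\<lambda>y. u y powr s) x - u x powr s)"
      using J(1) u_pos unfolding powr_eq R_apply s(3) by simp
    show "0 < sgn (p - \<theta>) * (matrix_apply R (\<lambda>y. u y powr s) x - u x powr s)"
      if "\<not> (AE w in P x. exp (\<theta> * jump w) * u (fst w) = u x)"
      using J(2) u_pos that unfolding powr_eq R_apply s(3) by simp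
  qed
  obtain x0 where x0: "\<not> (AE w in P x0. exp (\<theta> * jump w) * u (fst w) = u x0)"
    using assms(1) unfolding degenerate_def by blast
  have up: "0 < u x powr s" for x using u_pos[of x] by simp
  obtain d v where "0 < d" "\<And>x. 0 < v x" "\<And>x. d * v x \<le> sgn (p - \<theta>) * (matrix_apply R v x - v x)"
    by (rule strict_spread[OF R up jensen(1) jensen(2)[OF x0]], rule that)
  then show ?thesis unfolding R_apply by (rule that)
qed

end

text \<open>The lower power wins near \<open>0\<close> and the higher one near infinity; the switch is at \<open>t1\<close>.\<close>

lemma powr_interpolation:
  fixes p q s A B :: real
  assumes "s < p" "p < q" "0 < A" "0 < B"
  obtains C where "0 < C" "\<And>t. 0 < t \<Longrightarrow> B * t powr p \<le> A * t powr s + C * t powr q"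
proof
  define t1 where "t1 = (A / B) powr (1 / (p - s))"
  have t1: "0 < t1" using assms by (simp add: t1_def)
  show "0 < B * t1 powr (p - q)" using assms t1 by simp
  fix t :: real assume t: "0 < t"
  show "B * t powr p \<le> A * t powr s + B * t1 powr (p - q) * t powr q"
  proof (cases "t \<le> t1")
    case True
    have "t powr (p - s) \<le> t1 powr (p - s)" using True t assms by (intro powr_mono2) auto
    also have "\<dots> = A / B" using assms by (simp add: t1_def powr_powr)
    finally have "B * t powr (p - s) * t powr s \<le> A * t powr s"
      using assms by (intro mult_right_mono) (auto simp: field_simps)
    then have "B * t powr p \<le> A * t powr s" by (simp add: mult.assoc powr_add[symmetric])
    moreover have "0 \<le> B * t1 powr (p - q) * t powr q" using assms by simp
    ultimately show ?thesis by linarith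
  next
    case False
    have "t powr (p - q) \<le> t1 powr (p - q)" using False t1 assms by (intro powr_mono2') auto
    then have "B * (t powr (p - q) * t powr q) \<le> B * (t1 powr (p - q) * t powr q)"
      using assms by (intro mult_left_mono mult_right_mono) auto
    then have "B * t powr p \<le> B * t1 powr (p - q) * t powr q" by (simp add: powr_add[symmetric] mult.assoc)
    moreover have "0 \<le> A * t powr s" using assms by simp
    ultimately show ?thesis by linarith
  qed
qed

lemma powr_eventually_small:
  fixes p e :: real
  assumes "0 < p" "0 < e"
  shows "\<forall>\<^sub>F r in at_right 0. r powr p < e"
proof -
  have "((\<lambda>r. r powr p) \<longlongrightarrow> 0 powr p) (at_right 0)"
    by (rule tendsto_powr2) (use assms in \<open>auto intro: tendsto_ident_at eventually_at_right_less[THEN eventually_mono]\<close>)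
  then show ?thesis using order_tendstoD(2)[of _ "0 powr p" _ e] assms by simp
qed

section \<open>The upper tail bound\<close>

text \<open>One transition turns the ratio \<open>r = c / e\<close> of scale and residual level into \<open>\<rho>\<close> when the walk
  jumps, and then into \<open>\<rho> / (1 - \<rho> l)\<close> when the load is paid. If the new ratio is at most \<open>r0\<close>,
  the load changes \<open>u \<rho>\<^sup>\<theta>\<close> by a relative amount of order \<open>\<rho>\<close>, and \<open>q \<le> \<theta> + 1\<close> lets \<open>C1 \<rho>\<^sup>q\<close>
  absorb it. Otherwise \<open>\<rho> \<ge> r0 / 2\<close>, and the right-hand side is at least \<open>k\<close> because
  \<open>C2 \<rho>\<^sup>q\<close> makes up for the subtracted power.\<close>

lemma residual_step_bound:
  fixes \<theta> p q m u v k r0 C1 C2 \<rho> l F :: real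
  assumes exps: "0 < \<theta>" "\<theta> < p" "p < q" "q \<le> \<theta> + 1"
    and uv: "0 < u" "0 < v" and F: "F \<le> 1"
    and r0: "0 < r0" "r0 \<le> 1" "m * r0 \<le> 1" and k: "0 < k" "k \<le> u / 2 * (r0 / 2) powr \<theta>"
    and C1: "0 \<le> C1" "u * (2 * m * \<theta> * exp (2 * \<theta>)) \<le> C1"
    and C2: "0 \<le> C2" "\<And>t. 0 < t \<Longrightarrow> v * t powr p \<le> u / 2 * t powr \<theta> + C2 * t powr q"
    and \<rho>: "0 < \<rho>" and l: "0 \<le> l" "l < m"
    and small: "\<rho> * l < 1 \<Longrightarrow> \<rho> / (1 - \<rho> * l) \<le> r0 \<Longrightarrow>
      k * F \<le> u * (\<rho> / (1 - \<rho> * l)) powr \<theta> - v * (\<rho> / (1 - \<rho> * l)) powr p"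
  shows "k * F \<le> u * \<rho> powr \<theta> - v * \<rho> powr p + (C1 + C2) * \<rho> powr q"
proof -
  define r1 where "r1 = \<rho> / (1 - \<rho> * l)"
  have m: "0 < m" using l by simp
  have \<rho>q: "0 \<le> \<rho> powr q" by simp
  show ?thesis
  proof (cases "\<rho> * l < 1 \<and> r1 \<le> r0")
    case True
    then have kF: "k * F \<le> u * r1 powr \<theta> - v * r1 powr p" using small by (simp add: r1_def)
    have "0 \<le> \<rho> * l" using \<rho> l by simp
    with True \<rho> have r1: "0 < r1" "\<rho> \<le> r1"
      by (auto simp: r1_def pos_le_divide_eq intro: mult_left_le)
    (* Solving for rho shows how little the load can enlarge a small ratio. *)
    have r1_eq: "r1 = \<rho> * (1 + l * r1)"
      using True \<rho> by (simp add: r1_def field_simps)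
    have "m * r1 \<le> m * r0" using True m by (intro mult_left_mono) auto
    moreover have "l * r1 \<le> m * r1" using l r1 by (intro mult_right_mono) auto
    ultimately have lr1: "l * r1 \<le> 1" using r0 by linarith
    have r1_2: "r1 \<le> 2 * \<rho>"
      using r1_eq mult_left_mono[of "1 + l * r1" 2 \<rho>] lr1 \<rho> by simp
    have "l * r1 \<le> m * (2 * \<rho>)" using l r1 r1_2 m by (intro mult_mono) auto
    then have "r1 \<le> \<rho> * (1 + 2 * m * \<rho>)"
      using r1_eq mult_left_mono[of "1 + l * r1" "1 + 2 * m * \<rho>" \<rho>] \<rho> by simp
    also have "\<dots> \<le> \<rho> * exp (2 * m * \<rho>)"
      using \<rho> by (intro mult_left_mono) auto
    finally have "r1 powr \<theta> \<le> (\<rho> * exp (2 * m * \<rho>)) powr \<theta>"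
      using r1 exps by (intro powr_mono2) auto
    also have "\<dots> = \<rho> powr \<theta> * exp (2 * m * \<rho> * \<theta>)"
      using \<rho> by (simp add: powr_mult exp_powr_real)
    finally have r1_exp: "r1 powr \<theta> \<le> \<rho> powr \<theta> * exp (2 * m * \<rho> * \<theta>)" .
    have exp_le: "exp (2 * m * \<rho> * \<theta>) \<le> 1 + 2 * m * \<rho> * \<theta> * exp (2 * \<theta>)"
    proof -
      define y where "y = 2 * m * \<rho> * \<theta>"
      have "\<rho> \<le> r0" using True r1 by linarith
      then have "m * \<rho> \<le> m * r0" using m by (intro mult_left_mono) auto
      then have "m * \<rho> \<le> 1" using r0 by linarith
      then have "m * \<rho> * (2 * \<theta>) \<le> 1 * (2 * \<theta>)" using exps by (intro mult_right_mono) auto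
      then have y: "0 \<le> y" "y \<le> 2 * \<theta>" using m \<rho> exps by (auto simp: y_def algebra_simps)
      have "exp y * (1 - y) \<le> exp y * exp (- y)"
        using exp_ge_add_one_self[of "- y"] by (intro mult_left_mono) auto
      then have "exp y \<le> 1 + y * exp y" by (simp add: exp_minus algebra_simps)
      also have "y * exp y \<le> y * exp (2 * \<theta>)" using y by (intro mult_left_mono) auto
      finally show ?thesis by (simp add: y_def)
    qed
    have "u * r1 powr \<theta> \<le> u * (\<rho> powr \<theta> * (1 + 2 * m * \<rho> * \<theta> * exp (2 * \<theta>)))"
      using uv by (intro mult_left_mono order_trans[OF r1_exp] exp_le) auto
    also have "\<dots> = u * \<rho> powr \<theta> + u * (2 * m * \<theta> * exp (2 * \<theta>)) * (\<rho> powr (\<theta> + 1))"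
      using \<rho> by (simp add: powr_add algebra_simps)
    also have "u * (2 * m * \<theta> * exp (2 * \<theta>)) * (\<rho> powr (\<theta> + 1)) \<le> C1 * \<rho> powr q"
    proof (intro mult_mono C1)
      have "\<rho> \<le> 1" using True r1 r0 by linarith
      then show "\<rho> powr (\<theta> + 1) \<le> \<rho> powr q" using \<rho> exps by (intro powr_mono') auto
    qed (auto simp: C1)
    finally have "u * r1 powr \<theta> \<le> u * \<rho> powr \<theta> + C1 * \<rho> powr q" by simp
    moreover have "v * \<rho> powr p \<le> v * r1 powr p"
      using uv \<rho> r1 exps by (intro mult_left_mono powr_mono2) auto
    moreover have "0 \<le> C2 * \<rho> powr q" using C2 by simp
    ultimately show ?thesis using kF by (simp add: algebra_simps)
  next
    case False
    have "r0 / 2 \<le> \<rho>"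
    proof (rule ccontr)
      assume "\<not> r0 / 2 \<le> \<rho>"
      then have *: "\<rho> < r0 / 2" by simp
      have "\<rho> * l \<le> r0 / 2 * m" using * l \<rho> by (intro mult_mono) auto
      then have half: "\<rho> * l \<le> 1 / 2" using r0 by (simp add: mult.commute)
      then have "r1 \<le> \<rho> / (1 / 2)" unfolding r1_def using \<rho> by (intro divide_left_mono) auto
      then have "r1 \<le> r0" using * by simp
      then show False using False half by auto
    qed
    then have "(r0 / 2) powr \<theta> \<le> \<rho> powr \<theta>" using r0 exps by (intro powr_mono2) auto
    then have "u / 2 * (r0 / 2) powr \<theta> \<le> u / 2 * \<rho> powr \<theta>" using uv by (intro mult_left_mono) auto
    moreover have "k * F \<le> k" using F k by simp
    ultimately have "k * F \<le> u / 2 * \<rho> powr \<theta>" using k by linarith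
    moreover have "v * \<rho> powr p \<le> u / 2 * \<rho> powr \<theta> + C2 * \<rho> powr q" using C2(2) \<rho> by blast
    moreover have "0 \<le> C1 * \<rho> powr q" using C1 by simp
    ultimately show ?thesis by (simp add: algebra_simps)
  qed
qed

lemma exp_powr_scale: "0 < r \<Longrightarrow> (r * exp z) powr p = r powr p * exp (p * z)" for r z p :: real
  by (simp add: powr_mult exp_powr_real mult.commute)

context cramer_kernel
begin

lemma obtain_exponents:
  obtains p q where "\<theta> < p" "p < q" "q \<le> \<theta> + 1" "q < \<theta>'"
proof
  define \<epsilon> where "\<epsilon> = min 1 ((\<theta>' - \<theta>) / 2)"
  have "0 < \<epsilon>" "\<epsilon> \<le> 1" "\<epsilon> < \<theta>' - \<theta>" using theta by (auto simp: \<epsilon>_def min_def)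
  then show "\<theta> < \<theta> + \<epsilon> / 2" "\<theta> + \<epsilon> / 2 < \<theta> + \<epsilon>" "\<theta> + \<epsilon> \<le> \<theta> + 1" "\<theta> + \<epsilon> < \<theta>'"
    by auto
qed

lemma m_pos: "0 < m"
proof -
  obtain x :: 'x where True by simp
  interpret prob_space "P x" by (rule prob_P)
  have "AE w in P x. 0 < m" using load_range[of x] by eventually_elim auto
  then show ?thesis by simp
qed

text \<open>The function \<open>u r\<^sup>\<theta> - v r\<^sup>p\<close> of the ratio \<open>r = c / e\<close> is a supersolution of the recursion of
  \<open>exceed\<close> for small \<open>r\<close>: strict subharmonicity of \<open>v\<close> wins \<open>d v r\<^sup>p\<close> per step, and this
  pays for the errors of order \<open>r\<^sup>q\<close> with \<open>q > p\<close> that the loads and the truncation cause. Induction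
  on the horizon then bounds \<open>exceed\<close> uniformly. For ratios above \<open>r0\<close> the bound is trivial.\<close>

theorem exceed_upper_bound:
  assumes "\<not> degenerate"
  obtains C where "0 < C" "\<And>n x c e. 0 < c \<Longrightarrow> 0 < e \<Longrightarrow> exceed n x c e \<le> C * (c / e) powr \<theta>"
proof -
  obtain p q where pq: "\<theta> < p" "p < q" "q \<le> \<theta> + 1" "q < \<theta>'" by (rule obtain_exponents)
  obtain v d where vd: "0 < d" "\<And>x. 0 < v x"
    and v_sub0: "\<And>x. d * v x \<le> sgn (p - \<theta>) * ((\<integral>w. exp (p * jump w) * v (fst w) \<partial>P x) - v x)"
    by (rule strictly_sub_superharmonic[OF assms, of p]) (use pq theta in auto)
  have v_sub: "(1 + d) * v x \<le> (\<integral>w. exp (p * jump w) * v (fst w) \<partial>P x)" for x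
    using v_sub0[of x] pq by (simp add: algebra_simps)
  obtain u0 where u0: "0 < u0" "\<And>x. u0 \<le> u x" using finite_pos_lower_bound[of u] u_pos by auto
  obtain v0 where v0: "0 < v0" "\<And>x. v0 \<le> v x" using finite_pos_lower_bound[of v] vd by auto
  obtain v1 where v1: "0 < v1" "\<And>x. v x \<le> v1" using finite_upper_bound[of v] by auto
  obtain C1 where C1: "0 < C1" "\<And>x. u x * (2 * m * \<theta> * exp (2 * \<theta>)) \<le> C1"
    using finite_upper_bound[of "\<lambda>x. u x * (2 * m * \<theta> * exp (2 * \<theta>))"] by auto
  obtain C2 where C2: "0 < C2" "\<And>t. 0 < t \<Longrightarrow> v1 * t powr p \<le> u0 / 2 * t powr \<theta> + C2 * t powr q"
    using powr_interpolation[of \<theta> p q "u0 / 2" v1] pq u0 v1 by auto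
  have C2': "v x * t powr p \<le> u x / 2 * t powr \<theta> + C2 * t powr q" if "0 < t" for x t
  proof -
    have "v x * t powr p \<le> v1 * t powr p" using v1 by (intro mult_right_mono) auto
    also have "\<dots> \<le> u0 / 2 * t powr \<theta> + C2 * t powr q" using C2 that by blast
    also have "u0 / 2 * t powr \<theta> \<le> u x / 2 * t powr \<theta>" using u0 by (intro mult_right_mono) auto
    finally show ?thesis by simp
  qed
  obtain E where E: "0 < E" "\<And>x. (\<integral>w. exp (q * jump w) \<partial>P x) \<le> E"
    using finite_upper_bound[of "\<lambda>x. \<integral>w. exp (q * jump w) \<partial>P x"] by auto
  (* The threshold r0 has to make the supersolution nonnegative, let d * v * r powr p dominate the
     errors, and keep m * r0 below 1. *)
  have "\<forall>\<^sub>F r in at_right 0. (r::real) powr (p - \<theta>) < u0 / v1"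
    "\<forall>\<^sub>F r in at_right 0. (r::real) powr (q - p) < d * v0 / ((C1 + C2) * E)"
    "\<forall>\<^sub>F r in at_right 0. (r::real) powr 1 < 1"
    "\<forall>\<^sub>F r in at_right 0. (r::real) powr 1 < 1 / m"
    "\<forall>\<^sub>F r in at_right 0. (r::real) > 0"
    by (intro powr_eventually_small eventually_at_right_less divide_pos_pos mult_pos_pos add_pos_pos;
        use pq u0 v1 vd v0 C1 C2 E m_pos in simp)+
  then have "\<forall>\<^sub>F r in at_right (0::real). r powr (p - \<theta>) < u0 / v1
      \<and> r powr (q - p) < d * v0 / ((C1 + C2) * E) \<and> r powr 1 < 1 \<and> r powr 1 < 1 / m \<and> 0 < r"
    by (intro eventually_conj)
  then obtain r0 :: real where r0: "r0 powr (p - \<theta>) < u0 / v1"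
      "r0 powr (q - p) < d * v0 / ((C1 + C2) * E)" "r0 powr 1 < 1" "r0 powr 1 < 1 / m" "0 < r0"
    using eventually_happens'[OF trivial_limit_at_right_real] by blast
  then have r0': "r0 \<le> 1" "m * r0 \<le> 1" using m_pos by (auto simp: field_simps)
  define k where "k = u0 / 2 * (r0 / 2) powr \<theta>"
  have k: "0 < k" "\<And>x. k \<le> u x / 2 * (r0 / 2) powr \<theta>"
    using u0 r0 by (auto simp: k_def intro!: mult_right_mono)
  have main: "k * exceed n x c e \<le> u x * (c / e) powr \<theta> - v x * (c / e) powr p"
    if "0 < c" "0 < e" "c / e \<le> r0" for n x c e
    using that
  proof (induction n arbitrary: x c e)
    case 0
    define r where "r = c / e"
    have r: "0 < r" "r \<le> r0" using 0 by (auto simp: r_def)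
    have "r powr (p - \<theta>) \<le> r0 powr (p - \<theta>)" using r pq by (intro powr_mono2) auto
    then have "r powr (p - \<theta>) \<le> u0 / v1" using r0 by linarith
    then have "v1 * r powr (p - \<theta>) * r powr \<theta> \<le> u0 * r powr \<theta>"
      using v1 by (intro mult_right_mono) (auto simp: field_simps)
    then have "v1 * r powr p \<le> u0 * r powr \<theta>" by (simp add: mult.assoc powr_add[symmetric])
    moreover have "v x * r powr p \<le> v1 * r powr p" using v1 by (intro mult_right_mono) auto
    moreover have "u0 * r powr \<theta> \<le> u x * r powr \<theta>" using u0 by (intro mult_right_mono) auto
    ultimately have "v x * r powr p \<le> u x * r powr \<theta>" by linarith
    then show ?case using 0 by (simp add: r_def)
  next
    case (Suc n)
    define r where "r = c / e"
    have r: "0 < r" "r \<le> r0" using Suc by (auto simp: r_def)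
    let ?F = "\<lambda>w. exceed_next n c e w"
    let ?B = "\<lambda>w. r powr \<theta> * (exp (\<theta> * jump w) * u (fst w)) - r powr p * (exp (p * jump w) * v (fst w))
        + (C1 + C2) * r powr q * exp (q * jump w)"
    interpret prob_space "P x" by (rule prob_P)
    have ints: "integrable (P x) (\<lambda>w. exp (\<theta> * jump w) * u (fst w))"
      "integrable (P x) (\<lambda>w. exp (p * jump w) * v (fst w))"
      "integrable (P x) (\<lambda>w. exp (q * jump w))"
      using theta pq by (auto intro!: weighted_matrix exp_integrable)
    have "AE w in P x. k * ?F w \<le> ?B w"
      using load_range[of x]
    proof eventually_elim
      case (elim w)
      define \<rho> where "\<rho> = r * exp (jump w)"
      have \<rho>: "0 < \<rho>" using r by (simp add: \<rho>_def)
      have e\<rho>: "c * exp (jump w) = e * \<rho>" using Suc by (simp add: \<rho>_def r_def)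
      have res: "e - load w * (e * \<rho>) = e * (1 - \<rho> * load w)"
        by (simp add: algebra_simps)
      have "k * ?F w \<le> u (fst w) * \<rho> powr \<theta> - v (fst w) * \<rho> powr p + (C1 + C2) * \<rho> powr q"
      proof (rule residual_step_bound[OF theta(1) pq(1-3) u_pos vd(2) exceed_bounds(2) r0(5) r0' k
            less_imp_le[OF C1(1)] C1(2) less_imp_le[OF C2(1)] _ \<rho>])
        show "0 \<le> load w" "load w < m" using elim by auto
        show "v (fst w) * t powr p \<le> u (fst w) / 2 * t powr \<theta> + C2 * t powr q" if "0 < t" for t
          by (rule C2'[OF that])
        assume *: "\<rho> * load w < 1" "\<rho> / (1 - \<rho> * load w) \<le> r0"
        have "e * \<rho> / (e * (1 - \<rho> * load w)) = \<rho> / (1 - \<rho> * load w)"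
          using Suc.prems by simp
        then show "k * ?F w \<le> u (fst w) * (\<rho> / (1 - \<rho> * load w)) powr \<theta>
            - v (fst w) * (\<rho> / (1 - \<rho> * load w)) powr p"
          using Suc.IH[of "e * \<rho>" "e * (1 - \<rho> * load w)" "fst w"] Suc.prems(2) \<rho> *
          unfolding e\<rho> res by simp
      qed
      also have "\<dots> = ?B w" unfolding \<rho>_def using r by (simp add: exp_powr_scale algebra_simps)
      finally show ?case .
    qed
    then have "(\<integral>w. k * ?F w \<partial>P x) \<le> (\<integral>w. ?B w \<partial>P x)"
      by (intro integral_mono_AE integrable_mult_right exceed_step_integrable) (use ints in auto)
    then have "k * exceed (Suc n) x c e \<le> (\<integral>w. ?B w \<partial>P x)"
      by (simp add: exceed.simps(2))
    also have "\<dots> = r powr \<theta> * u x - r powr p * (\<integral>w. exp (p * jump w) * v (fst w) \<partial>P x)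
        + (C1 + C2) * r powr q * (\<integral>w. exp (q * jump w) \<partial>P x)"
      using ints by (simp add: harmonic)
    finally have step: "k * exceed (Suc n) x c e
        \<le> r powr \<theta> * u x - r powr p * (\<integral>w. exp (p * jump w) * v (fst w) \<partial>P x)
        + (C1 + C2) * r powr q * (\<integral>w. exp (q * jump w) \<partial>P x)" .
    have p_term: "r powr p * (\<integral>w. exp (p * jump w) * v (fst w) \<partial>P x) \<ge> r powr p * ((1 + d) * v x)"
      by (intro mult_left_mono v_sub) auto
    have q_term: "(C1 + C2) * r powr q * (\<integral>w. exp (q * jump w) \<partial>P x) \<le> d * v x * r powr p"
    proof -
      have "r powr (q - p) \<le> r0 powr (q - p)" using r pq by (intro powr_mono2) auto
      then have "r powr (q - p) \<le> d * v0 / ((C1 + C2) * E)" using r0 by linarith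
      moreover have "0 < (C1 + C2) * E" using C1 C2 E by simp
      ultimately have "(C1 + C2) * E * r powr (q - p) \<le> d * v0"
        by (simp only: pos_le_divide_eq mult.commute)
      then have "(C1 + C2) * E * r powr (q - p) * r powr p \<le> d * v0 * r powr p"
        by (rule mult_right_mono) simp
      then have "(C1 + C2) * E * r powr q \<le> d * v0 * r powr p"
        by (simp add: mult.assoc powr_add[symmetric])
      also have "\<dots> \<le> d * v x * r powr p" using vd v0 by (intro mult_right_mono mult_left_mono) auto
      finally have *: "(C1 + C2) * E * r powr q \<le> d * v x * r powr p" .
      have "(C1 + C2) * r powr q * (\<integral>w. exp (q * jump w) \<partial>P x) \<le> (C1 + C2) * r powr q * E"
        using C1 C2 E by (intro mult_left_mono) auto
      with * show ?thesis by (simp add: mult_ac)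
    qed
    have "k * exceed (Suc n) x c e
        \<le> r powr \<theta> * u x - r powr p * ((1 + d) * v x) + d * v x * r powr p"
      using step p_term q_term by linarith
    then show ?case by (simp add: r_def algebra_simps)
  qed
  obtain u1 where u1: "0 < u1" "\<And>x. u x \<le> u1" using finite_upper_bound[of u] by auto
  define C where "C = max (u1 / k) (1 / r0 powr \<theta>)"
  show ?thesis
  proof (rule that[of C])
    show "0 < C" using u1 k by (simp add: C_def less_max_iff_disj)
    fix n x and c e :: real assume ce: "0 < c" "0 < e"
    show "exceed n x c e \<le> C * (c / e) powr \<theta>"
    proof (cases "c / e \<le> r0")
      case True
      have "k * exceed n x c e \<le> u x * (c / e) powr \<theta> - v x * (c / e) powr p"
        by (rule main[OF ce True])
      also have "\<dots> \<le> u x * (c / e) powr \<theta>" using vd by (simp add: less_imp_le)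
      also have "\<dots> \<le> u1 * (c / e) powr \<theta>" using u1 by (intro mult_right_mono) auto
      finally have "exceed n x c e \<le> u1 / k * (c / e) powr \<theta>"
        using k by (simp add: field_simps)
      also have "\<dots> \<le> C * (c / e) powr \<theta>" by (intro mult_right_mono) (auto simp: C_def)
      finally show ?thesis .
    next
      case False
      then have "r0 powr \<theta> \<le> (c / e) powr \<theta>" using r0 theta by (intro powr_mono2) auto
      then have "1 \<le> 1 / r0 powr \<theta> * (c / e) powr \<theta>" using r0 by (simp add: field_simps)
      also have "\<dots> \<le> C * (c / e) powr \<theta>" by (intro mult_right_mono) (auto simp: C_def)
      finally show ?thesis using exceed_bounds(2)[of n x c e] by linarith
    qed
  qed
qed

end

section \<open>The lower tail bound\<close>

lemma (in finite_measure) positive_measure_UN: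
  fixes A :: "nat \<Rightarrow> 'a set"
  assumes A: "\<And>n. A n \<in> sets M" and pos: "0 < measure M (\<Union>n. A n)"
  shows "\<exists>n. 0 < measure M (A n)"
proof (rule ccontr)
  assume "\<not> ?thesis"
  then have "A n \<in> null_sets M" for n
    using A[of n] by (simp add: null_sets_def emeasure_eq_measure not_less measure_le_0_iff)
  then have "(\<Union>n. A n) \<in> null_sets M" by (rule null_sets_UN)
  then show False using pos by (simp add: null_sets_def measure_def)
qed

context additive_kernel
begin

lemma jump_sets: "A \<in> sets (P x) \<Longrightarrow> {w \<in> A. B < jump w} \<in> sets (P x)"
  using measurable_sets[of jump "P x" borel "{B <..}"]
  by (simp add: Collect_conj_eq vimage_def greaterThan_def sets.Int)

lemma load_sets: "{w. \<epsilon> < load w} \<in> sets (P x)"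
  using measurable_sets[of load "P x" borel "{\<epsilon> <..}"]
  by (simp add: vimage_def greaterThan_def)

lemma next_state_jump_bounded_below:
  assumes "0 < measure (P x) A" "A \<in> sets (P x)"
  obtains B where "0 < measure (P x) {w \<in> A. - B < jump w}"
proof -
  interpret P: prob_space "P x" by (rule prob_P)
  have "(\<Union>n::nat. {w \<in> A. - real n < jump w}) = A"
  proof safe
    fix w assume "w \<in> A"
    obtain n :: nat where "- jump w < real n" using reals_Archimedean2 by blast
    then have "- real n < jump w" by linarith
    then show "w \<in> (\<Union>n. {w \<in> A. - real n < jump w})" using \<open>w \<in> A\<close> by auto
  qed
  then obtain n where "0 < measure (P x) {w \<in> A. - real n < jump w}"
    using P.positive_measure_UN[of "\<lambda>n. {w \<in> A. - real n < jump w}"] assms jump_sets by auto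
  then show ?thesis by (rule that)
qed

lemma load_bounded_away:
  assumes "0 < measure (P x) {w. 0 < load w}"
  obtains \<epsilon> where "0 < \<epsilon>" "0 < measure (P x) {w. \<epsilon> < load w}"
proof -
  interpret P: prob_space "P x" by (rule prob_P)
  have "(\<Union>n. {w :: 'x \<times> real \<times> real. inverse (real (Suc n)) < load w}) = {w. 0 < load w}"
  proof (intro set_eqI iffI)
    fix w :: "'x \<times> real \<times> real" assume "w \<in> {w. 0 < load w}"
    then obtain n where "inverse (real (Suc n)) < load w" using reals_Archimedean[of "load w"] by auto
    then show "w \<in> (\<Union>n. {w. inverse (real (Suc n)) < load w})" by blast
  next
    fix w :: "'x \<times> real \<times> real" assume "w \<in> (\<Union>n. {w. inverse (real (Suc n)) < load w})"
    then obtain n where "inverse (real (Suc n)) < load w" by blast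
    moreover have "0 < inverse (real (Suc n))" by simp
    ultimately have "0 < load w" by (rule less_trans[rotated])
    then show "w \<in> {w. 0 < load w}" by simp
  qed
  then have "0 < measure (P x) (\<Union>n. {w. inverse (real (Suc n)) < load w})"
    using assms by (simp only:)
  from P.positive_measure_UN[OF load_sets this]
  obtain n where "0 < measure (P x) {w. inverse (real (Suc n)) < load w}" by blast
  then show ?thesis by (intro that[of "inverse (real (Suc n))"]) auto
qed

lemma exceed_Suc_ge:
  assumes A: "A \<in> sets (P x)" and \<epsilon>: "0 \<le> \<epsilon>"
    and ge: "\<And>w. w \<in> A \<Longrightarrow> 0 \<le> load w \<Longrightarrow>
      \<epsilon> \<le> exceed_next n c e w"
  shows "\<epsilon> * measure (P x) A \<le> exceed (Suc n) x c e"
proof -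
  interpret prob_space "P x" by (rule prob_P)
  have "\<epsilon> * measure (P x) A = (\<integral>w. \<epsilon> * indicator A w \<partial>P x)" using A by simp
  also have "\<dots> \<le> exceed (Suc n) x c e"
    unfolding exceed.simps(2)
  proof (rule integral_mono_AE)
    show "integrable (P x) (\<lambda>w. \<epsilon> * indicator A w)" using A
      by (intro integrable_mult_right integrable_real_indicator) (simp_all add: emeasure_eq_measure)
    show "AE w in P x. \<epsilon> * indicator A w
        \<le> exceed_next n c e w"
      using load_range[of x]
      by eventually_elim (use ge exceed_bounds in \<open>auto simp: indicator_def\<close>)
  qed (rule exceed_step_integrable)
  finally show ?thesis .
qed

text \<open>From every state the chain can reach a state that pays a load bounded away from \<open>0\<close>, while the
  walk drops by a bounded amount. If the scale is large enough, this single load exceeds the level.\<close>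

lemma exceed_uniform_lower:
  assumes "0 < measure (P x') {w. 0 < load w}"
  obtains N A \<kappa> where "0 < A" "0 < \<kappa>"
    "\<And>x c e. A \<le> c \<Longrightarrow> e \<le> 1 \<Longrightarrow> \<kappa> \<le> exceed N x c e"
proof -
  have "\<exists>N A \<kappa>. 0 < A \<and> 0 < \<kappa> \<and> (\<forall>c e. A \<le> c \<longrightarrow> e \<le> 1 \<longrightarrow> \<kappa> \<le> exceed N x c e)" for x
    using irreducible[of x x']
  proof (induction rule: converse_rtrancl_induct)
    case base
    obtain \<epsilon> where \<epsilon>: "0 < \<epsilon>" "0 < measure (P x') {w. \<epsilon> < load w}"
      using load_bounded_away[OF assms] by blast
    obtain B where B: "0 < measure (P x') {w \<in> {w. \<epsilon> < load w}. - B < jump w}"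
      using next_state_jump_bounded_below[OF \<epsilon>(2) load_sets] by blast
    show ?case
    proof (intro exI conjI allI impI)
      show "0 < 2 * exp B / \<epsilon>" using \<epsilon> by simp
      show "0 < 1 * measure (P x') {w \<in> {w. \<epsilon> < load w}. - B < jump w}" using B by simp
      fix c e :: real assume ce: "2 * exp B / \<epsilon> \<le> c" "e \<le> 1"
      show "1 * measure (P x') {w \<in> {w. \<epsilon> < load w}. - B < jump w} \<le> exceed (Suc 0) x' c e"
      proof (rule exceed_Suc_ge[OF jump_sets[OF load_sets]])
        fix w :: "'x \<times> real \<times> real" assume w: "w \<in> {w \<in> {w. \<epsilon> < load w}. - B < jump w}"
        have "\<epsilon> * (2 * exp B / \<epsilon> * exp (- B)) = 2" using \<epsilon> by (simp add: exp_minus)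
        then have "1 < \<epsilon> * (2 * exp B / \<epsilon> * exp (- B))" by simp
        also have "\<dots> \<le> load w * (c * exp (jump w))"
          using w ce \<epsilon> by (intro mult_mono) (auto intro: order_trans[of 0 "2 * exp B / \<epsilon>"])
        finally show "1 \<le> exceed_next 0 c e w"
          using ce by simp
      qed simp
    qed
  next
    case (step x y)
    then obtain N A \<kappa> where NA: "0 < A" "0 < \<kappa>" "\<And>c e. A \<le> c \<Longrightarrow> e \<le> 1 \<Longrightarrow> \<kappa> \<le> exceed N y c e" by blast
    obtain B where B: "0 < measure (P x) {w \<in> {w. fst w = y}. - B < jump w}"
      using next_state_jump_bounded_below[OF _ sets_next] step(1) by blast
    show ?case
    proof (intro exI conjI allI impI)
      show "0 < A * exp B" using NA by simp
      show "0 < \<kappa> * measure (P x) {w \<in> {w. fst w = y}. - B < jump w}" using B NA by simp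
      fix c e :: real assume ce: "A * exp B \<le> c" "e \<le> 1"
      have c: "0 < c" using ce(1) NA(1) by (meson exp_gt_zero less_le_trans mult_pos_pos)
      show "\<kappa> * measure (P x) {w \<in> {w. fst w = y}. - B < jump w} \<le> exceed (Suc N) x c e"
      proof (rule exceed_Suc_ge[OF jump_sets[OF sets_next]])
        fix w assume w: "w \<in> {w \<in> {w. fst w = y}. - B < jump w}" and l: "0 \<le> load w"
        have "A = A * exp B * exp (- B)" by (simp add: exp_minus)
        also have "\<dots> \<le> c * exp (jump w)" using w ce c by (intro mult_mono) auto
        finally have 1: "A \<le> c * exp (jump w)" .
        have "0 \<le> load w * (c * exp (jump w))" using l c by simp
        then have 2: "e - load w * (c * exp (jump w)) \<le> 1" using ce by linarith
        show "\<kappa> \<le> exceed N (fst w) (c * exp (jump w)) (e - load w * (c * exp (jump w)))"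
          using NA(3)[OF 1 2] w by simp
      qed (use NA in simp)
    qed
  qed
  then obtain N A \<kappa> where NA: "\<And>x. 0 < A x" "\<And>x. 0 < \<kappa> x"
    "\<And>x c e. A x \<le> c \<Longrightarrow> e \<le> 1 \<Longrightarrow> \<kappa> x \<le> exceed (N x) x c e" by metis
  obtain \<kappa>0 where k0: "0 < \<kappa>0" "\<And>x. \<kappa>0 \<le> \<kappa> x" using finite_pos_lower_bound[of \<kappa>] NA(2) by auto
  obtain A1 where A1: "0 < A1" "\<And>x. A x \<le> A1" using finite_upper_bound[of A] by auto
  show ?thesis
  proof (rule that[OF A1(1) k0(1)])
    fix x c and e :: real assume ce: "A1 \<le> c" "e \<le> 1"
    have "\<kappa>0 \<le> \<kappa> x" by (rule k0)
    also have "\<kappa> x \<le> exceed (N x) x c e" using NA(3)[of x c e] ce A1(2)[of x] by simp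
    also have "\<dots> \<le> exceed (Max (range N)) x c e"
      using ce A1 by (intro exceed_mono) auto
    finally show "\<kappa>0 \<le> exceed (Max (range N)) x c e" .
  qed
qed

end

context cramer_kernel
begin

text \<open>With \<open>t = c / A\<close>, the function \<open>u t\<^sup>\<theta> + v t\<^sup>p - k t\<^sup>q\<close> is a subsolution for \<open>t < 1\<close>, since the
  gain \<open>d v t\<^sup>p\<close> dominates the loss of order \<open>t\<^sup>q\<close>. For \<open>t \<ge> 1\<close> it is bounded above, whatever the
  overshoot, and \<open>exceed\<close> is bounded below. Loads paid while \<open>t < 1\<close> only
  lower the residual level. The term with \<open>h\<close> is the contribution of paths that stay
  below \<open>1\<close> for \<open>n\<close> steps: \<open>h\<close> is strictly superharmonic for an exponent \<open>s < \<theta>\<close>, so it decays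
  like \<open>(1 - b)\<^sup>n\<close> and disappears as the horizon grows.\<close>

theorem exceed_lower_bound:
  assumes nondeg: "\<not> degenerate" and load: "0 < measure (P x') {w. 0 < load w}"
  obtains \<kappa> c0 where "0 < \<kappa>" "0 < c0"
    "\<And>x c \<phi>. 0 < c \<Longrightarrow> c \<le> c0 \<Longrightarrow> \<forall>n. exceed n x c 1 \<le> \<phi> \<Longrightarrow> \<kappa> * c powr \<theta> \<le> \<phi>"
proof -
  define \<epsilon> where "\<epsilon> = (\<theta>' - \<theta>) / 3"
  define p where "p = \<theta> + \<epsilon>"
  define q where "q = \<theta> + 2 * \<epsilon>"
  have pq: "\<theta> < p" "p < q" "q < \<theta>'" using theta by (auto simp: p_def q_def \<epsilon>_def field_simps)
  define s where "s = \<theta> / 2"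
  have s: "0 < s" "s < \<theta>" using theta by (auto simp: s_def)
  obtain v d where vd: "0 < d" "\<And>x. 0 < v x"
    and v_sub0: "\<And>x. d * v x \<le> sgn (p - \<theta>) * ((\<integral>w. exp (p * jump w) * v (fst w) \<partial>P x) - v x)"
    by (rule strictly_sub_superharmonic[OF nondeg, of p]) (use pq theta in auto)
  have v_sub: "(1 + d) * v x \<le> (\<integral>w. exp (p * jump w) * v (fst w) \<partial>P x)" for x
    using v_sub0[of x] pq by (simp add: algebra_simps)
  obtain h b where hb: "0 < b" "\<And>x. 0 < h x"
    and h_super0: "\<And>x. b * h x \<le> sgn (s - \<theta>) * ((\<integral>w. exp (s * jump w) * h (fst w) \<partial>P x) - h x)"
    by (rule strictly_sub_superharmonic[OF nondeg, of s]) (use s theta in auto)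
  have h_super: "(\<integral>w. exp (s * jump w) * h (fst w) \<partial>P x) \<le> (1 - b) * h x" for x
    using h_super0[of x] s by (simp add: algebra_simps)
  have b: "0 < b" "b \<le> 1"
  proof -
    obtain x :: 'x where True by simp
    have "0 \<le> (\<integral>w. exp (s * jump w) * h (fst w) \<partial>P x)"
      using hb by (intro integral_nonneg_AE) (auto simp: less_imp_le)
    then have "0 \<le> (1 - b) * h x" using h_super by (rule order_trans)
    then show "b \<le> 1" using hb(2)[of x] by (simp add: zero_le_mult_iff)
  qed (rule hb)
  obtain u0 where u0: "0 < u0" "\<And>x. u0 \<le> u x" using finite_pos_lower_bound[of u] u_pos by auto
  obtain v0 where v0: "0 < v0" "\<And>x. v0 \<le> v x" using finite_pos_lower_bound[of v] vd by auto
  obtain h0 where h0: "0 < h0" "\<And>x. h0 \<le> h x" using finite_pos_lower_bound[of h] hb by auto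
  obtain U where U: "0 < U" "\<And>x. u x + v x \<le> U" using finite_upper_bound[of "\<lambda>x. u x + v x"] by auto
  obtain E where E: "0 < E" "\<And>x. (\<integral>w. exp (q * jump w) \<partial>P x) \<le> E"
    using finite_upper_bound[of "\<lambda>x. \<integral>w. exp (q * jump w) \<partial>P x"] by auto
  obtain N A \<kappa> where NA: "0 < A" "0 < \<kappa>"
    "\<And>x c e. A \<le> c \<Longrightarrow> e \<le> 1 \<Longrightarrow> \<kappa> \<le> exceed N x c e"
    by (rule exceed_uniform_lower[OF load], rule that)
  (* For t < 1 the gain d * v * t powr p has to pay for k * E * t powr q. *)
  define k where "k = d * v0 / E"
  have k: "0 < k" using vd v0 E by (simp add: k_def)
  define C1 where "C1 = U / h0"
  have "\<exists>C. 0 < C \<and> (\<forall>t\<ge>1. U * t powr p \<le> C * \<kappa> + k * t powr q)"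
  proof -
    define t1 where "t1 = (U / k) powr (1 / (q - p))"
    have t1: "0 < t1" using U k by (simp add: t1_def)
    have "U * t powr p \<le> U * t1 powr p / \<kappa> * \<kappa> + k * t powr q" if "1 \<le> t" for t
    proof (cases "t \<le> t1")
      case True
      then have "t powr p \<le> t1 powr p" using that pq theta by (intro powr_mono2) auto
      then have "U * t powr p \<le> U * t1 powr p" using U by simp
      moreover have "0 \<le> k * t powr q" using k by simp
      ultimately show ?thesis using NA by simp
    next
      case False
      have "U / k = t1 powr (q - p)" using U k pq by (simp add: t1_def powr_powr)
      also have "\<dots> \<le> t powr (q - p)" using False t1 pq by (intro powr_mono2) auto
      finally have "U \<le> k * t powr (q - p)" using k by (simp add: field_simps)
      then have "U * t powr p \<le> k * t powr (q - p) * t powr p" by (rule mult_right_mono) simp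
      also have "\<dots> = k * t powr q" by (simp add: mult.assoc powr_add[symmetric])
      finally show ?thesis using U NA by (simp add: add_increasing)
    qed
    moreover have "0 < U * t1 powr p / \<kappa>" using U t1 NA by simp
    ultimately show ?thesis by blast
  qed
  then obtain C2 where C2: "0 < C2" "\<And>t. 1 \<le> t \<Longrightarrow> U * t powr p \<le> C2 * \<kappa> + k * t powr q" by blast
  have C1: "0 < C1" using U h0 by (simp add: C1_def)
  have above: "u x * t powr \<theta> + v x * t powr p
      \<le> C2 * exceed (n + N) x (A * t) e + C1 * (1 - b) ^ n * (h x * t powr s) + k * t powr q"
    if "1 \<le> t" "e \<le> 1" for n x t e
  proof -
    have "t powr \<theta> \<le> t powr p" using that pq by (intro powr_mono) auto
    then have "u x * t powr \<theta> + v x * t powr p \<le> (u x + v x) * t powr p"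
      using u_pos[of x] by (simp add: distrib_right)
    also have "\<dots> \<le> U * t powr p" using U by (intro mult_right_mono) auto
    also have "\<dots> \<le> C2 * \<kappa> + k * t powr q" using C2 that by blast
    finally have 1: "u x * t powr \<theta> + v x * t powr p \<le> C2 * \<kappa> + k * t powr q" .
    have At: "A \<le> A * t" using NA that by simp
    have "\<kappa> \<le> exceed N x (A * t) e" by (rule NA(3)[OF At that(2)])
    also have "\<dots> \<le> exceed (n + N) x (A * t) e" using At NA by (intro exceed_mono) auto
    finally have 2: "C2 * \<kappa> \<le> C2 * exceed (n + N) x (A * t) e" using C2 by simp
    have 3: "0 \<le> C1 * (1 - b) ^ n * (h x * t powr s)" using C1 b hb(2)[of x] by simp
    from 1 2 3 show ?thesis by linarith
  qed
  have main: "u x * t powr \<theta> + v x * t powr p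
      \<le> C2 * exceed (n + N) x (A * t) e + C1 * (1 - b) ^ n * (h x * t powr s) + k * t powr q"
    if "0 < t" "e \<le> 1" for n x t e
    using that
  proof (induction n arbitrary: x t e)
    case (0 x t e)
    show ?case
    proof (cases "1 \<le> t")
      case True
      show ?thesis by (rule above[OF True 0(2)])
    next
      case False
      have "t powr \<theta> \<le> t powr s" "t powr p \<le> t powr s" using False 0 s pq by (auto intro!: powr_mono')
      then have "u x * t powr \<theta> + v x * t powr p \<le> u x * t powr s + v x * t powr s"
        using u_pos[of x] vd(2)[of x] by (intro add_mono mult_left_mono) auto
      also have "\<dots> = (u x + v x) * t powr s" by (simp add: distrib_right)
      also have "\<dots> \<le> C1 * h0 * t powr s" using U h0 by (intro mult_right_mono) (auto simp: C1_def)
      also have "\<dots> \<le> C1 * h x * t powr s" using h0 C1 by (intro mult_right_mono mult_left_mono) auto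
      finally have "u x * t powr \<theta> + v x * t powr p \<le> C1 * (1 - b) ^ 0 * (h x * t powr s)" by simp
      moreover have "0 \<le> C2 * exceed (0 + N) x (A * t) e" using C2 exceed_bounds by simp
      moreover have "0 \<le> k * t powr q" using k by simp
      ultimately show ?thesis by linarith
    qed
  next
    case (Suc n x t e)
    show ?case
    proof (cases "1 \<le> t")
      case True
      show ?thesis by (rule above[OF True Suc(3)])
    next
      case False
      interpret prob_space "P x" by (rule prob_P)
      let ?F = "\<lambda>w. exceed_next (n + N) (A * t) e w"
      let ?L = "\<lambda>w. t powr \<theta> * (exp (\<theta> * jump w) * u (fst w)) + t powr p * (exp (p * jump w) * v (fst w))"
      let ?R = "\<lambda>w. C2 * ?F w + C1 * (1 - b) ^ n * t powr s * (exp (s * jump w) * h (fst w))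
        + k * t powr q * exp (q * jump w)"
      have ints: "integrable (P x) (\<lambda>w. exp (\<theta> * jump w) * u (fst w))"
        "integrable (P x) (\<lambda>w. exp (p * jump w) * v (fst w))"
        "integrable (P x) (\<lambda>w. exp (s * jump w) * h (fst w))"
        "integrable (P x) (\<lambda>w. exp (q * jump w))"
        "integrable (P x) ?F"
        using theta pq s by (auto intro!: weighted_matrix exp_integrable exceed_step_integrable)
      have "AE w in P x. ?L w \<le> ?R w"
        using load_range[of x]
      proof eventually_elim
        case (elim w)
        have "0 \<le> load w * (A * (t * exp (jump w)))" using elim NA Suc.prems by simp
        then have "e - load w * (A * (t * exp (jump w))) \<le> 1" using Suc.prems by linarith
        from Suc.IH[OF _ this, where t = "t * exp (jump w)" and x = "fst w"]
        show ?case
          using Suc.prems unfolding exp_powr_scale[OF Suc.prems(1)] by (simp add: mult_ac)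
      qed
      then have "(\<integral>w. ?L w \<partial>P x) \<le> (\<integral>w. ?R w \<partial>P x)"
        using ints by (intro integral_mono_AE) auto
      then have step: "t powr \<theta> * u x + t powr p * (\<integral>w. exp (p * jump w) * v (fst w) \<partial>P x)
        \<le> C2 * exceed (Suc n + N) x (A * t) e
          + C1 * (1 - b) ^ n * t powr s * (\<integral>w. exp (s * jump w) * h (fst w) \<partial>P x)
          + k * t powr q * (\<integral>w. exp (q * jump w) \<partial>P x)"
        using ints by (simp add: harmonic exceed.simps(2))
      have p_term: "t powr p * ((1 + d) * v x) \<le> t powr p * (\<integral>w. exp (p * jump w) * v (fst w) \<partial>P x)"
        by (intro mult_left_mono v_sub) auto
      have s_term: "C1 * (1 - b) ^ n * t powr s * (\<integral>w. exp (s * jump w) * h (fst w) \<partial>P x)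
          \<le> C1 * (1 - b) ^ n * t powr s * ((1 - b) * h x)"
        using C1 b by (intro mult_left_mono h_super) auto
      have "k * t powr q * (\<integral>w. exp (q * jump w) \<partial>P x) \<le> k * t powr q * E"
        using k E by (intro mult_left_mono) auto
      also have "\<dots> = d * v0 * t powr q" using E by (simp add: k_def)
      also have "\<dots> \<le> d * v x * t powr p"
        using vd v0 False Suc.prems pq by (intro mult_mono powr_mono') (auto intro: less_imp_le)
      finally have q_term: "k * t powr q * (\<integral>w. exp (q * jump w) \<partial>P x) \<le> d * v x * t powr p" .
      have "t powr p * ((1 + d) * v x) = v x * t powr p + d * v x * t powr p" by (simp add: algebra_simps)
      with step p_term s_term q_term have "u x * t powr \<theta> + v x * t powr p
        \<le> C2 * exceed (Suc n + N) x (A * t) e + C1 * (1 - b) ^ n * t powr s * ((1 - b) * h x)"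
        by (simp add: mult.commute[of _ "u x"])
      moreover have "C1 * (1 - b) ^ n * t powr s * ((1 - b) * h x) = C1 * (1 - b) ^ Suc n * (h x * t powr s)"
        by simp
      moreover have "0 \<le> k * t powr q" using k by simp
      ultimately show ?thesis by linarith
    qed
  qed
  have "\<forall>\<^sub>F r in at_right 0. (r::real) powr (q - \<theta>) < u0 / (2 * k)"
    "\<forall>\<^sub>F r in at_right 0. (r::real) > 0"
    by (intro powr_eventually_small eventually_at_right_less; use pq u0 k in simp)+
  then have "\<forall>\<^sub>F r in at_right (0::real). r powr (q - \<theta>) < u0 / (2 * k) \<and> 0 < r"
    by (intro eventually_conj)
  then obtain t0 :: real where t0: "t0 powr (q - \<theta>) < u0 / (2 * k)" "0 < t0"
    using eventually_happens'[OF trivial_limit_at_right_real] by blast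
  show ?thesis
  proof (rule that[of "u0 / (2 * C2 * A powr \<theta>)" "A * t0"])
    show "0 < u0 / (2 * C2 * A powr \<theta>)" "0 < A * t0" using u0 C2 NA t0 by auto
    fix x c and \<phi> :: real assume c: "0 < c" "c \<le> A * t0" and \<phi>: "\<forall>n. exceed n x c 1 \<le> \<phi>"
    define t where "t = c / A"
    have t: "0 < t" "t \<le> t0" "A * t = c" using c NA by (auto simp: t_def field_simps)
    have "u x * t powr \<theta> \<le> C2 * \<phi> + C1 * 0 * (h x * t powr s) + k * t powr q"
    proof (rule LIMSEQ_le_const)
      show "(\<lambda>n. C2 * \<phi> + C1 * (1 - b) ^ n * (h x * t powr s) + k * t powr q)
          \<longlonglongrightarrow> C2 * \<phi> + C1 * 0 * (h x * t powr s) + k * t powr q"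
        using b by (intro tendsto_intros LIMSEQ_power_zero) auto
      have "u x * t powr \<theta> \<le> C2 * \<phi> + C1 * (1 - b) ^ n * (h x * t powr s) + k * t powr q" for n
      proof -
        have "C2 * exceed (n + N) x c 1 \<le> C2 * \<phi>" using \<phi> C2 by simp
        moreover have "0 \<le> v x * t powr p" using vd(2)[of x] by simp
        ultimately show ?thesis using main[OF t(1) order_refl, of x n] unfolding t(3) by linarith
      qed
      then show "\<exists>N. \<forall>n\<ge>N. u x * t powr \<theta> \<le> C2 * \<phi> + C1 * (1 - b) ^ n * (h x * t powr s) + k * t powr q"
        by blast
    qed
    moreover have "u0 * t powr \<theta> \<le> u x * t powr \<theta>" using u0 by (intro mult_right_mono) auto
    moreover have "k * t powr q \<le> u0 / 2 * t powr \<theta>"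
    proof -
      have "t powr (q - \<theta>) \<le> t0 powr (q - \<theta>)" using t pq by (intro powr_mono2) auto
      also have "\<dots> \<le> u0 / (2 * k)" using t0 by simp
      finally have "k * t powr (q - \<theta>) \<le> u0 / 2" using k by (simp add: field_simps)
      then have "k * t powr (q - \<theta>) * t powr \<theta> \<le> u0 / 2 * t powr \<theta>" by (rule mult_right_mono) simp
      then show ?thesis by (simp add: mult.assoc powr_add[symmetric])
    qed
    ultimately have "u0 / 2 * t powr \<theta> \<le> C2 * \<phi>" by simp
    then have "u0 / (2 * C2) * t powr \<theta> \<le> \<phi>" using C2 by (simp add: field_simps)
    moreover have "t powr \<theta> = c powr \<theta> / A powr \<theta>" using c NA by (simp add: t_def powr_divide)
    ultimately show "u0 / (2 * C2 * A powr \<theta>) * c powr \<theta> \<le> \<phi>" by simp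
  qed
qed

text \<open>Here \<open>c\<^sup>\<theta> u x\<close> is conserved, so the scale stays above a positive constant \<open>1 / \<beta>\<close>, and
  paying a load \<open>l\<close> shrinks \<open>exp (\<beta> e)\<close> at least by the factor \<open>exp (- l)\<close>. The constant \<open>1\<close>
  is superharmonic for the matrix of the means of \<open>exp (- l)\<close>, strictly at \<open>x'\<close>, which makes the probability of not
  exceeding the level decay geometrically.\<close>

theorem exceed_tendsto_1_degenerate:
  assumes deg: degenerate and load: "0 < measure (P x') {w. 0 < load w}" and c: "0 < c"
  shows "(\<lambda>n. exceed n x c e) \<longlonglongrightarrow> 1"
proof -
  (* The maximum keeps the weight bounded on the null set of negative loads. *)
  define R where "R x y = (\<integral>w. exp (- max 0 (load w)) * indicator {w. fst w = y} w \<partial>P x)" for x y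
  have int: "integrable (P x) (\<lambda>w. exp (- max 0 (load w)))" for x
  proof -
    interpret prob_space "P x" by (rule prob_P)
    show ?thesis by (rule integrable_const_bound[of _ 1]) auto
  qed
  have R: "0 \<le> R x y" "(x, y) \<in> {(x, y). 0 < R x y}\<^sup>*" for x y
    unfolding R_def using weighted_matrix_irreducible[OF int] by simp_all
  have R_apply: "matrix_apply R f x = (\<integral>w. exp (- max 0 (load w)) * f (fst w) \<partial>P x)" for f x
    using weighted_matrix(2)[OF int] unfolding R_def by blast
  have gap: "- 1 * (matrix_apply R (\<lambda>y. 1) x - 1) = (\<integral>w. 1 - exp (- max 0 (load w)) \<partial>P x)" for x
  proof -
    interpret prob_space "P x" by (rule prob_P)
    show ?thesis unfolding R_apply using int prob_space by (simp add: Bochner_Integration.integral_diff)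
  qed
  have gap_nonneg: "0 \<le> - 1 * (matrix_apply R (\<lambda>y. 1) x - 1)" for x
    unfolding gap by (rule integral_nonneg_AE) auto
  have gap_pos: "0 < - 1 * (matrix_apply R (\<lambda>y. 1) x' - 1)"
  proof -
    interpret prob_space "P x'" by (rule prob_P)
    have "(\<integral>w. 1 - exp (- max 0 (load w)) \<partial>P x') \<noteq> 0"
    proof
      assume "(\<integral>w. 1 - exp (- max 0 (load w)) \<partial>P x') = 0"
      then have "AE w in P x'. 1 - exp (- max 0 (load w)) = 0"
        using integral_nonneg_eq_0_iff_AE[of "P x'" "\<lambda>w. 1 - exp (- max 0 (load w))"] int by auto
      then have "AE w in P x'. w \<notin> {w. 0 < load w}" by eventually_elim auto
      then have "emeasure (P x') {w. 0 < load w} = 0"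
        using AE_iff_null_sets[OF load_sets[of 0 x']] by blast
      then show False using load by (simp add: measure_def)
    qed
    then show ?thesis using gap_nonneg[of x'] unfolding gap order_less_le by simp
  qed
  obtain v b where vb: "0 < b" "\<And>x. 0 < v x" "\<And>x. b * v x \<le> - 1 * (matrix_apply R v x - v x)"
    by (rule strict_spread[of R "\<lambda>y. 1" "- 1" x', OF R _ gap_nonneg gap_pos], simp, rule that)
  have v_super: "(\<integral>w. exp (- max 0 (load w)) * v (fst w) \<partial>P x) \<le> (1 - b) * v x" for x
    using vb(3)[of x] unfolding R_apply by (simp add: algebra_simps)
  have b: "b \<le> 1"
  proof -
    have "0 \<le> (\<integral>w. exp (- max 0 (load w)) * v (fst w) \<partial>P x)"
      using vb by (intro integral_nonneg_AE) (auto simp: less_imp_le)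
    then have "0 \<le> (1 - b) * v x" using v_super by (rule order_trans)
    then show "b \<le> 1" using vb(2)[of x] by (simp add: zero_le_mult_iff)
  qed
  obtain v0 where v0: "0 < v0" "\<And>x. v0 \<le> v x" using finite_pos_lower_bound[of v] vb by auto
  obtain U where U: "0 < U" "\<And>x. u x \<le> U" using finite_upper_bound[of u] by auto
  define H where "H = c powr \<theta> * u x"
  have H: "0 < H" using c u_pos by (simp add: H_def)
  define \<beta> where "\<beta> = 1 / (H / U) powr (1 / \<theta>)"
  have \<beta>: "0 < \<beta>" using H U by (simp add: \<beta>_def)
  have weight: "1 \<le> \<beta> * c" if "c powr \<theta> * u y = H" "0 < c" for c y
  proof -
    have "H \<le> c powr \<theta> * U" unfolding that(1)[symmetric] using U by (intro mult_left_mono) auto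
    then have "(H / U) powr (1 / \<theta>) \<le> (c powr \<theta>) powr (1 / \<theta>)"
      using H U theta by (intro powr_mono2) (auto simp: field_simps)
    then have "(H / U) powr (1 / \<theta>) \<le> c" using theta that by (simp add: powr_powr)
    then show ?thesis using H U by (simp add: \<beta>_def field_simps)
  qed
  have main: "1 - exceed n x c e \<le> (1 - b) ^ n * (v x / v0 * exp (\<beta> * e))"
    if "c powr \<theta> * u x = H" "0 < c" for n x c e
    using that
  proof (induction n arbitrary: x c e)
    case 0
    have "1 \<le> v x / v0" using v0 by simp
    moreover have "0 \<le> v x / v0 * exp (\<beta> * e)" using v0 vb(2)[of x] by simp
    moreover have "1 \<le> v x / v0 * exp (\<beta> * e)" if "0 \<le> e"
      using mult_mono[of 1 "v x / v0" 1 "exp (\<beta> * e)"] \<open>1 \<le> v x / v0\<close> \<beta> that by simp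
    ultimately show ?case by auto
  next
    case (Suc n)
    interpret prob_space "P x" by (rule prob_P)
    let ?F = "\<lambda>w. exceed_next n c e w"
    let ?K = "(1 - b) ^ n / v0 * exp (\<beta> * e)"
    have "AE w in P x. 1 - ?F w \<le> ?K * (exp (- max 0 (load w)) * v (fst w))"
      using load_range[of x] deg[unfolded degenerate_def, rule_format, of x]
    proof eventually_elim
      case (elim w)
      let ?c = "c * exp (jump w)"
      have inv: "?c powr \<theta> * u (fst w) = H"
        using elim(2) Suc.prems by (simp add: exp_powr_scale mult.assoc)
      have "1 \<le> \<beta> * ?c" using weight[OF inv] Suc.prems by simp
      then have "load w * 1 \<le> load w * (\<beta> * ?c)" using elim by (intro mult_left_mono) auto
      then have "\<beta> * (e - load w * ?c) \<le> \<beta> * e + - max 0 (load w)" using elim by (simp add: algebra_simps)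
      then have "exp (\<beta> * (e - load w * ?c)) \<le> exp (\<beta> * e) * exp (- max 0 (load w))"
        unfolding mult_exp_exp by simp
      then have "(1 - b) ^ n * (v (fst w) / v0 * exp (\<beta> * (e - load w * ?c)))
          \<le> (1 - b) ^ n * (v (fst w) / v0 * (exp (\<beta> * e) * exp (- max 0 (load w))))"
        using b v0 vb(2)[of "fst w"] by (intro mult_left_mono) auto
      moreover have "1 - ?F w \<le> (1 - b) ^ n * (v (fst w) / v0 * exp (\<beta> * (e - load w * ?c)))"
        using Suc.IH[OF inv] Suc.prems by simp
      ultimately show ?case by (simp add: mult_ac)
    qed
    then have "(\<integral>w. 1 - ?F w \<partial>P x) \<le> (\<integral>w. ?K * (exp (- max 0 (load w)) * v (fst w)) \<partial>P x)"
      by (intro integral_mono_AE Bochner_Integration.integrable_diff exceed_step_integrable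
            integrable_mult_right weighted_matrix int) auto
    also have "\<dots> = ?K * (\<integral>w. exp (- max 0 (load w)) * v (fst w) \<partial>P x)" by simp
    also have "\<dots> \<le> ?K * ((1 - b) * v x)" using b v0 by (intro mult_left_mono v_super) auto
    also have "(\<integral>w. 1 - ?F w \<partial>P x) = 1 - exceed (Suc n) x c e"
      unfolding exceed.simps(2) using exceed_step_integrable prob_space
      by (subst Bochner_Integration.integral_diff) auto
    finally show ?case by (simp add: mult_ac)
  qed
  have "(\<lambda>n. 1 - (1 - b) ^ n * (v x / v0 * exp (\<beta> * e)))
      \<longlonglongrightarrow> 1 - 0 * (v x / v0 * exp (\<beta> * e))"
    using b vb(1) by (intro tendsto_intros LIMSEQ_power_zero) auto
  then have lim: "(\<lambda>n. 1 - (1 - b) ^ n * (v x / v0 * exp (\<beta> * e))) \<longlonglongrightarrow> 1" by simp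
  have lower: "1 - (1 - b) ^ n * (v x / v0 * exp (\<beta> * e)) \<le> exceed n x c e" for n
    using main[OF H_def[symmetric] c, of n e] by linarith
  show ?thesis
    by (rule tendsto_sandwich[OF always_eventually[rule_format, OF lower]
          always_eventually[rule_format, OF exceed_bounds(2)] lim tendsto_const])
qed

end

section \<open>The model and its exponential tilting\<close>

locale increment_model = prob_space M
  for M :: "'a measure" and \<xi>1 \<eta>1 :: "'a \<Rightarrow> real" and \<gamma> lam :: "'x::finite \<Rightarrow> real \<Rightarrow> real"
    and K :: "'x \<Rightarrow> 'x \<Rightarrow> real" +
  assumes xi_measurable [measurable]: "\<xi>1 \<in> borel_measurable M"
    and eta_measurable [measurable]: "\<eta>1 \<in> borel_measurable M"
    and gamma_measurable [measurable]: "\<gamma> x \<in> borel_measurable borel"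
    and lam_measurable [measurable]: "lam x \<in> borel_measurable borel"
    and stochastic: "stochastic_matrix K"
begin

abbreviation "nominal \<equiv> nominal_step M \<xi>1 \<eta>1 \<gamma> lam K"

lemma K_nonneg: "0 \<le> K x y" and K_sum: "(\<Sum>y\<in>UNIV. K x y) = 1"
  using stochastic by (auto simp: stochastic_matrix_def)

lemma nominal_inner:
  "inc_law M \<xi>1 \<eta>1 \<gamma> lam y \<bind> (\<lambda>(z, l). return step_space (y, z, l))
    = distr M step_space (\<lambda>\<omega>. (y, \<gamma> y (\<xi>1 \<omega>), lam y (\<eta>1 \<omega>)))"
proof -
  have "inc_law M \<xi>1 \<eta>1 \<gamma> lam y \<bind> (\<lambda>(z, l). return step_space (y, z, l))
      = inc_law M \<xi>1 \<eta>1 \<gamma> lam y \<bind> (\<lambda>p. return step_space (y, p))"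
    by (simp add: split_beta')
  also have "\<dots> = distr (inc_law M \<xi>1 \<eta>1 \<gamma> lam y) step_space (\<lambda>p. (y, p))"
    by (rule bind_return_distr') (simp_all add: inc_law_def space_pair_measure)
  also have "\<dots> = distr M step_space (\<lambda>\<omega>. (y, \<gamma> y (\<xi>1 \<omega>), lam y (\<eta>1 \<omega>)))"
    unfolding inc_law_def by (subst distr_distr) (simp_all add: comp_def)
  finally show ?thesis .
qed

lemma nn_integral_point_measure_UNIV:
  fixes g :: "'x \<Rightarrow> ennreal"
  shows "(\<integral>\<^sup>+y. g y \<partial>point_measure UNIV h) = (\<Sum>y\<in>UNIV. h y * g y)"
  by (simp add: point_measure_def nn_integral_density nn_integral_count_space_finite)

lemma sets_nominal: "sets (nominal x) = sets step_space"
  unfolding nominal_step_def nominal_inner by (subst sets_bind) (auto simp: space_point_measure)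

lemma nominal_kernel_measurable:
  "(\<lambda>y. distr M step_space (\<lambda>\<omega>. (y, \<gamma> y (\<xi>1 \<omega>), lam y (\<eta>1 \<omega>))))
    \<in> measurable (point_measure UNIV h) (subprob_algebra step_space)"
  by (auto simp: space_subprob_algebra intro!: prob_space_imp_subprob_space prob_space_distr)

lemma nn_integral_nominal:
  assumes [measurable]: "f \<in> borel_measurable step_space"
  shows "(\<integral>\<^sup>+w. f w \<partial>nominal x)
    = (\<Sum>y\<in>UNIV. ennreal (K x y) * (\<integral>\<^sup>+\<omega>. f (y, \<gamma> y (\<xi>1 \<omega>), lam y (\<eta>1 \<omega>)) \<partial>M))"
  unfolding nominal_step_def nominal_inner
  by (subst nn_integral_bind[OF _ nominal_kernel_measurable])
     (simp_all add: nn_integral_point_measure_UNIV nn_integral_distr)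

lemma prob_space_nominal: "prob_space (nominal x)"
proof
  have "emeasure (nominal x) (space (nominal x)) = (\<integral>\<^sup>+w. 1 \<partial>nominal x)" by simp
  also have "\<dots> = (\<Sum>y\<in>UNIV. ennreal (K x y))"
    by (subst nn_integral_nominal) (simp_all add: emeasure_space_1)
  also have "\<dots> = 1" using K_nonneg K_sum by (simp add: sum_ennreal)
  finally show "emeasure (nominal x) (space (nominal x)) = 1" .
qed

lemma AE_nominal:
  assumes P: "\<And>y. AE \<omega> in M. P (y, \<gamma> y (\<xi>1 \<omega>), lam y (\<eta>1 \<omega>))"
    and [measurable]: "Measurable.pred step_space P"
  shows "AE w in nominal x. P w"
proof -
  have [measurable_cong]: "sets (nominal x) = sets step_space" by (rule sets_nominal)
  have "(\<integral>\<^sup>+\<omega>. indicator {w \<in> space step_space. \<not> P w} (y, \<gamma> y (\<xi>1 \<omega>), lam y (\<eta>1 \<omega>)) \<partial>M) = 0" for y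
    by (subst nn_integral_0_iff_AE, measurable) (use P[of y] in \<open>auto simp: indicator_def\<close>)
  then have "(\<integral>\<^sup>+w. indicator {w \<in> space step_space. \<not> P w} w \<partial>nominal x) = 0"
    by (subst nn_integral_nominal) simp_all
  then have "AE w in nominal x. indicator {w \<in> space step_space. \<not> P w} w = (0::ennreal)"
    by (subst (asm) nn_integral_0_iff_AE) simp_all
  then show ?thesis
    by eventually_elim (auto simp: indicator_def space_pair_measure split: if_splits)
qed

lemma nominal_next_prob: "measure (nominal x) {w. fst w = y} = K x y"
proof -
  have m: "{w. fst w = y} \<in> sets step_space"
    using measurable_sets[of fst step_space "count_space UNIV" "{y}"]
    by (simp add: vimage_def space_pair_measure)
  have "emeasure (nominal x) {w. fst w = y} = (\<integral>\<^sup>+w. indicator {w. fst w = y} w \<partial>nominal x)"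
    using m by (subst nn_integral_indicator) (simp_all add: sets_nominal)
  also have "\<dots> = (\<Sum>z\<in>UNIV. if z = y then ennreal (K x z) else 0)"
    using m by (subst nn_integral_nominal) (auto simp: emeasure_space_1 indicator_def intro!: sum.cong)
  finally show ?thesis by (simp add: measure_def K_nonneg)
qed

end

locale tilting_model = increment_model M \<xi>1 \<eta>1 \<gamma> lam K
  for M :: "'a measure" and \<xi>1 \<eta>1 :: "'a \<Rightarrow> real" and \<gamma> lam :: "'x::finite \<Rightarrow> real \<Rightarrow> real"
    and K :: "'x \<Rightarrow> 'x \<Rightarrow> real" +
  fixes \<theta> :: real and u :: "'x \<Rightarrow> real" and \<kappa> :: "'x \<Rightarrow> real \<Rightarrow> real measure"
  assumes mgf_finite: "mgf M \<xi>1 \<gamma> x \<theta> < \<infinity>"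
    and psi_0: "psi M \<xi>1 \<gamma> K \<theta> = 0"
    and eigenvector: "positive_eigenvector M \<xi>1 \<gamma> K \<theta> u"
    and conditional_law: "conditional_lam_law M \<xi>1 \<eta>1 \<gamma> lam \<kappa>"
begin

lemma u_pos: "0 < u x"
  using eigenvector by (simp add: positive_eigenvector_def)

lemma exp_chi: "ennreal (exp (chi M \<xi>1 \<gamma> y \<theta>)) = (\<integral>\<^sup>+\<omega>. ennreal (exp (\<theta> * \<gamma> y (\<xi>1 \<omega>))) \<partial>M)"
proof -
  have "mgf M \<xi>1 \<gamma> y \<theta> \<noteq> 0"
  proof
    assume "mgf M \<xi>1 \<gamma> y \<theta> = 0"
    then have "AE \<omega> in M. ennreal (exp (\<theta> * \<gamma> y (\<xi>1 \<omega>))) = 0"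
      unfolding mgf_def by (subst (asm) nn_integral_0_iff_AE) simp_all
    then show False by simp
  qed
  then have "0 < enn2real (mgf M \<xi>1 \<gamma> y \<theta>)" using mgf_finite[of y]
    by (simp add: enn2real_positive_iff zero_less_iff_neq_zero top.not_eq_extremum)
  then show ?thesis using mgf_finite[of y] by (simp add: chi_def mgf_def)
qed

lemma eigen_eq: "(\<Sum>y\<in>UNIV. K x y * exp (chi M \<xi>1 \<gamma> y \<theta>) * u y) = u x"
  using eigenvector by (simp add: positive_eigenvector_def psi_0 Q_matrix_def)

lemma kappa_measurable [measurable]: "\<kappa> y \<in> measurable borel (subprob_algebra borel)"
  using conditional_law by (auto simp: conditional_lam_law_def intro: measurable_prob_algebraD)

text \<open>Drawing the load from its conditional law given the jump reproduces the joint law.\<close>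

lemma disintegration:
  assumes [measurable]: "g \<in> borel_measurable (borel \<Otimes>\<^sub>M borel)"
  shows "(\<integral>\<^sup>+\<omega>. g (\<gamma> y (\<xi>1 \<omega>), lam y (\<eta>1 \<omega>)) \<partial>M)
    = (\<integral>\<^sup>+\<omega>. (\<integral>\<^sup>+l. g (\<gamma> y (\<xi>1 \<omega>), l) \<partial>\<kappa> y (\<gamma> y (\<xi>1 \<omega>))) \<partial>M)"
proof -
  have sets_kappa: "sets (\<kappa> y z) = sets borel" for z
    by (rule sets_kernel[OF kappa_measurable]) simp
  have inner: "(\<lambda>z. \<kappa> y z \<bind> (\<lambda>l. return (borel \<Otimes>\<^sub>M borel) (z, l)))
      \<in> measurable (distr M borel (\<lambda>\<omega>. \<gamma> y (\<xi>1 \<omega>))) (subprob_algebra (borel \<Otimes>\<^sub>M borel))"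
    by measurable
  have "(\<integral>\<^sup>+\<omega>. g (\<gamma> y (\<xi>1 \<omega>), lam y (\<eta>1 \<omega>)) \<partial>M) = (\<integral>\<^sup>+p. g p \<partial>inc_law M \<xi>1 \<eta>1 \<gamma> lam y)"
    unfolding inc_law_def by (simp add: nn_integral_distr)
  also have "inc_law M \<xi>1 \<eta>1 \<gamma> lam y = distr M borel (\<lambda>\<omega>. \<gamma> y (\<xi>1 \<omega>)) \<bind>
      (\<lambda>z. \<kappa> y z \<bind> (\<lambda>l. return (borel \<Otimes>\<^sub>M borel) (z, l)))"
    using conditional_law by (simp add: conditional_lam_law_def)
  also have "(\<integral>\<^sup>+p. g p \<partial>\<dots>) = (\<integral>\<^sup>+z. \<integral>\<^sup>+p. g p \<partial>(\<kappa> y z \<bind> (\<lambda>l. return (borel \<Otimes>\<^sub>M borel) (z, l)))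
      \<partial>distr M borel (\<lambda>\<omega>. \<gamma> y (\<xi>1 \<omega>)))"
    by (rule nn_integral_bind[OF _ inner]) simp
  also have "\<dots> = (\<integral>\<^sup>+z. \<integral>\<^sup>+l. g (z, l) \<partial>\<kappa> y z \<partial>distr M borel (\<lambda>\<omega>. \<gamma> y (\<xi>1 \<omega>)))"
  proof (rule nn_integral_cong)
    fix z :: real
    have [measurable_cong]: "sets (\<kappa> y z) = sets borel" by (rule sets_kappa)
    have "(\<lambda>l. return (borel \<Otimes>\<^sub>M borel) (z, l)) \<in> measurable (\<kappa> y z) (subprob_algebra (borel \<Otimes>\<^sub>M borel))"
      by measurable
    then show "(\<integral>\<^sup>+p. g p \<partial>(\<kappa> y z \<bind> (\<lambda>l. return (borel \<Otimes>\<^sub>M borel) (z, l)))) = (\<integral>\<^sup>+l. g (z, l) \<partial>\<kappa> y z)"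
      by (subst nn_integral_bind[where B = "borel \<Otimes>\<^sub>M borel"])
        (auto intro!: nn_integral_cong nn_integral_return simp: space_pair_measure)
  qed
  also have "\<dots> = (\<integral>\<^sup>+\<omega>. (\<integral>\<^sup>+l. g (\<gamma> y (\<xi>1 \<omega>), l) \<partial>\<kappa> y (\<gamma> y (\<xi>1 \<omega>))) \<partial>M)"
    by (rule nn_integral_distr)
      (measurable, auto intro!: nn_integral_measurable_subprob_algebra2[where N = borel])
  finally show ?thesis .
qed

abbreviation "tilted \<equiv> tilted_step M \<xi>1 \<gamma> K \<theta> u \<kappa>"

abbreviation "gamma_tilted y \<equiv>
  density (distr M borel (\<lambda>\<omega>. \<gamma> y (\<xi>1 \<omega>))) (\<lambda>z. ennreal (exp (\<theta> * z - chi M \<xi>1 \<gamma> y \<theta>)))"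

lemma prob_gamma_tilted: "prob_space (gamma_tilted y)"
proof
  have "emeasure (gamma_tilted y) (space (gamma_tilted y))
      = (\<integral>\<^sup>+\<omega>. ennreal (exp (\<theta> * \<gamma> y (\<xi>1 \<omega>) - chi M \<xi>1 \<gamma> y \<theta>)) \<partial>M)"
    by (simp add: emeasure_density nn_integral_distr)
  also have "\<dots> = (\<integral>\<^sup>+\<omega>. ennreal (exp (- chi M \<xi>1 \<gamma> y \<theta>)) * ennreal (exp (\<theta> * \<gamma> y (\<xi>1 \<omega>))) \<partial>M)"
    by (intro nn_integral_cong) (simp add: ennreal_mult'[symmetric] mult_exp_exp)
  also have "\<dots> = ennreal (exp (- chi M \<xi>1 \<gamma> y \<theta>)) * ennreal (exp (chi M \<xi>1 \<gamma> y \<theta>))"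
    unfolding exp_chi by (rule nn_integral_cmult) simp
  also have "\<dots> = 1" by (simp add: ennreal_mult'[symmetric] mult_exp_exp)
  finally show "emeasure (gamma_tilted y) (space (gamma_tilted y)) = 1" .
qed

lemma tilted_inner_measurable:
  "(\<lambda>z. \<kappa> y z \<bind> (\<lambda>l. return step_space (y, z, l))) \<in> measurable (gamma_tilted y) (subprob_algebra step_space)"
  by measurable

lemma tilted_kernel_measurable:
  "(\<lambda>y. gamma_tilted y \<bind> (\<lambda>z. \<kappa> y z \<bind> (\<lambda>l. return step_space (y, z, l))))
    \<in> measurable (point_measure UNIV h) (subprob_algebra step_space)"
proof -
  have "gamma_tilted y \<bind> (\<lambda>z. \<kappa> y z \<bind> (\<lambda>l. return step_space (y, z, l)))
      \<in> space (subprob_algebra step_space)" for y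
    using subprob_space.bind_in_space[OF prob_space_imp_subprob_space[OF prob_gamma_tilted]
        tilted_inner_measurable] .
  then show ?thesis by simp
qed

lemma nn_integral_tilted:
  assumes [measurable]: "f \<in> borel_measurable step_space"
  shows "(\<integral>\<^sup>+w. f w \<partial>tilted x) = (\<Sum>y\<in>UNIV. ennreal (K_tilted M \<xi>1 \<gamma> K \<theta> u x y) *
    (\<integral>\<^sup>+\<omega>. ennreal (exp (\<theta> * \<gamma> y (\<xi>1 \<omega>) - chi M \<xi>1 \<gamma> y \<theta>)) *
      f (y, \<gamma> y (\<xi>1 \<omega>), lam y (\<eta>1 \<omega>)) \<partial>M))"
proof -
  have inner: "(\<integral>\<^sup>+w. f w \<partial>(gamma_tilted y \<bind> (\<lambda>z. \<kappa> y z \<bind> (\<lambda>l. return step_space (y, z, l)))))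
    = (\<integral>\<^sup>+\<omega>. ennreal (exp (\<theta> * \<gamma> y (\<xi>1 \<omega>) - chi M \<xi>1 \<gamma> y \<theta>)) *
      f (y, \<gamma> y (\<xi>1 \<omega>), lam y (\<eta>1 \<omega>)) \<partial>M)" for y
  proof -
    have fy: "(\<lambda>z. \<integral>\<^sup>+l. f (y, z, l) \<partial>\<kappa> y z) \<in> borel_measurable borel"
      by (rule nn_integral_measurable_subprob_algebra2[where N = borel]) measurable
    have "(\<integral>\<^sup>+w. f w \<partial>(gamma_tilted y \<bind> (\<lambda>z. \<kappa> y z \<bind> (\<lambda>l. return step_space (y, z, l)))))
      = (\<integral>\<^sup>+z. \<integral>\<^sup>+w. f w \<partial>(\<kappa> y z \<bind> (\<lambda>l. return step_space (y, z, l))) \<partial>gamma_tilted y)"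
      by (rule nn_integral_bind[OF _ tilted_inner_measurable]) simp
    also have "\<dots> = (\<integral>\<^sup>+z. \<integral>\<^sup>+l. f (y, z, l) \<partial>\<kappa> y z \<partial>gamma_tilted y)"
    proof (rule nn_integral_cong)
      fix z :: real
      have [measurable_cong]: "sets (\<kappa> y z) = sets borel"
        by (rule sets_kernel[OF kappa_measurable]) simp
      have "(\<lambda>l. return step_space (y, z, l)) \<in> measurable (\<kappa> y z) (subprob_algebra step_space)"
        by measurable
      then show "(\<integral>\<^sup>+w. f w \<partial>(\<kappa> y z \<bind> (\<lambda>l. return step_space (y, z, l)))) = (\<integral>\<^sup>+l. f (y, z, l) \<partial>\<kappa> y z)"
        by (subst nn_integral_bind[where B = step_space])
          (auto intro!: nn_integral_cong nn_integral_return simp: space_pair_measure)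
    qed
    also have "\<dots> = (\<integral>\<^sup>+z. ennreal (exp (\<theta> * z - chi M \<xi>1 \<gamma> y \<theta>)) * (\<integral>\<^sup>+l. f (y, z, l) \<partial>\<kappa> y z)
        \<partial>distr M borel (\<lambda>\<omega>. \<gamma> y (\<xi>1 \<omega>)))"
      using fy by (subst nn_integral_density) simp_all
    also have "\<dots> = (\<integral>\<^sup>+\<omega>. ennreal (exp (\<theta> * \<gamma> y (\<xi>1 \<omega>) - chi M \<xi>1 \<gamma> y \<theta>)) *
        (\<integral>\<^sup>+l. f (y, \<gamma> y (\<xi>1 \<omega>), l) \<partial>\<kappa> y (\<gamma> y (\<xi>1 \<omega>))) \<partial>M)"
      using fy by (subst nn_integral_distr) simp_all
    also have "\<dots> = (\<integral>\<^sup>+\<omega>. (\<integral>\<^sup>+l. ennreal (exp (\<theta> * \<gamma> y (\<xi>1 \<omega>) - chi M \<xi>1 \<gamma> y \<theta>)) *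
        f (y, \<gamma> y (\<xi>1 \<omega>), l) \<partial>\<kappa> y (\<gamma> y (\<xi>1 \<omega>))) \<partial>M)"
    proof (rule nn_integral_cong)
      fix \<omega>
      have [measurable_cong]: "sets (\<kappa> y (\<gamma> y (\<xi>1 \<omega>))) = sets borel"
        by (rule sets_kernel[OF kappa_measurable]) simp
      show "ennreal (exp (\<theta> * \<gamma> y (\<xi>1 \<omega>) - chi M \<xi>1 \<gamma> y \<theta>)) *
          (\<integral>\<^sup>+l. f (y, \<gamma> y (\<xi>1 \<omega>), l) \<partial>\<kappa> y (\<gamma> y (\<xi>1 \<omega>)))
        = (\<integral>\<^sup>+l. ennreal (exp (\<theta> * \<gamma> y (\<xi>1 \<omega>) - chi M \<xi>1 \<gamma> y \<theta>)) *
          f (y, \<gamma> y (\<xi>1 \<omega>), l) \<partial>\<kappa> y (\<gamma> y (\<xi>1 \<omega>)))"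
        by (rule nn_integral_cmult[symmetric]) measurable
    qed
    also have "\<dots> = (\<integral>\<^sup>+\<omega>. ennreal (exp (\<theta> * \<gamma> y (\<xi>1 \<omega>) - chi M \<xi>1 \<gamma> y \<theta>)) *
        f (y, \<gamma> y (\<xi>1 \<omega>), lam y (\<eta>1 \<omega>)) \<partial>M)"
      using disintegration[of "\<lambda>p. ennreal (exp (\<theta> * fst p - chi M \<xi>1 \<gamma> y \<theta>)) * f (y, p)" y] by simp
    finally show ?thesis .
  qed
  show ?thesis
    unfolding tilted_step_def
    by (subst nn_integral_bind[OF _ tilted_kernel_measurable])
       (simp_all add: nn_integral_point_measure_UNIV inner)
qed

lemma sets_tilted: "sets (tilted x) = sets step_space"
  unfolding tilted_step_def
  by (rule sets_bind[OF sets_kernel[OF tilted_kernel_measurable]]) (auto simp: space_point_measure)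

text \<open>The weight of the jump depends on the jump alone, so resampling the load from its conditional law
  leaves the joint law a weighted nominal one. The factors \<open>exp (\<plusminus> \<chi>)\<close> of the chain and of
  the jump cancel, and \<open>\<psi> = 0\<close>.\<close>

theorem tilted_eq_density:
  "tilted x = density (nominal x) (\<lambda>w. ennreal (exp (\<theta> * fst (snd w)) * u (fst w) / u x))"
proof (rule measure_eqI)
  show "sets (tilted x) = sets (density (nominal x)
      (\<lambda>w. ennreal (exp (\<theta> * fst (snd w)) * u (fst w) / u x)))"
    by (simp add: sets_tilted sets_nominal)
  fix A assume "A \<in> sets (tilted x)"
  then have [measurable]: "A \<in> sets step_space" by (simp add: sets_tilted)
  have [measurable_cong]: "sets (nominal x) = sets step_space" by (rule sets_nominal)
  have [measurable]: "(\<lambda>w. u (fst w)) \<in> borel_measurable step_space"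
    by (rule measurable_compose[OF measurable_fst]) simp
  have weight: "ennreal (K_tilted M \<xi>1 \<gamma> K \<theta> u x y) * (ennreal (exp (\<theta> * z - chi M \<xi>1 \<gamma> y \<theta>)) * i)
      = ennreal (K x y) * (ennreal (exp (\<theta> * z) * u y / u x) * i)" for y z and i :: ennreal
  proof -
    have "K_tilted M \<xi>1 \<gamma> K \<theta> u x y * exp (\<theta> * z - chi M \<xi>1 \<gamma> y \<theta>) = K x y * (exp (\<theta> * z) * u y / u x)"
      by (simp add: K_tilted_def psi_0 exp_diff)
    moreover have "0 \<le> K_tilted M \<xi>1 \<gamma> K \<theta> u x y"
      using K_nonneg u_pos by (simp add: K_tilted_def less_imp_le)
    ultimately show ?thesis
      using K_nonneg u_pos by (simp add: ennreal_mult[symmetric] less_imp_le mult.assoc[symmetric])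
  qed
  have push: "c * (\<integral>\<^sup>+\<omega>. g \<omega> \<partial>M) = (\<integral>\<^sup>+\<omega>. c * g \<omega> \<partial>M)" if "g \<in> borel_measurable M" for c :: ennreal and g
    using that by (rule nn_integral_cmult[symmetric])
  have "emeasure (tilted x) A = (\<integral>\<^sup>+w. indicator A w \<partial>tilted x)"
    by (subst nn_integral_indicator) (simp_all add: sets_tilted)
  also have "\<dots> = (\<Sum>y\<in>UNIV. \<integral>\<^sup>+\<omega>. ennreal (K_tilted M \<xi>1 \<gamma> K \<theta> u x y) *
      (ennreal (exp (\<theta> * \<gamma> y (\<xi>1 \<omega>) - chi M \<xi>1 \<gamma> y \<theta>)) *
      indicator A (y, \<gamma> y (\<xi>1 \<omega>), lam y (\<eta>1 \<omega>))) \<partial>M)"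
    by (subst nn_integral_tilted) (simp_all add: push)
  also have "\<dots> = (\<integral>\<^sup>+w. ennreal (exp (\<theta> * fst (snd w)) * u (fst w) / u x) * indicator A w \<partial>nominal x)"
    unfolding weight by (subst nn_integral_nominal) (simp_all add: push)
  also have "\<dots> = emeasure (density (nominal x)
      (\<lambda>w. ennreal (exp (\<theta> * fst (snd w)) * u (fst w) / u x))) A"
    by (subst emeasure_density) simp_all
  finally show "emeasure (tilted x) A = emeasure (density (nominal x)
      (\<lambda>w. ennreal (exp (\<theta> * fst (snd w)) * u (fst w) / u x))) A" .
qed

lemma nominal_harmonic:
  "(\<integral>\<^sup>+w. ennreal (exp (\<theta> * fst (snd w)) * u (fst w)) \<partial>nominal x) = ennreal (u x)"
proof -
  have [measurable]: "(\<lambda>w. u (fst w)) \<in> borel_measurable step_space"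
    by (rule measurable_compose[OF measurable_fst]) simp
  have "(\<integral>\<^sup>+w. ennreal (exp (\<theta> * fst (snd w)) * u (fst w)) \<partial>nominal x)
      = (\<Sum>y\<in>UNIV. ennreal (K x y) * (ennreal (exp (chi M \<xi>1 \<gamma> y \<theta>)) * ennreal (u y)))"
    using u_pos by (subst nn_integral_nominal)
      (simp_all add: ennreal_mult less_imp_le exp_chi nn_integral_multc)
  also have "\<dots> = ennreal (\<Sum>y\<in>UNIV. K x y * exp (chi M \<xi>1 \<gamma> y \<theta>) * u y)"
    using K_nonneg u_pos by (simp add: sum_ennreal[symmetric] ennreal_mult less_imp_le mult.assoc)
  finally show ?thesis by (simp add: eigen_eq)
qed

end

section \<open>The sampled process\<close>

text \<open>On an event \<open>A\<close> of the past where the conditional law is one fixed measure \<open>\<mu>\<close>, past and next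
  observation are independent, so their joint law on \<open>A\<close> is a product measure. Product measures are
  determined by rectangles, and on these the claim is the definition of a conditional law.\<close>

lemma conditional_law_nn_integral:
  assumes N: "prob_space N" and F: "sets F \<subseteq> sets N" "space F = space N"
    and law: "has_conditional_law N F E Z \<rho>"
    and A: "A \<in> sets F" "\<And>\<omega>. \<omega> \<in> A \<Longrightarrow> \<rho> \<omega> = \<mu>"
    and \<mu>: "prob_space \<mu>" "sets \<mu> = sets E"
    and \<Phi>: "\<Phi> \<in> borel_measurable (F \<Otimes>\<^sub>M E)"
  shows "(\<integral>\<^sup>+\<omega>. indicator A \<omega> * \<Phi> (\<omega>, Z \<omega>) \<partial>N)
    = (\<integral>\<^sup>+\<omega>. indicator A \<omega> * (\<integral>\<^sup>+z. \<Phi> (\<omega>, z) \<partial>\<mu>) \<partial>N)"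
proof -
  interpret N: prob_space N by (rule N)
  interpret \<mu>: prob_space \<mu> by (rule \<mu>)
  have Z: "Z \<in> measurable N E" using law by (simp add: has_conditional_law_def)
  have id: "(\<lambda>\<omega>. \<omega>) \<in> measurable N F" using F by (auto simp: measurable_def sets.sets_into_space)
  have AN: "A \<in> sets N" using A F by auto
  define NA where "NA = density N (indicator A)"
  have NA: "measurable NA = (measurable N :: 'b measure \<Rightarrow> _)" "measurable NA = (measurable N :: ('a \<times> 'b) measure \<Rightarrow> _)"
      "measurable NA = (measurable N :: 'a measure \<Rightarrow> _)"
    unfolding NA_def by (auto intro!: ext)
  have graph: "(\<lambda>\<omega>. (\<omega>, Z \<omega>)) \<in> measurable N (F \<Otimes>\<^sub>M E)" by (intro measurable_Pair id Z)
  have finNA: "finite_measure NA"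
    unfolding NA_def using AN by (intro finite_measureI) (simp add: emeasure_density N.emeasure_eq_measure)
  have eq: "distr NA F (\<lambda>\<omega>. \<omega>) \<Otimes>\<^sub>M \<mu> = distr NA (F \<Otimes>\<^sub>M E) (\<lambda>\<omega>. (\<omega>, Z \<omega>))"
  proof (rule pair_measure_eqI)
    show "sigma_finite_measure (distr NA F (\<lambda>\<omega>. \<omega>))"
      using finite_measure.finite_measure_distr[OF finNA, of "\<lambda>\<omega>. \<omega>" F] id NA
      by (simp add: finite_measure_def)
    show "sigma_finite_measure \<mu>" by unfold_locales
    show "sets (distr NA F (\<lambda>\<omega>. \<omega>) \<Otimes>\<^sub>M \<mu>) = sets (distr NA (F \<Otimes>\<^sub>M E) (\<lambda>\<omega>. (\<omega>, Z \<omega>)))"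
      using \<mu> by (simp cong: sets_pair_measure_cong)
  next
    fix B C assume "B \<in> sets (distr NA F (\<lambda>\<omega>. \<omega>))" "C \<in> sets \<mu>"
    then have B: "B \<in> sets F" and C: "C \<in> sets E" using \<mu> by auto
    have BN: "B \<in> sets N" using B F by auto
    have CN: "Z -` C \<inter> space N \<in> sets N" using Z C by (rule measurable_sets)
    have AB: "A \<inter> B \<in> sets F" using A B by auto
    have "emeasure (distr NA (F \<Otimes>\<^sub>M E) (\<lambda>\<omega>. (\<omega>, Z \<omega>))) (B \<times> C)
        = emeasure NA ((\<lambda>\<omega>. (\<omega>, Z \<omega>)) -` (B \<times> C) \<inter> space NA)"
      using graph B C NA by (intro emeasure_distr) auto
    also have "(\<lambda>\<omega>. (\<omega>, Z \<omega>)) -` (B \<times> C) \<inter> space NA = B \<inter> (Z -` C \<inter> space N)"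
      by (auto simp: NA_def)
    also have "emeasure NA (B \<inter> (Z -` C \<inter> space N)) = (\<integral>\<^sup>+\<omega>. indicator A \<omega> * indicator (B \<inter> (Z -` C \<inter> space N)) \<omega> \<partial>N)"
      unfolding NA_def using AN BN CN by (intro emeasure_density) auto
    also have "\<dots> = (\<integral>\<^sup>+\<omega>. indicator {\<omega> \<in> A \<inter> B. Z \<omega> \<in> C} \<omega> \<partial>N)"
      using sets.sets_into_space[OF AN] by (intro nn_integral_cong) (auto simp: indicator_def)
    also have "\<dots> = emeasure N {\<omega> \<in> A \<inter> B. Z \<omega> \<in> C}"
    proof (rule nn_integral_indicator)
      have "{\<omega> \<in> A \<inter> B. Z \<omega> \<in> C} = A \<inter> B \<inter> (Z -` C \<inter> space N)"
        using sets.sets_into_space[OF AN] by auto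
      then show "{\<omega> \<in> A \<inter> B. Z \<omega> \<in> C} \<in> sets N" using AN BN CN by auto
    qed
    also have "\<dots> = (\<integral>\<^sup>+\<omega>\<in>A \<inter> B. emeasure (\<rho> \<omega>) C \<partial>N)"
      using law AB C unfolding has_conditional_law_def by blast
    also have "\<dots> = (\<integral>\<^sup>+\<omega>. emeasure \<mu> C * indicator (A \<inter> B) \<omega> \<partial>N)"
      using A(2) by (intro nn_integral_cong) (auto simp: indicator_def)
    also have "\<dots> = emeasure \<mu> C * emeasure N (A \<inter> B)"
      using AN BN by (simp add: nn_integral_cmult)
    also have "emeasure N (A \<inter> B) = (\<integral>\<^sup>+\<omega>. indicator A \<omega> * indicator B \<omega> \<partial>N)"
      using AN BN by (simp add: indicator_inter_arith[symmetric])
    also have "\<dots> = emeasure NA B"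
      unfolding NA_def using AN BN by (intro emeasure_density[symmetric]) auto
    also have "\<dots> = emeasure (distr NA F (\<lambda>\<omega>. \<omega>)) B"
      using id B BN NA sets.sets_into_space[OF BN]
      by (subst emeasure_distr) (auto simp: NA_def Int_absorb2)
    finally show "emeasure (distr NA F (\<lambda>\<omega>. \<omega>)) B * emeasure \<mu> C
        = emeasure (distr NA (F \<Otimes>\<^sub>M E) (\<lambda>\<omega>. (\<omega>, Z \<omega>))) (B \<times> C)"
      by (simp add: mult.commute)
  qed
  have [measurable_cong]: "sets \<mu> = sets E" by (rule \<mu>)
  have \<Phi>': "\<Phi> \<in> borel_measurable (F \<Otimes>\<^sub>M \<mu>)"
    using \<Phi> \<mu> by (simp cong: measurable_cong_sets sets_pair_measure_cong)
  have inner: "(\<lambda>\<omega>. \<integral>\<^sup>+z. \<Phi> (\<omega>, z) \<partial>\<mu>) \<in> borel_measurable F"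
    using \<mu>.borel_measurable_nn_integral_fst[OF \<Phi>'] by simp
  have "(\<integral>\<^sup>+\<omega>. indicator A \<omega> * \<Phi> (\<omega>, Z \<omega>) \<partial>N) = (\<integral>\<^sup>+\<omega>. \<Phi> (\<omega>, Z \<omega>) \<partial>NA)"
    unfolding NA_def using AN measurable_compose[OF graph \<Phi>] by (subst nn_integral_density) auto
  also have "\<dots> = (\<integral>\<^sup>+p. \<Phi> p \<partial>distr NA (F \<Otimes>\<^sub>M E) (\<lambda>\<omega>. (\<omega>, Z \<omega>)))"
    using graph \<Phi> NA by (subst nn_integral_distr) auto
  also have "\<dots> = (\<integral>\<^sup>+p. \<Phi> p \<partial>(distr NA F (\<lambda>\<omega>. \<omega>) \<Otimes>\<^sub>M \<mu>))" by (simp only: eq)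
  also have "\<dots> = (\<integral>\<^sup>+\<omega>. (\<integral>\<^sup>+z. \<Phi> (\<omega>, z) \<partial>\<mu>) \<partial>distr NA F (\<lambda>\<omega>. \<omega>))"
    using \<Phi>' by (subst \<mu>.nn_integral_fst[symmetric]) (auto cong: measurable_cong_sets sets_pair_measure_cong)
  also have "\<dots> = (\<integral>\<^sup>+\<omega>. (\<integral>\<^sup>+z. \<Phi> (\<omega>, z) \<partial>\<mu>) \<partial>NA)"
    using id inner NA by (subst nn_integral_distr) auto
  also have "\<dots> = (\<integral>\<^sup>+\<omega>. indicator A \<omega> * (\<integral>\<^sup>+z. \<Phi> (\<omega>, z) \<partial>\<mu>) \<partial>N)"
    unfolding NA_def using AN measurable_compose[OF id inner] by (subst nn_integral_density) auto
  finally show ?thesis .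
qed

lemma less_hit_time_iff: "enat n < hit_time a \<Delta> g l \<longleftrightarrow> (\<forall>k\<le>n. D_path \<Delta> g l k \<le> a)"
proof
  assume "enat n < hit_time a \<Delta> g l"
  then show "\<forall>k\<le>n. D_path \<Delta> g l k \<le> a"
    unfolding hit_time_def by (metis (mono_tags, lifting) Inf_lower enat_ord_simps(1) imageI
        leD le_less_trans mem_Collect_eq not_le_imp_less)
next
  assume *: "\<forall>k\<le>n. D_path \<Delta> g l k \<le> a"
  have "enat (Suc n) \<le> hit_time a \<Delta> g l"
    unfolding hit_time_def
  proof (rule Inf_greatest)
    fix t assume "t \<in> enat ` {n. a < D_path \<Delta> g l n}"
    then obtain k where k: "t = enat k" "a < D_path \<Delta> g l k" by auto
    then have "\<not> k \<le> n" using * by auto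
    then show "enat (Suc n) \<le> t" using k by simp
  qed
  then show "enat n < hit_time a \<Delta> g l" by (meson enat_ord_simps(2) lessI less_le_trans)
qed

locale sampling_model = cramer_kernel P m \<theta> \<theta>' u
  for P :: "'x::finite \<Rightarrow> ('x \<times> real \<times> real) measure" and m \<theta> \<theta>' :: real and u :: "'x \<Rightarrow> real" +
  fixes N :: "'w measure" and a \<Delta> :: real and x0 :: 'x
    and Y :: "nat \<Rightarrow> 'w \<Rightarrow> 'x" and G L :: "nat \<Rightarrow> 'w \<Rightarrow> real"
  assumes Delta_pos: "0 < \<Delta>" and a_pos: "0 < a"
    and sampled: "sampled_process N
      (\<lambda>x. density (P x) (\<lambda>w. ennreal (exp (\<theta> * jump w) * u (fst w) / u x))) P a \<Delta> x0 Y G L"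

sublocale sampling_model \<subseteq> prob_space N
  using sampled by (simp add: sampled_process_def)

context sampling_model
begin

abbreviation "tilted x \<equiv> density (P x) (\<lambda>w. ennreal (exp (\<theta> * jump w) * u (fst w) / u x))"
abbreviation "S n \<omega> \<equiv> S_path (\<lambda>j. G j \<omega>) n"
abbreviation "D n \<omega> \<equiv> D_path \<Delta> (\<lambda>j. G j \<omega>) (\<lambda>j. L j \<omega>) n"
abbreviation "T \<omega> \<equiv> hit_time a \<Delta> (\<lambda>j. G j \<omega>) (\<lambda>j. L j \<omega>)"
abbreviation "\<F> n \<equiv> history N \<Delta> Y G L n"
abbreviation "step n \<omega> \<equiv> (Y (Suc n) \<omega>, G (Suc n) \<omega>, L (Suc n) \<omega>)"

lemma sets_tilted [simp, measurable_cong]: "sets (tilted x) = sets step_space"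
  by (simp add: sets_P)

lemma prob_tilted: "prob_space (tilted x)"
proof
  have "emeasure (tilted x) (space (tilted x)) = (\<integral>\<^sup>+w. ennreal (exp (\<theta> * jump w) * u (fst w) / u x) \<partial>P x)"
    using sets.top[of "P x"] by (simp add: emeasure_density)
  also have "\<dots> = ennreal (\<integral>w. exp (\<theta> * jump w) * u (fst w) / u x \<partial>P x)"
    using u_pos theta by (intro nn_integral_eq_integral integrable_divide weighted_matrix exp_integrable)
      (auto simp: less_imp_le)
  also have "\<dots> = 1" using u_pos[of x] by (simp add: harmonic)
  finally show "emeasure (tilted x) (space (tilted x)) = 1" .
qed

lemma conditional_law: "has_conditional_law N (\<F> n) step_space (step n)
    (\<lambda>\<omega>. if enat n < T \<omega> then tilted (Y n \<omega>) else P (Y n \<omega>))"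
  using sampled by (simp add: sampled_process_def)

lemma step_measurable: "step n \<in> measurable N step_space"
  using conditional_law[of n] by (simp add: has_conditional_law_def)

lemma Y_measurable [measurable]: "Y n \<in> measurable N (count_space UNIV)"
proof (cases n)
  case 0
  then show ?thesis using sampled by (simp add: sampled_process_def)
next
  case (Suc k)
  then show ?thesis using measurable_compose[OF step_measurable[of k] measurable_fst] by simp
qed

lemma G_measurable [measurable]: "G (Suc n) \<in> borel_measurable N"
  using measurable_compose[OF measurable_compose[OF step_measurable[of n] measurable_snd] measurable_fst]
  by simp

lemma L_measurable [measurable]: "L (Suc n) \<in> borel_measurable N"
  using measurable_compose[OF measurable_compose[OF step_measurable[of n] measurable_snd] measurable_snd]
  by simp

lemma S_measurable [measurable]: "S n \<in> borel_measurable N"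
  by (induction n) simp_all

lemma D_measurable [measurable]: "D n \<in> borel_measurable N"
  by (induction n) simp_all

lemma space_history [simp]: "space (\<F> n) = space N"
  by (simp add: history_def)

lemma sets_history: "sets (\<F> n) \<subseteq> sets N"
  unfolding history_def
  by (intro sets_image_in_sets measurable_restrict) (auto simp: measurable_Pair)

lemma history_component:
  assumes "k \<le> n"
  shows "(\<lambda>\<omega>. (Y k \<omega>, S k \<omega>, D k \<omega>)) \<in> measurable (\<F> n) step_space"
proof -
  have "(\<lambda>\<omega>. \<lambda>k\<in>{..n}. (Y k \<omega>, S k \<omega>, D k \<omega>)) \<in> measurable (\<F> n) (PiM {..n} (\<lambda>_. step_space))"
    unfolding history_def
    by (rule measurable_vimage_algebra1) (auto simp: space_PiM space_pair_measure)
  from measurable_compose[OF this measurable_component_singleton[of k]] assms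
  show ?thesis by simp
qed

lemma history_measurable:
  assumes "k \<le> n"
  shows "Y k \<in> measurable (\<F> n) (count_space UNIV)" "S k \<in> borel_measurable (\<F> n)"
    "D k \<in> borel_measurable (\<F> n)"
  using measurable_compose[OF history_component[OF assms] measurable_fst]
    measurable_compose[OF measurable_compose[OF history_component[OF assms] measurable_snd] measurable_fst]
    measurable_compose[OF measurable_compose[OF history_component[OF assms] measurable_snd] measurable_snd]
  by simp_all

lemma before_T_sets: "k \<le> n \<Longrightarrow> {\<omega> \<in> space N. enat k < T \<omega>} \<in> sets (\<F> n)"
proof -
  assume k: "k \<le> n"
  have "{\<omega> \<in> space N. enat k < T \<omega>} = (\<Inter>i\<in>{..k}. {\<omega> \<in> space (\<F> n). D i \<omega> \<le> a})"
    by (auto simp: less_hit_time_iff)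
  also have "\<dots> \<in> sets (\<F> n)"
    using k by (intro sets.finite_INT borel_measurable_le history_measurable) auto
  finally show ?thesis .
qed

lemma history_subalgebra: "f \<in> measurable (\<F> n) B \<Longrightarrow> f \<in> measurable N B"
  using sets_history by (auto simp: measurable_def)

text \<open>The conditional law depends on the past only through the current state, of which there are
  finitely many.\<close>

lemma step_nn_integral:
  assumes A: "A \<in> sets (\<F> n)"
    and \<mu>: "\<And>x. prob_space (\<mu> x)" "\<And>x. sets (\<mu> x) = sets step_space"
      "\<And>\<omega>. \<omega> \<in> A \<Longrightarrow> (if enat n < T \<omega> then tilted (Y n \<omega>) else P (Y n \<omega>)) = \<mu> (Y n \<omega>)"
    and \<Phi>: "\<And>x. \<Phi> x \<in> borel_measurable (\<F> n \<Otimes>\<^sub>M step_space)"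
  shows "(\<integral>\<^sup>+\<omega>. indicator A \<omega> * \<Phi> (Y n \<omega>) (\<omega>, step n \<omega>) \<partial>N)
    = (\<integral>\<^sup>+\<omega>. indicator A \<omega> * (\<integral>\<^sup>+w. \<Phi> (Y n \<omega>) (\<omega>, w) \<partial>\<mu> (Y n \<omega>)) \<partial>N)"
proof -
  define Ax where "Ax x = A \<inter> {\<omega> \<in> space N. Y n \<omega> = x}" for x
  have Ax: "Ax x \<in> sets (\<F> n)" for x
  proof -
    have "Y n -` {x} \<inter> space (\<F> n) \<in> sets (\<F> n)"
      by (rule measurable_sets[OF history_measurable(1)]) auto
    also have "Y n -` {x} \<inter> space (\<F> n) = {\<omega> \<in> space N. Y n \<omega> = x}" by auto
    finally show ?thesis using A by (auto simp: Ax_def)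
  qed
  have split: "indicator A \<omega> * f (Y n \<omega>) = (\<Sum>x\<in>UNIV. indicator (Ax x) \<omega> * f x)"
    if "\<omega> \<in> space N" for \<omega> and f :: "'x \<Rightarrow> ennreal"
  proof -
    have "(\<Sum>x\<in>UNIV. indicator (Ax x) \<omega> * f x) = (\<Sum>x\<in>UNIV. if x = Y n \<omega> then indicator A \<omega> * f x else 0)"
      using that by (intro sum.cong) (auto simp: Ax_def indicator_def)
    then show ?thesis by simp
  qed
  have id: "(\<lambda>\<omega>. \<omega>) \<in> measurable N (\<F> n)"
    using sets_history sets.sets_into_space by (auto simp: measurable_def)
  have m1: "(\<lambda>\<omega>. \<Phi> x (\<omega>, step n \<omega>)) \<in> borel_measurable N" for x
    by (rule measurable_compose[OF measurable_Pair[OF id step_measurable] \<Phi>])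
  have m2: "(\<lambda>\<omega>. \<integral>\<^sup>+w. \<Phi> x (\<omega>, w) \<partial>\<mu> x) \<in> borel_measurable N" for x
  proof -
    interpret \<mu>: prob_space "\<mu> x" by (rule \<mu>)
    have "\<Phi> x \<in> borel_measurable (\<F> n \<Otimes>\<^sub>M \<mu> x)"
      using \<Phi> \<mu>(2) by (simp cong: measurable_cong_sets sets_pair_measure_cong)
    from \<mu>.borel_measurable_nn_integral_fst[OF this] show ?thesis by (rule history_subalgebra)
  qed
  have AxN: "Ax x \<in> sets N" for x using Ax sets_history by blast
  have "(\<integral>\<^sup>+\<omega>. indicator A \<omega> * \<Phi> (Y n \<omega>) (\<omega>, step n \<omega>) \<partial>N)
      = (\<integral>\<^sup>+\<omega>. (\<Sum>x\<in>UNIV. indicator (Ax x) \<omega> * \<Phi> x (\<omega>, step n \<omega>)) \<partial>N)"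
    by (rule nn_integral_cong) (rule split)
  also have "\<dots> = (\<Sum>x\<in>UNIV. \<integral>\<^sup>+\<omega>. indicator (Ax x) \<omega> * \<Phi> x (\<omega>, step n \<omega>) \<partial>N)"
    using m1 AxN by (intro nn_integral_sum) auto
  also have "\<dots> = (\<Sum>x\<in>UNIV. \<integral>\<^sup>+\<omega>. indicator (Ax x) \<omega> * (\<integral>\<^sup>+w. \<Phi> x (\<omega>, w) \<partial>\<mu> x) \<partial>N)"
  proof (rule sum.cong[OF refl])
    fix x
    show "(\<integral>\<^sup>+\<omega>. indicator (Ax x) \<omega> * \<Phi> x (\<omega>, step n \<omega>) \<partial>N)
        = (\<integral>\<^sup>+\<omega>. indicator (Ax x) \<omega> * (\<integral>\<^sup>+w. \<Phi> x (\<omega>, w) \<partial>\<mu> x) \<partial>N)"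
      by (rule conditional_law_nn_integral[OF prob_space_axioms sets_history space_history
            conditional_law Ax _ \<mu>(1,2) \<Phi>])
         (use \<mu>(3) in \<open>auto simp: Ax_def\<close>)
  qed
  also have "\<dots> = (\<integral>\<^sup>+\<omega>. (\<Sum>x\<in>UNIV. indicator (Ax x) \<omega> * (\<integral>\<^sup>+w. \<Phi> x (\<omega>, w) \<partial>\<mu> x)) \<partial>N)"
    using m2 AxN by (intro nn_integral_sum[symmetric]) auto
  also have "\<dots> = (\<integral>\<^sup>+\<omega>. indicator A \<omega> * (\<integral>\<^sup>+w. \<Phi> (Y n \<omega>) (\<omega>, w) \<partial>\<mu> (Y n \<omega>)) \<partial>N)"
    by (rule nn_integral_cong) (rule split[symmetric])
  finally show ?thesis .
qed

text \<open>A tilted transition is absolutely continuous with respect to the nominal one, so null events of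
  nominal transitions are null for the sampled process.\<close>

lemma AE_step:
  assumes Q: "\<And>x. AE w in P x. Q x w" and [measurable]: "\<And>x. Measurable.pred step_space (Q x)"
  shows "AE \<omega> in N. Q (Y n \<omega>) (step n \<omega>)"
proof -
  define B where "B x = {w. \<not> Q x w}" for x
  have B [measurable]: "B x \<in> sets step_space" for x
  proof -
    have "{w \<in> space step_space. \<not> Q x w} \<in> sets step_space" by measurable
    then show ?thesis by (simp add: B_def space_pair_measure)
  qed
  let ?\<mu> = "\<lambda>\<omega>. if enat n < T \<omega> then tilted (Y n \<omega>) else P (Y n \<omega>)"
  have null: "emeasure (P x) (B x) = 0" for x
    using Q[of x] B[of x] by (subst (asm) AE_iff_measurable[of "B x"]) (auto simp: B_def sets_P)
  have null': "emeasure (tilted x) (B x) = 0" for x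
  proof -
    have "AE w in P x. w \<notin> B x" using Q[of x] by (simp add: B_def)
    then have "AE w in P x. ennreal (exp (\<theta> * jump w) * u (fst w) / u x) * indicator (B x) w = 0"
      by eventually_elim simp
    then have "(\<integral>\<^sup>+w. ennreal (exp (\<theta> * jump w) * u (fst w) / u x) * indicator (B x) w \<partial>P x) = 0"
      by (subst nn_integral_0_iff_AE) measurable
    then show ?thesis by (subst emeasure_density) simp_all
  qed
  have Yx: "{\<omega> \<in> space N. Y n \<omega> = x} \<in> sets (\<F> n)" for x
  proof -
    have "Y n -` {x} \<inter> space (\<F> n) \<in> sets (\<F> n)"
      by (rule measurable_sets[OF history_measurable(1)]) auto
    then show ?thesis by (simp add: vimage_def Int_def conj_commute)
  qed
  have "AE \<omega> in N. \<not> (Y n \<omega> = x \<and> step n \<omega> \<in> B x)" for x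
  proof -
    have "emeasure N {\<omega> \<in> {\<omega> \<in> space N. Y n \<omega> = x}. step n \<omega> \<in> B x}
        = (\<integral>\<^sup>+\<omega>\<in>{\<omega> \<in> space N. Y n \<omega> = x}. emeasure (?\<mu> \<omega>) (B x) \<partial>N)"
      using conditional_law[of n] Yx B unfolding has_conditional_law_def by blast
    also have "\<dots> = (\<integral>\<^sup>+\<omega>. 0 \<partial>N)"
      by (intro nn_integral_cong) (auto simp: null null' indicator_def)
    finally have 0: "emeasure N {\<omega> \<in> {\<omega> \<in> space N. Y n \<omega> = x}. step n \<omega> \<in> B x} = 0" by simp
    have "{\<omega> \<in> {\<omega> \<in> space N. Y n \<omega> = x}. step n \<omega> \<in> B x}
        = {\<omega> \<in> space N. Y n \<omega> = x} \<inter> (step n -` B x \<inter> space N)" by auto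
    also have "\<dots> \<in> sets N"
      using Yx sets_history measurable_sets[OF step_measurable B] by blast
    finally have "{\<omega> \<in> {\<omega> \<in> space N. Y n \<omega> = x}. step n \<omega> \<in> B x} \<in> null_sets N" using 0 by auto
    then show ?thesis by (rule AE_I') auto
  qed
  then have "AE \<omega> in N. \<forall>x. \<not> (Y n \<omega> = x \<and> step n \<omega> \<in> B x)"
    by (intro AE_all_countable[THEN iffD2] allI)
  then show ?thesis by eventually_elim (auto simp: B_def)
qed

lemma AE_load_range: "AE \<omega> in N. \<forall>n. 0 \<le> L (Suc n) \<omega> \<and> L (Suc n) \<omega> < m"
proof -
  have "AE \<omega> in N. 0 \<le> L (Suc n) \<omega> \<and> L (Suc n) \<omega> < m" for n
    using AE_step[of "\<lambda>x w. 0 \<le> load w \<and> load w < m" n] load_range by simp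
  then show ?thesis by (simp add: AE_all_countable)
qed

end

section \<open>Likelihood ratio weights\<close>

context sampling_model
begin

text \<open>The reciprocal of the martingale \<open>exp (\<theta> S\<^sub>n) u (X\<^sub>n) / u x0\<close>, stopped at \<open>T\<close>. It is the
  likelihood ratio of nominal to sampling dynamics up to time \<open>n\<close>; the minimum also keeps the
  argument of \<open>the_enat\<close> finite.\<close>

definition weight :: "nat \<Rightarrow> 'w \<Rightarrow> real" where
  "weight n \<omega> = (let \<tau> = the_enat (min (enat n) (T \<omega>))
    in exp (- \<theta> * S \<tau> \<omega>) * (u x0 / u (Y \<tau> \<omega>)))"

lemma weight_before: "enat n < T \<omega> \<Longrightarrow> weight n \<omega> = exp (- \<theta> * S n \<omega>) * (u x0 / u (Y n \<omega>))"
  by (simp add: weight_def Let_def min_def less_imp_le)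

lemma weight_at:
  assumes "T \<omega> = enat k" "k \<le> n"
  shows "weight n \<omega> = exp (- \<theta> * S k \<omega>) * (u x0 / u (Y k \<omega>))"
  using assms by (simp add: weight_def Let_def min_def)

lemma weight_0: "weight 0 \<omega> = u x0 / u (Y 0 \<omega>)"
proof -
  have "min (enat 0) (T \<omega>) = enat 0" by (simp add: min_def zero_enat_def[symmetric])
  then show ?thesis by (simp add: weight_def)
qed

lemma weight_Suc: "weight (Suc n) \<omega> =
  (if enat n < T \<omega> then exp (- \<theta> * S (Suc n) \<omega>) * (u x0 / u (Y (Suc n) \<omega>)) else weight n \<omega>)"
proof (cases "enat n < T \<omega>")
  case True
  then have "enat (Suc n) \<le> T \<omega>" by (simp add: Suc_ile_eq)
  then show ?thesis using True by (simp add: weight_def Let_def min_def)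
next
  case False
  then have "T \<omega> \<le> enat n" by simp
  moreover from this have "T \<omega> \<le> enat (Suc n)" by (meson enat_ord_simps(1) le_SucI order_refl order_trans)
  ultimately show ?thesis using False by (simp add: weight_def min_def Let_def)
qed

lemma weight_Suc_before: "enat n < T \<omega> \<Longrightarrow>
  weight (Suc n) \<omega> = weight n \<omega> * (u (Y n \<omega>) / u (Y (Suc n) \<omega>) * exp (- \<theta> * G (Suc n) \<omega>))"
  using u_pos[of "Y n \<omega>"] by (simp add: weight_Suc weight_before exp_add[symmetric] algebra_simps)

lemma weight_pos: "0 < weight n \<omega>"
  using u_pos by (simp add: weight_def Let_def)

lemma weight_measurable: "n \<le> k \<Longrightarrow> weight n \<in> borel_measurable (\<F> k)"
proof (induction n)
  case 0
  have "(\<lambda>\<omega>. u x0 / u (Y 0 \<omega>)) \<in> borel_measurable (\<F> k)"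
    by (rule measurable_compose[OF history_measurable(1)[OF 0], of "\<lambda>y. u x0 / u y"]) simp
  moreover have "weight 0 = (\<lambda>\<omega>. u x0 / u (Y 0 \<omega>))" by (rule ext) (rule weight_0)
  ultimately show ?case by (simp only:)
next
  case (Suc n)
  have now: "(\<lambda>\<omega>. u x0 / u (Y (Suc n) \<omega>)) \<in> borel_measurable (\<F> k)"
    by (rule measurable_compose[OF history_measurable(1)[OF Suc(2)], of "\<lambda>y. u x0 / u y"]) simp
  have "(\<lambda>\<omega>. if enat n < T \<omega> then exp (- \<theta> * S (Suc n) \<omega>) * (u x0 / u (Y (Suc n) \<omega>)) else weight n \<omega>)
      \<in> borel_measurable (\<F> k)"
  proof (rule measurable_If)
    show "(\<lambda>\<omega>. exp (- \<theta> * S (Suc n) \<omega>) * (u x0 / u (Y (Suc n) \<omega>))) \<in> borel_measurable (\<F> k)"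
      by (intro borel_measurable_times now
          measurable_compose[OF history_measurable(2)[OF Suc(2)], of "\<lambda>s. exp (- \<theta> * s)"]) simp
    show "weight n \<in> borel_measurable (\<F> k)" by (rule Suc.IH) (use Suc.prems in simp)
    show "{\<omega> \<in> space (\<F> k). enat n < T \<omega>} \<in> sets (\<F> k)"
      using before_T_sets[of n k] Suc.prems by simp
  qed
  moreover have "weight (Suc n) = (\<lambda>\<omega>. if enat n < T \<omega>
      then exp (- \<theta> * S (Suc n) \<omega>) * (u x0 / u (Y (Suc n) \<omega>)) else weight n \<omega>)"
    by (rule ext) (rule weight_Suc)
  ultimately show ?case by (simp only:)
qed

lemma weight_measurable_N [measurable]: "weight n \<in> borel_measurable N"
  using weight_measurable[of n n] by (intro history_subalgebra[of _ n]) simp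

abbreviation "ahead n \<omega> \<equiv> indicator {\<omega>. enat n < T \<omega>} \<omega> :: ennreal"
abbreviation "past n \<omega> \<equiv> indicator {\<omega>. \<not> enat n < T \<omega>} \<omega> :: ennreal"
abbreviation "tail b j n \<omega> \<equiv> exceed j (Y n \<omega>) (\<Delta> * exp (S n \<omega>)) (b - D n \<omega>)"

lemma tail_measurable [measurable]: "tail b j n \<in> borel_measurable N"
  by measurable

lemma exceed_nn_integral:
  "(\<integral>\<^sup>+w. ennreal (exceed_next j c e w) \<partial>P x)
    = ennreal (exceed (Suc j) x c e)"
  unfolding exceed.simps(2)
  by (rule nn_integral_eq_integral[OF exceed_step_integrable]) (simp add: exceed_bounds)

lemma tilted_exceed_nn_integral:
  "(\<integral>\<^sup>+w. ennreal (u x / u (fst w) * exp (- \<theta> * jump w)) *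
      ennreal (exceed_next j c e w) \<partial>tilted x)
    = ennreal (exceed (Suc j) x c e)"
proof -
  have [measurable]: "(\<lambda>w. u x / u (fst w)) \<in> borel_measurable (P x)" by (rule next_fun_measurable)
  have "(\<integral>\<^sup>+w. ennreal (u x / u (fst w) * exp (- \<theta> * jump w)) *
      ennreal (exceed_next j c e w) \<partial>tilted x)
    = (\<integral>\<^sup>+w. ennreal (exp (\<theta> * jump w) * u (fst w) / u x) * (ennreal (u x / u (fst w) * exp (- \<theta> * jump w)) *
      ennreal (exceed_next j c e w)) \<partial>P x)"
    by (rule nn_integral_density) measurable
  also have "\<dots> = (\<integral>\<^sup>+w. ennreal (exceed_next j c e w) \<partial>P x)"
  proof (rule nn_integral_cong)
    fix w
    have "exp (\<theta> * jump w) * u (fst w) / u x * (u x / u (fst w) * exp (- \<theta> * jump w)) = 1"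
      using u_pos[of x] u_pos[of "fst w"] by (simp add: exp_minus)
    then show "ennreal (exp (\<theta> * jump w) * u (fst w) / u x) * (ennreal (u x / u (fst w) * exp (- \<theta> * jump w)) *
        ennreal (exceed_next j c e w))
      = ennreal (exceed_next j c e w)"
      using u_pos by (simp add: ennreal_mult[symmetric] mult.assoc[symmetric] exceed_bounds less_imp_le)
  qed
  finally show ?thesis by (simp only: exceed_nn_integral)
qed

lemma tail_Suc: "tail b j (Suc n) \<omega> = exceed j (Y (Suc n) \<omega>) (\<Delta> * exp (S n \<omega>) * exp (G (Suc n) \<omega>))
    (b - D n \<omega> - L (Suc n) \<omega> * (\<Delta> * exp (S n \<omega>) * exp (G (Suc n) \<omega>)))"
  by (simp add: exp_add algebra_simps)

text \<open>After \<open>T\<close> the transitions are nominal, hence one transition is one unfolding of \<open>exceed\<close>.\<close>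

lemma step_after:
  assumes H: "H \<in> borel_measurable (\<F> n)"
  shows "(\<integral>\<^sup>+\<omega>. past n \<omega> * (H \<omega> * ennreal (tail b j (Suc n) \<omega>)) \<partial>N)
    = (\<integral>\<^sup>+\<omega>. past n \<omega> * (H \<omega> * ennreal (tail b (Suc j) n \<omega>)) \<partial>N)"
proof -
  define A where "A = {\<omega> \<in> space N. \<not> enat n < T \<omega>}"
  have A: "A \<in> sets (\<F> n)"
  proof -
    have "A = space (\<F> n) - {\<omega> \<in> space N. enat n < T \<omega>}" by (auto simp: A_def)
    then show ?thesis using sets.compl_sets[OF before_T_sets[of n n]] by simp
  qed
  have [measurable]: "S n \<in> borel_measurable (\<F> n)" "D n \<in> borel_measurable (\<F> n)"
    "H \<in> borel_measurable (\<F> n)"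
    using history_measurable[of n n] H by auto
  define \<Phi> where "\<Phi> = (\<lambda>(x::'x) p. H (fst p) * ennreal (exceed j (fst (snd p))
    (\<Delta> * exp (S n (fst p)) * exp (jump (snd p)))
    (b - D n (fst p) - load (snd p) * (\<Delta> * exp (S n (fst p)) * exp (jump (snd p))))))"
  have \<Phi>: "\<Phi> x \<in> borel_measurable (\<F> n \<Otimes>\<^sub>M step_space)" for x
    unfolding \<Phi>_def by measurable
  have "(\<integral>\<^sup>+\<omega>. past n \<omega> * (H \<omega> * ennreal (tail b j (Suc n) \<omega>)) \<partial>N)
      = (\<integral>\<^sup>+\<omega>. indicator A \<omega> * \<Phi> (Y n \<omega>) (\<omega>, step n \<omega>) \<partial>N)"
    unfolding tail_Suc by (intro nn_integral_cong) (auto simp: A_def \<Phi>_def indicator_def)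
  also have "\<dots> = (\<integral>\<^sup>+\<omega>. indicator A \<omega> * (\<integral>\<^sup>+w. \<Phi> (Y n \<omega>) (\<omega>, w) \<partial>P (Y n \<omega>)) \<partial>N)"
    by (rule step_nn_integral[OF A prob_P sets_P _ \<Phi>]) (simp add: A_def)
  also have "\<dots> = (\<integral>\<^sup>+\<omega>. past n \<omega> * (H \<omega> * ennreal (tail b (Suc j) n \<omega>)) \<partial>N)"
  proof (rule nn_integral_cong)
    fix \<omega> assume "\<omega> \<in> space N"
    have "(\<integral>\<^sup>+w. \<Phi> (Y n \<omega>) (\<omega>, w) \<partial>P (Y n \<omega>)) = H \<omega> * ennreal (tail b (Suc j) n \<omega>)"
      unfolding \<Phi>_def fst_conv snd_conv
      by (subst nn_integral_cmult) (measurable, simp only: exceed_nn_integral)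
    then show "indicator A \<omega> * (\<integral>\<^sup>+w. \<Phi> (Y n \<omega>) (\<omega>, w) \<partial>P (Y n \<omega>))
        = past n \<omega> * (H \<omega> * ennreal (tail b (Suc j) n \<omega>))"
      using \<open>\<omega> \<in> space N\<close> by (simp add: A_def indicator_def)
  qed
  finally show ?thesis .
qed

text \<open>Before \<open>T\<close> the increment of the weight undoes the tilting, so again one transition is one
  unfolding of \<open>exceed\<close>.\<close>

lemma step_before:
  assumes H: "H \<in> borel_measurable (\<F> n)"
  shows "(\<integral>\<^sup>+\<omega>. ahead n \<omega> * (H \<omega> *
      (ennreal (u (Y n \<omega>) / u (Y (Suc n) \<omega>) * exp (- \<theta> * G (Suc n) \<omega>)) * ennreal (tail b j (Suc n) \<omega>))) \<partial>N)
    = (\<integral>\<^sup>+\<omega>. ahead n \<omega> * (H \<omega> * ennreal (tail b (Suc j) n \<omega>)) \<partial>N)"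
proof -
  define A where "A = {\<omega> \<in> space N. enat n < T \<omega>}"
  have A: "A \<in> sets (\<F> n)" unfolding A_def by (rule before_T_sets) simp
  have [measurable]: "S n \<in> borel_measurable (\<F> n)" "D n \<in> borel_measurable (\<F> n)"
    "H \<in> borel_measurable (\<F> n)"
    using history_measurable[of n n] H by auto
  define \<Phi> where "\<Phi> = (\<lambda>x p. H (fst p) * (ennreal (u x / u (fst (snd p)) * exp (- \<theta> * jump (snd p))) *
    ennreal (exceed j (fst (snd p)) (\<Delta> * exp (S n (fst p)) * exp (jump (snd p)))
    (b - D n (fst p) - load (snd p) * (\<Delta> * exp (S n (fst p)) * exp (jump (snd p)))))))"
  have [measurable]: "(\<lambda>w. u x / u (fst w)) \<in> borel_measurable step_space" for x
    by (rule measurable_compose[OF measurable_fst]) simp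
  have \<Phi>: "\<Phi> x \<in> borel_measurable (\<F> n \<Otimes>\<^sub>M step_space)" for x
  proof -
    have [measurable]: "(\<lambda>p. u x / u (fst (snd p))) \<in> borel_measurable (\<F> n \<Otimes>\<^sub>M step_space)"
      by (rule measurable_compose[OF measurable_snd]) measurable
    show ?thesis unfolding \<Phi>_def by measurable
  qed
  have "(\<integral>\<^sup>+\<omega>. ahead n \<omega> * (H \<omega> *
      (ennreal (u (Y n \<omega>) / u (Y (Suc n) \<omega>) * exp (- \<theta> * G (Suc n) \<omega>)) * ennreal (tail b j (Suc n) \<omega>))) \<partial>N)
      = (\<integral>\<^sup>+\<omega>. indicator A \<omega> * \<Phi> (Y n \<omega>) (\<omega>, step n \<omega>) \<partial>N)"
    unfolding tail_Suc by (intro nn_integral_cong) (auto simp: A_def \<Phi>_def indicator_def)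
  also have "\<dots> = (\<integral>\<^sup>+\<omega>. indicator A \<omega> * (\<integral>\<^sup>+w. \<Phi> (Y n \<omega>) (\<omega>, w) \<partial>tilted (Y n \<omega>)) \<partial>N)"
    by (rule step_nn_integral[OF A prob_tilted sets_tilted _ \<Phi>]) (simp add: A_def)
  also have "\<dots> = (\<integral>\<^sup>+\<omega>. ahead n \<omega> * (H \<omega> * ennreal (tail b (Suc j) n \<omega>)) \<partial>N)"
  proof (rule nn_integral_cong)
    fix \<omega> assume "\<omega> \<in> space N"
    have "(\<integral>\<^sup>+w. \<Phi> (Y n \<omega>) (\<omega>, w) \<partial>tilted (Y n \<omega>)) = H \<omega> * ennreal (tail b (Suc j) n \<omega>)"
      unfolding \<Phi>_def fst_conv snd_conv
      by (subst nn_integral_cmult) (measurable, simp only: tilted_exceed_nn_integral)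
    then show "indicator A \<omega> * (\<integral>\<^sup>+w. \<Phi> (Y n \<omega>) (\<omega>, w) \<partial>tilted (Y n \<omega>))
        = ahead n \<omega> * (H \<omega> * ennreal (tail b (Suc j) n \<omega>))"
      using \<open>\<omega> \<in> space N\<close> by (simp add: A_def indicator_def)
  qed
  finally show ?thesis .
qed

lemma before_T_pred [measurable]: "Measurable.pred N (\<lambda>\<omega>. enat n < T \<omega>)"
  using before_T_sets[of n n] sets_history by (auto simp: pred_def)

lemma AE_initial: "AE \<omega> in N. Y 0 \<omega> = x0"
  using sampled by (simp add: sampled_process_def)

text \<open>Each transition of the weighted sampled process acts as a nominal one, so time may be traded for
  horizon until the initial state is reached. This is the change of measure behind unbiasedness.\<close>

theorem weighted_tail_invariant:
  "(\<integral>\<^sup>+\<omega>. ennreal (weight n \<omega> * tail b j n \<omega>) \<partial>N) = ennreal (exceed (n + j) x0 \<Delta> b)"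
proof (induction n arbitrary: j)
  case 0
  have "(\<integral>\<^sup>+\<omega>. ennreal (weight 0 \<omega> * tail b j 0 \<omega>) \<partial>N) = (\<integral>\<^sup>+\<omega>. ennreal (exceed j x0 \<Delta> b) \<partial>N)"
    using AE_initial u_pos[of x0] by (intro nn_integral_cong_AE) (auto simp: weight_0)
  then show ?case by (simp add: emeasure_space_1)
next
  case (Suc n)
  have H: "(\<lambda>\<omega>. ennreal (weight n \<omega>)) \<in> borel_measurable (\<F> n)" using weight_measurable[of n n] by simp
  have "(\<integral>\<^sup>+\<omega>. ennreal (weight (Suc n) \<omega> * tail b j (Suc n) \<omega>) \<partial>N)
      = (\<integral>\<^sup>+\<omega>. ahead n \<omega> * (ennreal (weight n \<omega>) *
      (ennreal (u (Y n \<omega>) / u (Y (Suc n) \<omega>) * exp (- \<theta> * G (Suc n) \<omega>)) * ennreal (tail b j (Suc n) \<omega>)))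
      + past n \<omega> * (ennreal (weight n \<omega>) * ennreal (tail b j (Suc n) \<omega>)) \<partial>N)"
  proof (rule nn_integral_cong)
    fix \<omega>
    show "ennreal (weight (Suc n) \<omega> * tail b j (Suc n) \<omega>)
      = ahead n \<omega> * (ennreal (weight n \<omega>) *
      (ennreal (u (Y n \<omega>) / u (Y (Suc n) \<omega>) * exp (- \<theta> * G (Suc n) \<omega>)) * ennreal (tail b j (Suc n) \<omega>)))
      + past n \<omega> * (ennreal (weight n \<omega>) * ennreal (tail b j (Suc n) \<omega>))"
    proof (cases "enat n < T \<omega>")
      case True
      define r where "r = u (Y n \<omega>) / u (Y (Suc n) \<omega>) * exp (- \<theta> * G (Suc n) \<omega>)"
      have "0 \<le> r" using u_pos by (simp add: r_def less_imp_le)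
      then show ?thesis
        using True weight_pos[of n \<omega>] exceed_bounds(1)
        unfolding weight_Suc_before[OF True] r_def[symmetric]
        by (simp add: ennreal_mult mult.assoc less_imp_le del: S_path.simps D_path.simps)
    next
      case False
      then show ?thesis
        using weight_pos[of n \<omega>] exceed_bounds(1)
        by (simp add: weight_Suc ennreal_mult less_imp_le del: S_path.simps D_path.simps)
    qed
  qed
  also have "\<dots> = (\<integral>\<^sup>+\<omega>. ahead n \<omega> * (ennreal (weight n \<omega>) * ennreal (tail b (Suc j) n \<omega>)) \<partial>N)
      + (\<integral>\<^sup>+\<omega>. past n \<omega> * (ennreal (weight n \<omega>) * ennreal (tail b (Suc j) n \<omega>)) \<partial>N)"
  proof -
    have [measurable]: "(\<lambda>\<omega>. u (Y n \<omega>) / u (Y (Suc n) \<omega>)) \<in> borel_measurable N"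
      by (intro borel_measurable_divide measurable_compose[OF Y_measurable]) simp_all
    show ?thesis
      by (subst nn_integral_add) (measurable, simp only: step_before[OF H] step_after[OF H])
  qed
  also have "\<dots> = (\<integral>\<^sup>+\<omega>. ennreal (weight n \<omega> * tail b (Suc j) n \<omega>) \<partial>N)"
    using weight_pos exceed_bounds(1)
    by (subst nn_integral_add[symmetric], measurable)
       (auto intro!: nn_integral_cong simp: indicator_def ennreal_mult less_imp_le)
  also have "\<dots> = ennreal (exceed (Suc n + j) x0 \<Delta> b)" using Suc[of "Suc j"] by simp
  finally show ?case .
qed

end

section \<open>Moments of the estimator\<close>

lemma D_path_mono:
  assumes "0 \<le> \<Delta>" "\<And>k. 0 \<le> l (Suc k)" "k \<le> n"
  shows "D_path \<Delta> g l k \<le> D_path \<Delta> g l n"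
  by (rule lift_Suc_mono_le[OF _ assms(3)]) (use assms(1,2) in simp)

lemma D_inf_greater_iff:
  assumes "0 \<le> \<Delta>" "\<And>k. 0 \<le> l (Suc k)"
  shows "ereal b < D_inf \<Delta> g l \<longleftrightarrow> (\<exists>n. b < D_path \<Delta> g l n)"
proof -
  have "incseq (\<lambda>n. ereal (D_path \<Delta> g l n))"
    using D_path_mono[of \<Delta> l, OF assms] by (auto simp: incseq_def)
  then have "D_inf \<Delta> g l = (SUP n. ereal (D_path \<Delta> g l n))"
    unfolding D_inf_def by (intro limI LIMSEQ_SUP)
  then show ?thesis by (simp add: less_SUP_iff)
qed

context sampling_model
begin

text \<open>One factor of the squared weight is paid by the pointwise bound at the moment \<open>T = n + 1\<close>. Once
  \<open>T\<close> has passed, the weight is frozen and a transition only moves the horizon of \<open>tail\<close>. The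
  generality in \<open>j\<close> serves this induction.\<close>

lemma second_moment_reduction:
  assumes C: "0 \<le> C" and pointwise: "\<And>n j. AE \<omega> in N. enat n < T \<omega> \<longrightarrow> \<not> enat (Suc n) < T \<omega> \<longrightarrow>
      weight (Suc n) \<omega> * tail b j (Suc n) \<omega> \<le> C"
  shows "(\<integral>\<^sup>+\<omega>. past n \<omega> * ennreal ((weight n \<omega>)\<^sup>2 * tail b j n \<omega>) \<partial>N)
    \<le> ennreal C * (\<integral>\<^sup>+\<omega>. past n \<omega> * ennreal (weight n \<omega>) \<partial>N)"
proof (induction n arbitrary: j)
  case 0
  have "enat 0 < T \<omega>" for \<omega> using a_pos by (simp add: less_hit_time_iff)
  then show ?case by simp
next
  case (Suc n)
  let ?now = "{\<omega>. enat n < T \<omega> \<and> \<not> enat (Suc n) < T \<omega>}"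
  have T_mono: "enat n < T \<omega>" if "enat (Suc n) < T \<omega>" for \<omega>
    using that by (meson enat_ord_simps(2) lessI less_trans)
  have split: "past (Suc n) \<omega> * f
      = past n \<omega> * f + indicator ?now \<omega> * f" for \<omega> and f :: ennreal
    using T_mono[of \<omega>] by (auto simp: indicator_def)
  have frozen: "past n \<omega> * h (weight (Suc n) \<omega>)
      = past n \<omega> * h (weight n \<omega>)" for \<omega> and h :: "real \<Rightarrow> ennreal"
    by (auto simp: indicator_def weight_Suc)
  have H: "(\<lambda>\<omega>. ennreal ((weight n \<omega>)\<^sup>2)) \<in> borel_measurable (\<F> n)"
    using weight_measurable[of n n] by simp
  have old: "(\<integral>\<^sup>+\<omega>. past n \<omega> * ennreal ((weight n \<omega>)\<^sup>2 * tail b j (Suc n) \<omega>) \<partial>N)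
      \<le> ennreal C * (\<integral>\<^sup>+\<omega>. past n \<omega> * ennreal (weight n \<omega>) \<partial>N)"
  proof -
    have "(\<integral>\<^sup>+\<omega>. past n \<omega> * ennreal ((weight n \<omega>)\<^sup>2 * tail b j (Suc n) \<omega>) \<partial>N)
      = (\<integral>\<^sup>+\<omega>. past n \<omega> * (ennreal ((weight n \<omega>)\<^sup>2) * ennreal (tail b j (Suc n) \<omega>)) \<partial>N)"
      by (simp only: ennreal_mult[OF zero_le_power2 exceed_bounds(1)])
    also have "\<dots> = (\<integral>\<^sup>+\<omega>. past n \<omega> * ennreal ((weight n \<omega>)\<^sup>2 * tail b (Suc j) n \<omega>) \<partial>N)"
      by (simp only: step_after[OF H] ennreal_mult[OF zero_le_power2 exceed_bounds(1)])
    finally show ?thesis using Suc[of "Suc j"] by simp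
  qed
  have new: "(\<integral>\<^sup>+\<omega>. indicator ?now \<omega> * ennreal ((weight (Suc n) \<omega>)\<^sup>2 * tail b j (Suc n) \<omega>) \<partial>N)
      \<le> ennreal C * (\<integral>\<^sup>+\<omega>. indicator ?now \<omega> * ennreal (weight (Suc n) \<omega>) \<partial>N)"
  proof -
    have "(\<integral>\<^sup>+\<omega>. indicator ?now \<omega> * ennreal ((weight (Suc n) \<omega>)\<^sup>2 * tail b j (Suc n) \<omega>) \<partial>N)
      \<le> (\<integral>\<^sup>+\<omega>. ennreal C * (indicator ?now \<omega> * ennreal (weight (Suc n) \<omega>)) \<partial>N)"
    proof (rule nn_integral_mono_AE)
      show "AE \<omega> in N. indicator ?now \<omega> * ennreal ((weight (Suc n) \<omega>)\<^sup>2 * tail b j (Suc n) \<omega>)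
          \<le> ennreal C * (indicator ?now \<omega> * ennreal (weight (Suc n) \<omega>))"
        using pointwise[of n j]
      proof eventually_elim
        case (elim \<omega>)
        show ?case
        proof (cases "\<omega> \<in> ?now")
          case True
          then have "weight (Suc n) \<omega> * tail b j (Suc n) \<omega> \<le> C" using elim by blast
          then have "weight (Suc n) \<omega> * tail b j (Suc n) \<omega> * weight (Suc n) \<omega> \<le> C * weight (Suc n) \<omega>"
            using weight_pos[of "Suc n" \<omega>] by (intro mult_right_mono) auto
          then have "(weight (Suc n) \<omega>)\<^sup>2 * tail b j (Suc n) \<omega> \<le> C * weight (Suc n) \<omega>"
            by (simp only: power2_eq_square mult_ac)
          from ennreal_leI[OF this] True show ?thesis
            using C weight_pos[of "Suc n" \<omega>] by (simp add: ennreal_mult less_imp_le)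
        qed simp
      qed
    qed
    also have "\<dots> = ennreal C * (\<integral>\<^sup>+\<omega>. indicator ?now \<omega> * ennreal (weight (Suc n) \<omega>) \<partial>N)"
      by (rule nn_integral_cmult) measurable
    finally show ?thesis .
  qed
  have "(\<integral>\<^sup>+\<omega>. past (Suc n) \<omega> * ennreal ((weight (Suc n) \<omega>)\<^sup>2 * tail b j (Suc n) \<omega>) \<partial>N)
    = (\<integral>\<^sup>+\<omega>. past n \<omega> * ennreal ((weight n \<omega>)\<^sup>2 * tail b j (Suc n) \<omega>) \<partial>N)
      + (\<integral>\<^sup>+\<omega>. indicator ?now \<omega> * ennreal ((weight (Suc n) \<omega>)\<^sup>2 * tail b j (Suc n) \<omega>) \<partial>N)"
    unfolding split frozen[of _ "\<lambda>v. ennreal (v\<^sup>2 * tail b j (Suc n) _)"]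
    by (rule nn_integral_add) measurable
  also have "\<dots> \<le> ennreal C * (\<integral>\<^sup>+\<omega>. past n \<omega> * ennreal (weight n \<omega>) \<partial>N)
      + ennreal C * (\<integral>\<^sup>+\<omega>. indicator ?now \<omega> * ennreal (weight (Suc n) \<omega>) \<partial>N)"
    by (rule add_mono[OF old new])
  also have "\<dots> = ennreal C * (\<integral>\<^sup>+\<omega>. past n \<omega> * ennreal (weight n \<omega>)
      + indicator ?now \<omega> * ennreal (weight (Suc n) \<omega>) \<partial>N)"
    by (subst nn_integral_add) (measurable, simp only: distrib_left)
  also have "\<dots> = ennreal C * (\<integral>\<^sup>+\<omega>. past (Suc n) \<omega> * ennreal (weight (Suc n) \<omega>) \<partial>N)"
    unfolding split by (simp only: frozen)
  finally show ?case .
qed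

text \<open>At time \<open>T\<close> the level \<open>a\<close> has just been passed, and the load is less than \<open>m\<close>; with
  \<open>q = \<Delta> exp S\<^sub>T\<close> this gives \<open>D\<^sub>T \<le> a + m q\<close>. If \<open>m q \<le> (1 - a) / 2\<close>, the residual level is at
  least \<open>(1 - a) / 2\<close> and the upper tail bound gives order \<open>q\<^sup>\<theta>\<close>; otherwise \<open>q\<close> is bounded
  below and the trivial bound \<open>1\<close> is of that order. The weight \<open>exp (- \<theta> S\<^sub>T)\<close> turns
  \<open>q\<^sup>\<theta>\<close> into \<open>\<Delta>\<^sup>\<theta>\<close>. A small \<open>S\<^sub>T\<close>
  makes the weight large, but then \<open>D\<close> is still far from \<open>1\<close>.\<close>

lemma overshoot_bound:
  assumes a: "a < 1" and C0: "0 < C0"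
      "\<And>n x c e. 0 < c \<Longrightarrow> 0 < e \<Longrightarrow> exceed n x c e \<le> C0 * (c / e) powr \<theta>"
    and u0: "0 < u0" "\<And>x. u0 \<le> u x"
  shows "AE \<omega> in N. enat n < T \<omega> \<longrightarrow> \<not> enat (Suc n) < T \<omega> \<longrightarrow> weight (Suc n) \<omega> * tail 1 j (Suc n) \<omega>
    \<le> u x0 / u0 * max (C0 * (2 / (1 - a)) powr \<theta>) ((2 * m / (1 - a)) powr \<theta>) * \<Delta> powr \<theta>"
  using AE_load_range
proof eventually_elim
  case (elim \<omega>)
  show ?case
  proof (intro impI)
    assume before: "enat n < T \<omega>"
    define q where "q = \<Delta> * exp (S (Suc n) \<omega>)"
    define e where "e = 1 - D (Suc n) \<omega>"
    define C1 where "C1 = max (C0 * (2 / (1 - a)) powr \<theta>) ((2 * m / (1 - a)) powr \<theta>)"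
    have q: "0 < q" using Delta_pos by (simp add: q_def)
    have L: "0 \<le> L (Suc n) \<omega>" "L (Suc n) \<omega> < m" using elim by auto
    have "D n \<omega> \<le> a" using before by (simp add: less_hit_time_iff)
    moreover have "L (Suc n) \<omega> * q \<le> m * q" using L q by (intro mult_right_mono) auto
    ultimately have "D (Suc n) \<omega> \<le> a + m * q" by (simp add: q_def mult_ac)
    then have e: "1 - a - m * q \<le> e" by (simp add: e_def)
    have main: "exceed j (Y (Suc n) \<omega>) q e \<le> C1 * q powr \<theta>"
    proof (cases "m * q \<le> (1 - a) / 2")
      case True
      then have e2: "(1 - a) / 2 \<le> e" using e by (simp add: field_simps)
      moreover have "0 < (1 - a) / 2" using a by simp
      ultimately have e0: "0 < e" by (rule less_le_trans[rotated])
      have "q / e \<le> q / ((1 - a) / 2)" using e2 e0 q a by (intro divide_left_mono) auto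
      also have "\<dots> = 2 / (1 - a) * q" by simp
      finally have "(q / e) powr \<theta> \<le> (2 / (1 - a) * q) powr \<theta>"
        using q e0 theta by (intro powr_mono2) auto
      also have "\<dots> = (2 / (1 - a)) powr \<theta> * q powr \<theta>" using q a by (intro powr_mult)
      finally have "C0 * (q / e) powr \<theta> \<le> C0 * (2 / (1 - a)) powr \<theta> * q powr \<theta>"
        using C0(1) by simp
      also have "\<dots> \<le> C1 * q powr \<theta>" by (intro mult_right_mono) (auto simp: C1_def)
      finally show ?thesis using C0(2)[OF q e0, of j "Y (Suc n) \<omega>"] by linarith
    next
      case False
      then have "1 \<le> 2 * m / (1 - a) * q" using a by (simp add: field_simps)
      then have "1 powr \<theta> \<le> (2 * m / (1 - a) * q) powr \<theta>" using theta by (intro powr_mono2) auto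
      also have "\<dots> = (2 * m / (1 - a)) powr \<theta> * q powr \<theta>" using q a m_pos by (intro powr_mult)
      also have "\<dots> \<le> C1 * q powr \<theta>" by (intro mult_right_mono) (auto simp: C1_def)
      finally show ?thesis using exceed_bounds(2)[of j "Y (Suc n) \<omega>" q e] by simp
    qed
    have w: "weight (Suc n) \<omega> = exp (- \<theta> * S (Suc n) \<omega>) * (u x0 / u (Y (Suc n) \<omega>))"
      using before by (simp add: weight_Suc)
    have C1: "0 \<le> C1" using C0(1) by (auto simp: C1_def intro: max.coboundedI1)
    have "weight (Suc n) \<omega> * tail 1 j (Suc n) \<omega> \<le> weight (Suc n) \<omega> * (C1 * q powr \<theta>)"
      using main weight_pos[of "Suc n" \<omega>] by (simp only: q_def e_def mult_left_mono less_imp_le)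
    also have "\<dots> = u x0 / u (Y (Suc n) \<omega>) * C1 * \<Delta> powr \<theta>"
    proof -
      have "exp (- \<theta> * S (Suc n) \<omega>) * q powr \<theta> = \<Delta> powr \<theta>"
        using Delta_pos unfolding q_def by (simp only: exp_powr_scale mult_exp_exp mult.left_commute) simp
      moreover have "weight (Suc n) \<omega> * (C1 * q powr \<theta>)
          = u x0 / u (Y (Suc n) \<omega>) * C1 * (exp (- \<theta> * S (Suc n) \<omega>) * q powr \<theta>)"
        unfolding w by (simp only: mult_ac)
      ultimately show ?thesis by simp
    qed
    also have "\<dots> \<le> u x0 / u0 * C1 * \<Delta> powr \<theta>"
      using u0 u_pos[of x0] C1 by (intro mult_right_mono divide_left_mono) (auto intro: mult_pos_pos u_pos)
    finally show "weight (Suc n) \<omega> * tail 1 j (Suc n) \<omega> \<le> u x0 / u0 * C1 * \<Delta> powr \<theta>" .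
  qed
qed

lemma AE_D_mono: "AE \<omega> in N. \<forall>k n. k \<le> n \<longrightarrow> D k \<omega> \<le> D n \<omega>"
  using AE_load_range by eventually_elim (use Delta_pos in \<open>auto intro!: D_path_mono\<close>)

text \<open>\<open>T \<le> n\<close> means that \<open>D n\<close> exceeds \<open>a\<close>, because \<open>D\<close> is increasing.\<close>

lemma weight_after_T:
  "(\<integral>\<^sup>+\<omega>. past n \<omega> * ennreal (weight n \<omega>) \<partial>N) \<le> ennreal (exceed n x0 \<Delta> a)"
proof -
  have "(\<integral>\<^sup>+\<omega>. past n \<omega> * ennreal (weight n \<omega>) \<partial>N)
      \<le> (\<integral>\<^sup>+\<omega>. ennreal (weight n \<omega> * tail a 0 n \<omega>) \<partial>N)"
  proof (rule nn_integral_mono_AE)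
    show "AE \<omega> in N. past n \<omega> * ennreal (weight n \<omega>)
        \<le> ennreal (weight n \<omega> * tail a 0 n \<omega>)"
      using AE_D_mono
    proof eventually_elim
      case (elim \<omega>)
      have "a < D n \<omega>" if hit: "\<not> enat n < T \<omega>"
      proof -
        obtain k where "k \<le> n" "a < D k \<omega>" using hit by (auto simp: less_hit_time_iff not_le)
        then show ?thesis using elim by force
      qed
      then show ?case by (simp add: indicator_def)
    qed
  qed
  also have "\<dots> = ennreal (exceed n x0 \<Delta> a)" using weighted_tail_invariant[of n 0 a] by simp
  finally show ?thesis .
qed

abbreviation "estimator \<equiv> Z1 \<theta> u x0 a \<Delta> Y G L"

lemma T_measurable: "T \<in> measurable N (count_space UNIV)"
proof (rule measurable_count_space_eq2_countable[THEN iffD2], intro conjI ballI)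
  show "T \<in> space N \<rightarrow> UNIV" by simp
  fix t :: enat
  show "T -` {t} \<inter> space N \<in> sets N"
  proof (cases t)
    case (enat k)
    have "T \<omega> = enat k \<longleftrightarrow> \<not> enat k < T \<omega> \<and> (\<forall>i\<in>{..<k}. enat i < T \<omega>)" for \<omega>
    proof (cases "T \<omega>")
      case (enat j)
      then show ?thesis by (auto simp: not_less le_less)
    qed simp
    then have "T -` {t} \<inter> space N = {\<omega> \<in> space N. \<not> enat k < T \<omega> \<and> (\<forall>i\<in>{..<k}. enat i < T \<omega>)}"
      using enat by auto
    also have "\<dots> \<in> sets N" by measurable
    finally show ?thesis .
  next
    case infinity
    have "T \<omega> = \<infinity> \<longleftrightarrow> (\<forall>i. enat i < T \<omega>)" for \<omega>
      by (cases "T \<omega>") auto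
    then have "T -` {t} \<inter> space N = {\<omega> \<in> space N. \<forall>i. enat i < T \<omega>}" using infinity by auto
    also have "\<dots> \<in> sets N" by measurable
    finally show ?thesis .
  qed
qed

lemma D_inf_measurable: "(\<lambda>\<omega>. D_inf \<Delta> (\<lambda>j. G j \<omega>) (\<lambda>j. L j \<omega>)) \<in> borel_measurable N"
  unfolding D_inf_def by measurable

lemma estimator_measurable [measurable]: "estimator \<in> borel_measurable N"
proof -
  have \<tau>: "(\<lambda>\<omega>. the_enat (T \<omega>)) \<in> measurable N (count_space UNIV)"
    by (rule measurable_compose[OF T_measurable]) simp
  have "(\<lambda>\<omega>. exp (- \<theta> * S k \<omega>) * (u x0 / u (Y k \<omega>))) \<in> borel_measurable N" for k
    by (intro borel_measurable_times measurable_compose[OF Y_measurable, of "\<lambda>y. u x0 / u y"]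
        measurable_compose[OF S_measurable, of "\<lambda>s. exp (- \<theta> * s)"]) simp_all
  from measurable_compose_countable[OF this \<tau>]
  have w: "(\<lambda>\<omega>. exp (- \<theta> * S (the_enat (T \<omega>)) \<omega>) * (u x0 / u (Y (the_enat (T \<omega>)) \<omega>))) \<in> borel_measurable N" .
  have i: "(\<lambda>\<omega>. (if 1 < D_inf \<Delta> (\<lambda>j. G j \<omega>) (\<lambda>j. L j \<omega>) then 1 else 0 :: real)) \<in> borel_measurable N"
    by (rule measurable_If[OF _ _ borel_measurable_less[OF _ D_inf_measurable]]) simp_all
  have "estimator = (\<lambda>\<omega>. exp (- \<theta> * S (the_enat (T \<omega>)) \<omega>) * (u x0 / u (Y (the_enat (T \<omega>)) \<omega>))
      * (if 1 < D_inf \<Delta> (\<lambda>j. G j \<omega>) (\<lambda>j. L j \<omega>) then 1 else 0))"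
    by (rule ext) (simp add: Z1_def Let_def)
  then show ?thesis by (rule ssubst) (rule borel_measurable_times[OF w i])
qed

lemma estimator_nonneg: "0 \<le> estimator \<omega>"
  using u_pos by (simp add: Z1_def Let_def less_imp_le)

lemma AE_estimator:
  assumes "a < 1"
  shows "AE \<omega> in N. (\<forall>n. D n \<omega> \<le> D (Suc n) \<omega>) \<and> (\<forall>n. 1 < D n \<omega> \<longrightarrow> \<not> enat n < T \<omega> \<and> weight n \<omega> = estimator \<omega>)
    \<and> ((\<forall>n. D n \<omega> \<le> 1) \<longrightarrow> estimator \<omega> = 0)"
  using AE_load_range
proof eventually_elim
  case (elim \<omega>)
  have inf: "1 < D_inf \<Delta> (\<lambda>j. G j \<omega>) (\<lambda>j. L j \<omega>) \<longleftrightarrow> (\<exists>n. 1 < D n \<omega>)"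
    using D_inf_greater_iff[of \<Delta> "\<lambda>j. L j \<omega>" 1 "\<lambda>j. G j \<omega>"] elim Delta_pos by (simp add: one_ereal_def)
  have "\<not> enat n < T \<omega> \<and> weight n \<omega> = estimator \<omega>" if n: "1 < D n \<omega>" for n
  proof -
    have hit: "\<not> enat n < T \<omega>" using n assms by (auto simp: less_hit_time_iff)
    then obtain k where k: "T \<omega> = enat k" "k \<le> n" by (cases "T \<omega>") auto
    have "weight n \<omega> = estimator \<omega>"
      using inf n k by (auto simp: weight_at[OF k] Z1_def Let_def)
    then show ?thesis using hit by simp
  qed
  moreover have "estimator \<omega> = 0" if "\<forall>n. D n \<omega> \<le> 1"
  proof -
    have "\<not> 1 < D_inf \<Delta> (\<lambda>j. G j \<omega>) (\<lambda>j. L j \<omega>)" using that inf by (simp add: not_less)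
    then show ?thesis by (simp add: Z1_def Let_def)
  qed
  moreover have "D n \<omega> \<le> D (Suc n) \<omega>" for n using elim Delta_pos by simp
  ultimately show ?case by blast
qed

text \<open>Along almost every path \<open>weight n\<close> restricted to \<open>D n > 1\<close> vanishes up to the passage of the
  level \<open>1\<close>, and from then on it equals the estimator, because \<open>a < 1\<close> puts \<open>T\<close> before this
  passage. Monotone convergence applies to every power.\<close>

lemma estimator_nn_integral:
  assumes a: "a < 1" and p: "0 < p"
  shows "(\<integral>\<^sup>+\<omega>. ennreal (estimator \<omega> ^ p) \<partial>N) = (SUP n. \<integral>\<^sup>+\<omega>. ennreal (weight n \<omega> ^ p * tail 1 0 n \<omega>) \<partial>N)"
proof -
  have "(\<integral>\<^sup>+\<omega>. ennreal (estimator \<omega> ^ p) \<partial>N) = (\<integral>\<^sup>+\<omega>. (SUP n. ennreal (weight n \<omega> ^ p * tail 1 0 n \<omega>)) \<partial>N)"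
  proof (rule nn_integral_cong_AE)
    show "AE \<omega> in N. ennreal (estimator \<omega> ^ p) = (SUP n. ennreal (weight n \<omega> ^ p * tail 1 0 n \<omega>))"
      using AE_estimator[OF a]
    proof eventually_elim
      case (elim \<omega>)
      show ?case
      proof (rule antisym)
        show "(SUP n. ennreal (weight n \<omega> ^ p * tail 1 0 n \<omega>)) \<le> ennreal (estimator \<omega> ^ p)"
          using elim estimator_nonneg[of \<omega>] by (intro SUP_least ennreal_leI) auto
        show "ennreal (estimator \<omega> ^ p) \<le> (SUP n. ennreal (weight n \<omega> ^ p * tail 1 0 n \<omega>))"
        proof (cases "\<exists>n. 1 < D n \<omega>")
          case True
          then obtain n where n: "1 < D n \<omega>" by blast
          then have "ennreal (estimator \<omega> ^ p) = ennreal (weight n \<omega> ^ p * tail 1 0 n \<omega>)" using elim by simp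
          then show ?thesis by (simp only:) (rule SUP_upper, simp)
        next
          case False
          then have "estimator \<omega> = 0" using elim by (simp add: not_less)
          then show ?thesis using p by (simp add: zero_power)
        qed
      qed
    qed
  qed
  also have "\<dots> = (SUP n. \<integral>\<^sup>+\<omega>. ennreal (weight n \<omega> ^ p * tail 1 0 n \<omega>) \<partial>N)"
  proof (rule nn_integral_monotone_convergence_SUP_AE)
    show "AE \<omega> in N. ennreal (weight n \<omega> ^ p * tail 1 0 n \<omega>) \<le> ennreal (weight (Suc n) \<omega> ^ p * tail 1 0 (Suc n) \<omega>)" for n
      using AE_estimator[OF a]
    proof eventually_elim
      case (elim \<omega>)
      show ?case
      proof (cases "1 < D n \<omega>")
        case True
        moreover from this have "1 < D (Suc n) \<omega>" using elim by (meson less_le_trans)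
        ultimately have "weight n \<omega> = estimator \<omega>" "weight (Suc n) \<omega> = estimator \<omega>" "tail 1 0 n \<omega> = 1" "tail 1 0 (Suc n) \<omega> = 1"
          using elim by (auto simp del: D_path.simps)
        then show ?thesis by (simp only: order_refl)
      qed simp
    qed
  qed measurable
  finally show ?thesis .
qed

theorem estimator_expectation:
  assumes a: "a < 1" and \<phi>: "(\<lambda>n. exceed n x0 \<Delta> 1) \<longlonglongrightarrow> \<phi>"
  shows "integrable N estimator" "expectation estimator = \<phi>"
proof -
  have inc: "incseq (\<lambda>n. exceed n x0 \<Delta> 1)"
    using exceed_mono Delta_pos by (auto simp: incseq_def)
  have "(\<integral>\<^sup>+\<omega>. ennreal (estimator \<omega>) \<partial>N) = (SUP n. ennreal (exceed n x0 \<Delta> 1))"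
    using estimator_nn_integral[OF a, of 1] weighted_tail_invariant[of _ 0 1] by simp
  also have "\<dots> = ennreal \<phi>"
  proof (rule LIMSEQ_unique)
    show "(\<lambda>n. ennreal (exceed n x0 \<Delta> 1)) \<longlonglongrightarrow> (SUP n. ennreal (exceed n x0 \<Delta> 1))"
      using inc by (intro LIMSEQ_SUP) (auto simp: incseq_def intro: ennreal_leI)
    show "(\<lambda>n. ennreal (exceed n x0 \<Delta> 1)) \<longlonglongrightarrow> ennreal \<phi>" using \<phi> by (intro tendsto_ennrealI)
  qed
  finally have *: "(\<integral>\<^sup>+\<omega>. ennreal (estimator \<omega>) \<partial>N) = ennreal \<phi>" .
  have "0 \<le> \<phi>" using \<phi> by (rule LIMSEQ_le_const) (auto simp: exceed_bounds)
  then have "has_bochner_integral N estimator \<phi>"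
    using * estimator_nonneg by (intro has_bochner_integral_nn_integral) auto
  then show "integrable N estimator" "expectation estimator = \<phi>"
    by (auto simp: has_bochner_integral_iff)
qed

text \<open>One factor \<open>\<Delta>\<^sup>\<theta>\<close> comes from the overshoot at \<open>T\<close>, the other from the probability of ever
  reaching the level \<open>a\<close>.\<close>

theorem estimator_second_moment:
  assumes a: "a < 1" and C0: "0 < C0"
      "\<And>n x c e. 0 < c \<Longrightarrow> 0 < e \<Longrightarrow> exceed n x c e \<le> C0 * (c / e) powr \<theta>"
    and u0: "0 < u0" "\<And>x. u0 \<le> u x"
  shows "integrable N (\<lambda>\<omega>. (estimator \<omega>)\<^sup>2)"
    and "expectation (\<lambda>\<omega>. (estimator \<omega>)\<^sup>2)
      \<le> u x0 / u0 * max (C0 * (2 / (1 - a)) powr \<theta>) ((2 * m / (1 - a)) powr \<theta>) * \<Delta> powr \<theta>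
        * (C0 * (\<Delta> / a) powr \<theta>)"
proof -
  define C where "C = u x0 / u0 * max (C0 * (2 / (1 - a)) powr \<theta>) ((2 * m / (1 - a)) powr \<theta>) * \<Delta> powr \<theta>"
  have C: "0 \<le> C"
    using C0(1) u0(1) u_pos[of x0] unfolding C_def
    by (intro mult_nonneg_nonneg) (auto intro: max.coboundedI1)
  have bound: "(\<integral>\<^sup>+\<omega>. ennreal ((weight n \<omega>)\<^sup>2 * tail 1 0 n \<omega>) \<partial>N) \<le> ennreal (C * (C0 * (\<Delta> / a) powr \<theta>))" for n
  proof -
    have "(\<integral>\<^sup>+\<omega>. ennreal ((weight n \<omega>)\<^sup>2 * tail 1 0 n \<omega>) \<partial>N)
        \<le> (\<integral>\<^sup>+\<omega>. past n \<omega> * ennreal ((weight n \<omega>)\<^sup>2 * tail 1 0 n \<omega>) \<partial>N)"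
      by (rule nn_integral_mono_AE) (use AE_estimator[OF a] in eventually_elim, auto simp: indicator_def)
    also have "\<dots> \<le> ennreal C * (\<integral>\<^sup>+\<omega>. past n \<omega> * ennreal (weight n \<omega>) \<partial>N)"
      by (rule second_moment_reduction[OF C])
        (unfold C_def, rule overshoot_bound[OF a C0 u0])
    also have "\<dots> \<le> ennreal C * ennreal (exceed n x0 \<Delta> a)"
      by (intro mult_left_mono weight_after_T) simp
    also have "\<dots> = ennreal (C * exceed n x0 \<Delta> a)" using C by (simp add: ennreal_mult exceed_bounds)
    also have "\<dots> \<le> ennreal (C * (C0 * (\<Delta> / a) powr \<theta>))"
      using C C0(2)[OF Delta_pos a_pos] by (intro ennreal_leI mult_left_mono) auto
    finally show ?thesis .
  qed
  have "(\<integral>\<^sup>+\<omega>. ennreal ((estimator \<omega>)\<^sup>2) \<partial>N)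
      = (SUP n. \<integral>\<^sup>+\<omega>. ennreal ((weight n \<omega>)\<^sup>2 * tail 1 0 n \<omega>) \<partial>N)"
    by (rule estimator_nn_integral[OF a]) simp
  also have "\<dots> \<le> ennreal (C * (C0 * (\<Delta> / a) powr \<theta>))" by (rule SUP_least) (rule bound)
  finally have le: "(\<integral>\<^sup>+\<omega>. ennreal ((estimator \<omega>)\<^sup>2) \<partial>N) \<le> ennreal (C * (C0 * (\<Delta> / a) powr \<theta>))" .
  show int: "integrable N (\<lambda>\<omega>. (estimator \<omega>)\<^sup>2)"
    by (rule integrableI_nonneg) (simp_all add: le_less_trans[OF le])
  have "ennreal (expectation (\<lambda>\<omega>. (estimator \<omega>)\<^sup>2)) \<le> ennreal (C * (C0 * (\<Delta> / a) powr \<theta>))"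
    using le nn_integral_eq_integral[OF int] by simp
  moreover have "0 \<le> C * (C0 * (\<Delta> / a) powr \<theta>)" using C C0(1) by simp
  ultimately show "expectation (\<lambda>\<omega>. (estimator \<omega>)\<^sup>2)
      \<le> u x0 / u0 * max (C0 * (2 / (1 - a)) powr \<theta>) ((2 * m / (1 - a)) powr \<theta>) * \<Delta> powr \<theta>
        * (C0 * (\<Delta> / a) powr \<theta>)"
    unfolding C_def by (simp only: ennreal_le_iff)
qed

text \<open>The likelihood ratio is identically \<open>1\<close>, so the estimator is an indicator.\<close>

lemma degenerate_estimator:
  assumes degenerate "a < 1"
  shows "AE \<omega> in N. (estimator \<omega>)\<^sup>2 = estimator \<omega>"
proof -
  have "AE \<omega> in N. exp (\<theta> * G (Suc n) \<omega>) * u (Y (Suc n) \<omega>) = u (Y n \<omega>)" for n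
  proof -
    have "Measurable.pred step_space (\<lambda>w. exp (\<theta> * jump w) * u (fst w) = u x)" for x
    proof -
      have "(\<lambda>w. exp (\<theta> * jump w) * u (fst w)) \<in> borel_measurable step_space"
        by (intro borel_measurable_times measurable_compose[OF measurable_fst, of u]) simp_all
      from measurable_sets[OF this, of "{u x}"] show ?thesis
        by (simp add: pred_def vimage_def space_pair_measure)
    qed
    then show ?thesis
      using AE_step[of "\<lambda>x w. exp (\<theta> * jump w) * u (fst w) = u x" n] assms(1)
      by (simp add: degenerate_def)
  qed
  then have "AE \<omega> in N. \<forall>n. exp (\<theta> * G (Suc n) \<omega>) * u (Y (Suc n) \<omega>) = u (Y n \<omega>)"
    by (intro AE_all_countable[THEN iffD2] allI)
  then show ?thesis using AE_initial AE_estimator[OF assms(2)]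
  proof eventually_elim
    case (elim \<omega>)
    have inv: "exp (- \<theta> * S n \<omega>) * (u x0 / u (Y n \<omega>)) = 1" for n
    proof (induction n)
      case 0
      then show ?case using elim(2) u_pos[of x0] by simp
    next
      case (Suc n)
      have eq: "u (Y n \<omega>) = exp (\<theta> * G (Suc n) \<omega>) * u (Y (Suc n) \<omega>)" using elim(1) by simp
      have "exp (- \<theta> * S (Suc n) \<omega>) = exp (- \<theta> * S n \<omega>) / exp (\<theta> * G (Suc n) \<omega>)"
        by (simp add: distrib_left exp_diff[symmetric])
      then show ?case using Suc u_pos[of x0] unfolding eq by (simp add: mult_ac)
    qed
    have "weight n \<omega> = 1" for n
      unfolding weight_def Let_def by (rule inv)
    then have "estimator \<omega> = 0 \<or> estimator \<omega> = 1" using elim(3) by (metis not_le)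
    then show ?case by auto
  qed
qed

end

section \<open>The nominal process\<close>

text \<open>Conditioning on \<open>A\<close> does not change the law on the independent sigma-algebra.\<close>

lemma (in prob_space) indep_set_nn_integral:
  assumes indep: "indep_set (sets F1) (sets F2)" and space: "space F2 = space M"
    and A: "A \<in> sets F1" and h: "h \<in> borel_measurable F2"
  shows "(\<integral>\<^sup>+\<omega>. indicator A \<omega> * h \<omega> \<partial>M) = emeasure M A * (\<integral>\<^sup>+\<omega>. h \<omega> \<partial>M)"
proof -
  have F: "sets F1 \<subseteq> events" "sets F2 \<subseteq> events"
    using indep by (rule indep_setD_ev1, rule indep_setD_ev2)
  have AM: "A \<in> events" using A F by auto
  have id: "(\<lambda>\<omega>. \<omega>) \<in> measurable M F2"
    using F(2) space sets.sets_into_space[where M = M] by (auto simp: measurable_def)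
  have id': "(\<lambda>\<omega>. \<omega>) \<in> measurable (density M (indicator A)) F2" using id by simp
  have h': "h \<in> borel_measurable M" using measurable_compose[OF id h] by simp
  have eq: "distr (density M (indicator A)) F2 (\<lambda>\<omega>. \<omega>) = density (distr M F2 (\<lambda>\<omega>. \<omega>)) (\<lambda>_. emeasure M A)"
  proof (rule measure_eqI)
    fix B assume "B \<in> sets (distr (density M (indicator A)) F2 (\<lambda>\<omega>. \<omega>))"
    then have B: "B \<in> sets F2" by simp
    then have BM: "B \<in> events" using F by auto
    have sub: "(\<lambda>\<omega>. \<omega>) -` B \<inter> space M = B" using sets.sets_into_space[OF BM] by auto
    have "emeasure (distr (density M (indicator A)) F2 (\<lambda>\<omega>. \<omega>)) B = (\<integral>\<^sup>+\<omega>. indicator A \<omega> * indicator B \<omega> \<partial>M)"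
      using id' B BM AM sub by (subst emeasure_distr) (auto simp: emeasure_density)
    also have "\<dots> = emeasure M (A \<inter> B)" using AM BM by (simp add: indicator_inter_arith[symmetric])
    also have "\<dots> = emeasure M A * emeasure M B"
      using indep_setD[OF indep A B] by (simp add: emeasure_eq_measure ennreal_mult)
    also have "\<dots> = emeasure (density (distr M F2 (\<lambda>\<omega>. \<omega>)) (\<lambda>_. emeasure M A)) B"
      using id B sub by (simp add: emeasure_density nn_integral_cmult emeasure_distr)
    finally show "emeasure (distr (density M (indicator A)) F2 (\<lambda>\<omega>. \<omega>)) B
        = emeasure (density (distr M F2 (\<lambda>\<omega>. \<omega>)) (\<lambda>_. emeasure M A)) B" .
  qed simp
  have "(\<integral>\<^sup>+\<omega>. indicator A \<omega> * h \<omega> \<partial>M) = (\<integral>\<^sup>+\<omega>. h \<omega> \<partial>density M (indicator A))"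
    using AM h' by (subst nn_integral_density) auto
  also have "\<dots> = (\<integral>\<^sup>+\<omega>. h \<omega> \<partial>distr (density M (indicator A)) F2 (\<lambda>\<omega>. \<omega>))"
    using id' h by (subst nn_integral_distr) auto
  also have "\<dots> = emeasure M A * (\<integral>\<^sup>+\<omega>. h \<omega> \<partial>distr M F2 (\<lambda>\<omega>. \<omega>))"
    unfolding eq using h by (simp add: nn_integral_density nn_integral_cmult)
  also have "(\<integral>\<^sup>+\<omega>. h \<omega> \<partial>distr M F2 (\<lambda>\<omega>. \<omega>)) = (\<integral>\<^sup>+\<omega>. h \<omega> \<partial>M)"
    using id h by (subst nn_integral_distr) auto
  finally show ?thesis .
qed

lemma S_path_cong: "(\<And>k. 1 \<le> k \<Longrightarrow> k \<le> n \<Longrightarrow> g k = g' k) \<Longrightarrow> S_path g n = S_path g' n"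
  by (induction n) auto

lemma D_path_cong:
  "(\<And>k. 1 \<le> k \<Longrightarrow> k \<le> n \<Longrightarrow> g k = g' k \<and> l k = l' k) \<Longrightarrow> D_path \<Delta> g l n = D_path \<Delta> g' l' n"
  using S_path_cong[of _ g g'] by (induction n) (auto simp del: S_path.simps)

lemma S_path_measurable:
  "(\<And>k. 1 \<le> k \<Longrightarrow> k \<le> n \<Longrightarrow> (\<lambda>v. g v k) \<in> borel_measurable M) \<Longrightarrow> (\<lambda>v. S_path (g v) n) \<in> borel_measurable M"
  by (induction n) auto

lemma D_path_measurable:
  assumes "\<And>k. 1 \<le> k \<Longrightarrow> k \<le> n \<Longrightarrow> (\<lambda>v. g v k) \<in> borel_measurable M"
    "\<And>k. 1 \<le> k \<Longrightarrow> k \<le> n \<Longrightarrow> (\<lambda>v. l v k) \<in> borel_measurable M"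
  shows "(\<lambda>v. D_path \<Delta> (g v) (l v) n) \<in> borel_measurable M"
  using assms
proof (induction n)
  case (Suc n)
  have "(\<lambda>v. S_path (g v) (Suc n)) \<in> borel_measurable M" by (rule S_path_measurable) (rule Suc.prems(1))
  then show ?case using Suc by (simp del: S_path.simps)
qed simp

locale nominal_process = additive_kernel "nominal_step M (\<xi> 1) (\<eta> 1) \<gamma> lam K" m
  for M :: "'a measure" and \<xi> \<eta> :: "nat \<Rightarrow> 'a \<Rightarrow> real" and \<gamma> lam :: "'x::finite \<Rightarrow> real \<Rightarrow> real"
    and K :: "'x \<Rightarrow> 'x \<Rightarrow> real" and m :: real +
  fixes x0 :: 'x and X :: "nat \<Rightarrow> 'a \<Rightarrow> 'x"
  assumes model: "nominal_model M K x0 X \<xi> \<eta>"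
    and gamma_borel [measurable]: "\<gamma> x \<in> borel_measurable borel"
    and lam_borel [measurable]: "lam x \<in> borel_measurable borel"
    and lam_nonneg: "0 \<le> lam x z"

sublocale nominal_process \<subseteq> prob_space M
  using model unfolding nominal_model_def by blast

context nominal_process
begin

text \<open>The index \<open>1\<close> occurs inside the kernel; rewriting it to \<open>Suc 0\<close> would detach terms from the
  facts about this kernel.\<close>

declare One_nat_def [simp del]

lemma pairs_indep: "indep_vars (\<lambda>_. borel) (\<lambda>n \<omega>. (\<xi> n \<omega>, \<eta> n \<omega>)) {1..}"
  and pairs_distr: "1 \<le> n \<Longrightarrow> distr M borel (\<lambda>\<omega>. (\<xi> n \<omega>, \<eta> n \<omega>)) = distr M borel (\<lambda>\<omega>. (\<xi> 1 \<omega>, \<eta> 1 \<omega>))"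
  and chain: "markov_chain M K x0 X"
  and chain_indep: "indep_set
       (sets (vimage_algebra (space M) (\<lambda>\<omega> n. X n \<omega>) (PiM UNIV (\<lambda>_. count_space UNIV))))
       (sets (vimage_algebra (space M) (\<lambda>\<omega>. \<lambda>n\<in>{1..}. (\<xi> n \<omega>, \<eta> n \<omega>)) (PiM {1..} (\<lambda>_. borel))))"
  using model unfolding nominal_model_def by blast+

lemma pair_measurable: "1 \<le> n \<Longrightarrow> (\<lambda>\<omega>. (\<xi> n \<omega>, \<eta> n \<omega>)) \<in> borel_measurable M"
  using pairs_indep by (simp add: indep_vars_def)

lemma xi_eta_measurable:
  assumes "1 \<le> n" shows "\<xi> n \<in> borel_measurable M" "\<eta> n \<in> borel_measurable M"
  using pair_measurable[OF assms] by (simp_all add: borel_prod[symmetric] measurable_pair_iff comp_def)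

lemma X_measurable [measurable]: "X n \<in> measurable M (count_space UNIV)"
  using chain by (simp add: markov_chain_def)

sublocale increment: increment_model M "\<xi> 1" "\<eta> 1" \<gamma> lam K
proof -
  have "stochastic_matrix K" using model unfolding nominal_model_def by blast
  then show "increment_model M (\<xi> 1) (\<eta> 1) \<gamma> lam K"
    using xi_eta_measurable[of 1] gamma_borel lam_borel prob_space_axioms
    by (simp add: increment_model_def increment_model_axioms_def)
qed

text \<open>The walk and the perpetuity along a fixed path \<open>s\<close> of the chain depend on the noise only.
  \<open>fun_S\<close> and \<open>fun_D\<close> below exhibit them as functions of finitely many noise pairs.\<close>

abbreviation "path_S s n \<omega> \<equiv> S_path (\<lambda>k. \<gamma> (s k) (\<xi> k \<omega>)) n"
abbreviation "path_D \<Delta> s n \<omega> \<equiv> D_path \<Delta> (\<lambda>k. \<gamma> (s k) (\<xi> k \<omega>)) (\<lambda>k. lam (s k) (\<eta> k \<omega>)) n"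
abbreviation "cylinder n s \<equiv> {\<omega> \<in> space M. \<forall>k\<le>n. X k \<omega> = s k}"

abbreviation "fun_S s n v \<equiv> S_path (\<lambda>k. \<gamma> (s k) (fst (v k))) n"
abbreviation "fun_D \<Delta> s n v \<equiv> D_path \<Delta> (\<lambda>k. \<gamma> (s k) (fst (v k))) (\<lambda>k. lam (s k) (snd (v k))) n"

lemma fun_measurable:
  assumes "{1..n} \<subseteq> I"
  shows "fun_S s n \<in> borel_measurable (PiM I (\<lambda>_. borel :: (real \<times> real) measure))"
    "fun_D \<Delta> s n \<in> borel_measurable (PiM I (\<lambda>_. borel :: (real \<times> real) measure))"
proof -
  have comp: "(\<lambda>v. v k) \<in> borel_measurable (PiM I (\<lambda>_. borel :: (real \<times> real) measure))"
    if "1 \<le> k" "k \<le> n" for k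
    by (rule measurable_component_singleton) (use assms that in auto)
  have c1: "(\<lambda>v. \<gamma> (s k) (fst (v k))) \<in> borel_measurable (PiM I (\<lambda>_. borel :: (real \<times> real) measure))"
    if "1 \<le> k" "k \<le> n" for k
    by (rule measurable_compose[OF comp[OF that], of "\<lambda>p. \<gamma> (s k) (fst p)"])
      (simp add: borel_prod[symmetric])
  have c2: "(\<lambda>v. lam (s k) (snd (v k))) \<in> borel_measurable (PiM I (\<lambda>_. borel :: (real \<times> real) measure))"
    if "1 \<le> k" "k \<le> n" for k
    by (rule measurable_compose[OF comp[OF that], of "\<lambda>p. lam (s k) (snd p)"])
      (simp add: borel_prod[symmetric])
  show "fun_S s n \<in> borel_measurable (PiM I (\<lambda>_. borel :: (real \<times> real) measure))"
    by (rule S_path_measurable) (rule c1)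
  show "fun_D \<Delta> s n \<in> borel_measurable (PiM I (\<lambda>_. borel :: (real \<times> real) measure))"
    by (rule D_path_measurable) (rule c1 c2; assumption)+
qed

lemma path_eq_fun:
  assumes "{1..n} \<subseteq> I"
  shows "path_S s n \<omega> = fun_S s n (\<lambda>k\<in>I. (\<xi> k \<omega>, \<eta> k \<omega>))"
    "path_D \<Delta> s n \<omega> = fun_D \<Delta> s n (\<lambda>k\<in>I. (\<xi> k \<omega>, \<eta> k \<omega>))"
  using assms by (auto intro!: S_path_cong D_path_cong)

lemma path_measurable: "path_S s n \<in> borel_measurable M" "path_D \<Delta> s n \<in> borel_measurable M"
  using xi_eta_measurable
  by (auto intro!: S_path_measurable D_path_measurable measurable_compose[OF _ gamma_borel]
      measurable_compose[OF _ lam_borel])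

text \<open>The pair at time \<open>n + 1\<close> is independent of the earlier ones and has the law of the first pair.\<close>

lemma fresh_pair:
  assumes F: "F \<in> borel_measurable ((borel \<Otimes>\<^sub>M borel) \<Otimes>\<^sub>M borel)"
  shows "(\<integral>\<^sup>+\<omega>. F ((path_S s n \<omega>, path_D \<Delta> s n \<omega>), (\<xi> (Suc n) \<omega>, \<eta> (Suc n) \<omega>)) \<partial>M)
    = (\<integral>\<^sup>+\<omega>. (\<integral>\<^sup>+\<omega>'. F ((path_S s n \<omega>, path_D \<Delta> s n \<omega>), (\<xi> 1 \<omega>', \<eta> 1 \<omega>')) \<partial>M) \<partial>M)"
proof -
  let ?V = "\<lambda>\<omega>. (path_S s n \<omega>, path_D \<Delta> s n \<omega>)"
  let ?p = "\<lambda>k \<omega>. (\<xi> k \<omega>, \<eta> k \<omega>)"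
  have "indep_var (borel \<Otimes>\<^sub>M borel)
      ((\<lambda>v. (fun_S s n v, fun_D \<Delta> s n v)) \<circ> (\<lambda>\<omega>. \<lambda>k\<in>{1..n}. ?p k \<omega>))
      borel ((\<lambda>v. v (Suc n)) \<circ> (\<lambda>\<omega>. \<lambda>k\<in>{Suc n}. ?p k \<omega>))"
  proof (rule indep_var_compose)
    show "indep_var (PiM {1..n} (\<lambda>_. borel)) (\<lambda>\<omega>. \<lambda>k\<in>{1..n}. ?p k \<omega>)
        (PiM {Suc n} (\<lambda>_. borel)) (\<lambda>\<omega>. \<lambda>k\<in>{Suc n}. ?p k \<omega>)"
      by (rule indep_var_restrict[OF pairs_indep]) auto
    show "(\<lambda>v. (fun_S s n v, fun_D \<Delta> s n v)) \<in> measurable (PiM {1..n} (\<lambda>_. borel)) (borel \<Otimes>\<^sub>M borel)"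
      by (intro measurable_Pair fun_measurable order_refl)
    show "(\<lambda>v. v (Suc n)) \<in> borel_measurable (PiM {Suc n} (\<lambda>_. borel))"
      by (rule measurable_component_singleton) simp
  qed
  moreover have "(\<lambda>v. (fun_S s n v, fun_D \<Delta> s n v)) \<circ> (\<lambda>\<omega>. \<lambda>k\<in>{1..n}. ?p k \<omega>) = ?V"
    by (rule ext) (simp only: comp_def path_eq_fun[OF order_refl, symmetric])
  moreover have "(\<lambda>v. v (Suc n)) \<circ> (\<lambda>\<omega>. \<lambda>k\<in>{Suc n}. ?p k \<omega>) = ?p (Suc n)"
    by (rule ext) simp
  ultimately have "indep_var (borel \<Otimes>\<^sub>M borel) ?V borel (?p (Suc n))" by (simp only:)
  then have eq: "distr M (borel \<Otimes>\<^sub>M borel) ?V \<Otimes>\<^sub>M distr M borel (?p (Suc n))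
      = distr M ((borel \<Otimes>\<^sub>M borel) \<Otimes>\<^sub>M borel) (\<lambda>\<omega>. (?V \<omega>, ?p (Suc n) \<omega>))"
    by (simp add: indep_var_distribution_eq)
  have V: "?V \<in> measurable M (borel \<Otimes>\<^sub>M borel)" by (intro measurable_Pair path_measurable)
  have p: "?p k \<in> borel_measurable M" if "1 \<le> k" for k by (rule pair_measurable[OF that])
  interpret p1: prob_space "distr M borel (?p 1)" by (rule prob_space_distr[OF p]) simp
  have F': "F \<in> borel_measurable (distr M (borel \<Otimes>\<^sub>M borel) ?V \<Otimes>\<^sub>M distr M borel (?p 1))"
    using F by (simp cong: measurable_cong_sets sets_pair_measure_cong)
  have "(\<integral>\<^sup>+\<omega>. F (?V \<omega>, ?p (Suc n) \<omega>) \<partial>M)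
      = (\<integral>\<^sup>+q. F q \<partial>distr M ((borel \<Otimes>\<^sub>M borel) \<Otimes>\<^sub>M borel) (\<lambda>\<omega>. (?V \<omega>, ?p (Suc n) \<omega>)))"
    using F V p by (subst nn_integral_distr) (auto intro!: measurable_Pair)
  also have "\<dots> = (\<integral>\<^sup>+q. F q \<partial>(distr M (borel \<Otimes>\<^sub>M borel) ?V \<Otimes>\<^sub>M distr M borel (?p 1)))"
    unfolding eq[symmetric] using pairs_distr[of "Suc n"] by simp
  also have "\<dots> = (\<integral>\<^sup>+v. (\<integral>\<^sup>+q. F (v, q) \<partial>distr M borel (?p 1)) \<partial>distr M (borel \<Otimes>\<^sub>M borel) ?V)"
    by (rule p1.nn_integral_fst[symmetric]) (rule F')
  also have "\<dots> = (\<integral>\<^sup>+\<omega>. (\<integral>\<^sup>+q. F (?V \<omega>, q) \<partial>distr M borel (?p 1)) \<partial>M)"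
    using p1.borel_measurable_nn_integral_fst[OF F'] by (intro nn_integral_distr V) simp
  also have "\<dots> = (\<integral>\<^sup>+\<omega>. (\<integral>\<^sup>+\<omega>'. F (?V \<omega>, ?p 1 \<omega>') \<partial>M) \<partial>M)"
  proof (rule nn_integral_cong)
    fix \<omega>
    have "(\<lambda>q. F (?V \<omega>, q)) \<in> borel_measurable borel"
      by (rule measurable_compose[OF measurable_Pair1' F]) (simp add: space_pair_measure)
    then show "(\<integral>\<^sup>+q. F (?V \<omega>, q) \<partial>distr M borel (?p 1)) = (\<integral>\<^sup>+\<omega>'. F (?V \<omega>, ?p 1 \<omega>') \<partial>M)"
      using p[of 1] by (intro nn_integral_distr) auto
  qed
  finally show ?thesis .
qed

abbreviation "path_tail \<Delta> b s j n y \<omega> \<equiv> exceed j y (\<Delta> * exp (path_S s n \<omega>)) (b - path_D \<Delta> s n \<omega>)"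

lemma path_tail_step:
  "(\<integral>\<^sup>+\<omega>. ennreal (path_tail \<Delta> b s (Suc j) n x \<omega>) \<partial>M)
    = (\<Sum>y\<in>UNIV. ennreal (K x y) * (\<integral>\<^sup>+\<omega>. ennreal (path_tail \<Delta> b (s(Suc n := y)) j (Suc n) y \<omega>) \<partial>M))"
proof -
  define F where "F y q = ennreal (exceed j y (\<Delta> * exp (fst (fst q)) * exp (\<gamma> y (fst (snd q))))
    (b - snd (fst q) - lam y (snd (snd q)) * (\<Delta> * exp (fst (fst q)) * exp (\<gamma> y (fst (snd q))))))"
    for y and q :: "(real \<times> real) \<times> real \<times> real"
  have F: "F y \<in> borel_measurable ((borel \<Otimes>\<^sub>M borel) \<Otimes>\<^sub>M borel)" for y
    unfolding F_def borel_prod[symmetric] by measurable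
  have unroll: "ennreal (exceed (Suc j) x c e) = (\<Sum>y\<in>UNIV. ennreal (K x y) *
      (\<integral>\<^sup>+\<omega>'. ennreal (exceed j y (c * exp (\<gamma> y (\<xi> 1 \<omega>'))) (e - lam y (\<eta> 1 \<omega>') * (c * exp (\<gamma> y (\<xi> 1 \<omega>'))))) \<partial>M))"
    for c e
  proof -
    have "ennreal (exceed (Suc j) x c e) = (\<integral>\<^sup>+w. ennreal (exceed j (fst w) (c * exp (jump w))
        (e - load w * (c * exp (jump w)))) \<partial>nominal_step M (\<xi> 1) (\<eta> 1) \<gamma> lam K x)"
      unfolding exceed.simps(2)
      by (rule nn_integral_eq_integral[OF exceed_step_integrable, symmetric]) (simp add: exceed_bounds)
    also have "\<dots> = (\<Sum>y\<in>UNIV. ennreal (K x y) *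
      (\<integral>\<^sup>+\<omega>'. ennreal (exceed j y (c * exp (\<gamma> y (\<xi> 1 \<omega>'))) (e - lam y (\<eta> 1 \<omega>') * (c * exp (\<gamma> y (\<xi> 1 \<omega>'))))) \<partial>M))"
      by (subst increment.nn_integral_nominal) simp_all
    finally show ?thesis .
  qed
  have meas: "(\<lambda>\<omega>. \<integral>\<^sup>+\<omega>'. F y ((path_S s n \<omega>, path_D \<Delta> s n \<omega>), (\<xi> 1 \<omega>', \<eta> 1 \<omega>')) \<partial>M) \<in> borel_measurable M" for y
  proof (rule borel_measurable_nn_integral)
    have "(\<lambda>q. ((path_S s n (fst q), path_D \<Delta> s n (fst q)), (\<xi> 1 (snd q), \<eta> 1 (snd q))))
        \<in> measurable (M \<Otimes>\<^sub>M M) ((borel \<Otimes>\<^sub>M borel) \<Otimes>\<^sub>M borel)"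
      by (intro measurable_Pair measurable_compose[OF measurable_fst] path_measurable
          measurable_compose[OF measurable_snd pair_measurable]) simp
    from measurable_compose[OF this F]
    show "(\<lambda>(\<omega>, \<omega>'). F y ((path_S s n \<omega>, path_D \<Delta> s n \<omega>), \<xi> 1 \<omega>', \<eta> 1 \<omega>')) \<in> borel_measurable (M \<Otimes>\<^sub>M M)"
      by (simp add: split_beta')
  qed
  have "(\<integral>\<^sup>+\<omega>. ennreal (path_tail \<Delta> b s (Suc j) n x \<omega>) \<partial>M)
      = (\<integral>\<^sup>+\<omega>. (\<Sum>y\<in>UNIV. ennreal (K x y) *
        (\<integral>\<^sup>+\<omega>'. F y ((path_S s n \<omega>, path_D \<Delta> s n \<omega>), (\<xi> 1 \<omega>', \<eta> 1 \<omega>')) \<partial>M)) \<partial>M)"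
    unfolding unroll F_def by simp
  also have "\<dots> = (\<Sum>y\<in>UNIV. ennreal (K x y) *
      (\<integral>\<^sup>+\<omega>. (\<integral>\<^sup>+\<omega>'. F y ((path_S s n \<omega>, path_D \<Delta> s n \<omega>), (\<xi> 1 \<omega>', \<eta> 1 \<omega>')) \<partial>M) \<partial>M))"
    using meas by (subst nn_integral_sum) (auto simp: nn_integral_cmult)
  also have "\<dots> = (\<Sum>y\<in>UNIV. ennreal (K x y) * (\<integral>\<^sup>+\<omega>. ennreal (path_tail \<Delta> b (s(Suc n := y)) j (Suc n) y \<omega>) \<partial>M))"
  proof (rule sum.cong[OF refl])
    fix y
    have old: "path_S (s(Suc n := y)) n \<omega> = path_S s n \<omega>" "path_D \<Delta> (s(Suc n := y)) n \<omega> = path_D \<Delta> s n \<omega>" for \<omega>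
      by (auto intro!: S_path_cong D_path_cong)
    have "ennreal (path_tail \<Delta> b (s(Suc n := y)) j (Suc n) y \<omega>)
        = F y ((path_S s n \<omega>, path_D \<Delta> s n \<omega>), (\<xi> (Suc n) \<omega>, \<eta> (Suc n) \<omega>))" for \<omega>
      by (simp add: F_def old exp_add algebra_simps fun_upd_same del: fun_upd_apply)
    then show "ennreal (K x y) *
      (\<integral>\<^sup>+\<omega>. (\<integral>\<^sup>+\<omega>'. F y ((path_S s n \<omega>, path_D \<Delta> s n \<omega>), (\<xi> 1 \<omega>', \<eta> 1 \<omega>')) \<partial>M) \<partial>M)
      = ennreal (K x y) * (\<integral>\<^sup>+\<omega>. ennreal (path_tail \<Delta> b (s(Suc n := y)) j (Suc n) y \<omega>) \<partial>M)"
      by (simp only: fresh_pair[OF F])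
  qed
  finally show ?thesis .
qed

lemma cylinder_sets:
  "cylinder n s \<in> sets (vimage_algebra (space M) (\<lambda>\<omega> n. X n \<omega>) (PiM UNIV (\<lambda>_. count_space UNIV)))"
proof -
  have "{x \<in> space (PiM UNIV (\<lambda>_. count_space UNIV)). \<forall>k\<in>{..n}. x k = s k}
      \<in> sets (PiM UNIV (\<lambda>_. count_space UNIV :: 'x measure))"
    by measurable
  note preimage = in_vimage_algebra[OF this, of "\<lambda>\<omega> n. X n \<omega>" "space M"]
  have "cylinder n s = (\<lambda>\<omega> n. X n \<omega>) -`
      {x \<in> space (PiM UNIV (\<lambda>_. count_space UNIV)). \<forall>k\<in>{..n}. x k = s k} \<inter> space M"
    by (auto simp: space_PiM)
  also have "\<dots> \<in> sets (vimage_algebra (space M) (\<lambda>\<omega> n. X n \<omega>) (PiM UNIV (\<lambda>_. count_space UNIV)))"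
    by (rule preimage)
  finally show ?thesis .
qed

lemma cylinder_measurable [measurable]: "cylinder n s \<in> sets M"
proof -
  have "cylinder n s = {\<omega> \<in> space M. \<forall>k\<in>{..n}. X k \<omega> = s k}" by auto
  also have "\<dots> \<in> sets M" by measurable
  finally show ?thesis .
qed

lemma cylinder_integral:
  "(\<integral>\<^sup>+\<omega>. indicator (cylinder n s) \<omega> * ennreal (path_tail \<Delta> b s' j k y \<omega>) \<partial>M)
    = emeasure M (cylinder n s) * (\<integral>\<^sup>+\<omega>. ennreal (path_tail \<Delta> b s' j k y \<omega>) \<partial>M)"
proof (rule indep_set_nn_integral[OF chain_indep _ cylinder_sets])
  let ?P = "\<lambda>\<omega>. \<lambda>n\<in>{1..}. (\<xi> n \<omega>, \<eta> n \<omega>)"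
  let ?F = "vimage_algebra (space M) ?P (PiM {1..} (\<lambda>_. borel))"
  show "space ?F = space M" by simp
  have P: "?P \<in> measurable ?F (PiM {1..} (\<lambda>_. borel))"
    by (rule measurable_vimage_algebra1) (auto simp: space_PiM)
  have I: "{1..k} \<subseteq> {1..}" by auto
  have S: "path_S s' k \<in> borel_measurable ?F"
    using measurable_compose[OF P fun_measurable(1)[OF I]] unfolding path_eq_fun(1)[OF I] .
  have D: "path_D \<Delta> s' k \<in> borel_measurable ?F"
    using measurable_compose[OF P fun_measurable(2)[OF I]] unfolding path_eq_fun(2)[OF I] .
  have "path_tail \<Delta> b s' j k y \<in> borel_measurable ?F"
    by (intro exceed_measurable borel_measurable_times borel_measurable_diff borel_measurable_const
      S D measurable_const measurable_compose[OF S borel_measurable_exp]) simp_all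
  then show "(\<lambda>\<omega>. ennreal (path_tail \<Delta> b s' j k y \<omega>)) \<in> borel_measurable ?F"
    by (rule measurable_compose[OF _ measurable_ennreal])
qed

abbreviation "nom_S n \<omega> \<equiv> S_path (\<lambda>k. \<gamma> (X k \<omega>) (\<xi> k \<omega>)) n"
abbreviation "nom_D \<Delta> n \<omega> \<equiv> D_path \<Delta> (\<lambda>k. \<gamma> (X k \<omega>) (\<xi> k \<omega>)) (\<lambda>k. lam (X k \<omega>) (\<eta> k \<omega>)) n"

lemma nom_D_measurable [measurable]: "nom_D \<Delta> n \<in> borel_measurable M"
proof -
  have g: "(\<lambda>\<omega>. \<gamma> (X k \<omega>) (\<xi> k \<omega>)) \<in> borel_measurable M" if "1 \<le> k" for k
    by (rule measurable_compose_countable[OF _ X_measurable])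
       (rule measurable_compose[OF xi_eta_measurable(1)[OF that] gamma_borel])
  have l: "(\<lambda>\<omega>. lam (X k \<omega>) (\<eta> k \<omega>)) \<in> borel_measurable M" if "1 \<le> k" for k
    by (rule measurable_compose_countable[OF _ X_measurable])
       (rule measurable_compose[OF xi_eta_measurable(2)[OF that] lam_borel])
  show ?thesis by (rule D_path_measurable) (rule g l; assumption)+
qed

text \<open>On a cylinder the states up to time \<open>n\<close> are fixed, and only the noise, which is independent of
  the chain, is random. Unfolding \<open>exceed\<close> once draws the next state and a fresh pair; splitting
  the cylinder by the state at time \<open>n + 1\<close> matches the first, since the chain is Markov.\<close>

lemma nominal_cylinder_tail:
  "(\<integral>\<^sup>+\<omega>. indicator (cylinder n s) \<omega> * ennreal (path_tail \<Delta> b s j n (s n) \<omega>) \<partial>M)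
    = (\<integral>\<^sup>+\<omega>. indicator (cylinder n s) \<omega> * indicator {\<omega>. b < nom_D \<Delta> (n + j) \<omega>} \<omega> \<partial>M)"
proof (induction j arbitrary: n s)
  case 0
  show ?case
  proof (rule nn_integral_cong)
    fix \<omega>
    have "path_D \<Delta> s n \<omega> = nom_D \<Delta> n \<omega>" if "\<omega> \<in> cylinder n s"
      using that by (auto intro!: D_path_cong)
    then show "indicator (cylinder n s) \<omega> * ennreal (path_tail \<Delta> b s 0 n (s n) \<omega>)
        = indicator (cylinder n s) \<omega> * indicator {\<omega>. b < nom_D \<Delta> (n + 0) \<omega>} \<omega>"
      by (auto simp: indicator_def)
  qed
next
  case (Suc j)
  let ?s = "\<lambda>y. s(Suc n := y)"
  have step: "emeasure M (cylinder n s) * ennreal (K (s n) y) = emeasure M (cylinder (Suc n) (?s y))" for y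
  proof -
    have "cylinder n (?s y) = cylinder n s" by auto
    moreover have "measure M (cylinder (Suc n) (?s y)) = measure M (cylinder n (?s y)) * K (?s y n) (?s y (Suc n))"
      using chain unfolding markov_chain_def by blast
    ultimately show ?thesis using increment.K_nonneg by (simp add: emeasure_eq_measure ennreal_mult)
  qed
  have split: "(\<Sum>y\<in>UNIV. indicator (cylinder (Suc n) (?s y)) \<omega> * f) = indicator (cylinder n s) \<omega> * f"
    if "\<omega> \<in> space M" for \<omega> and f :: ennreal
  proof -
    have "(\<Sum>y\<in>UNIV. indicator (cylinder (Suc n) (?s y)) \<omega> * f)
        = (\<Sum>y\<in>UNIV. if y = X (Suc n) \<omega> then indicator (cylinder n s) \<omega> * f else 0)"
      using that by (intro sum.cong) (auto simp: indicator_def le_Suc_eq)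
    then show ?thesis by simp
  qed
  have "(\<integral>\<^sup>+\<omega>. indicator (cylinder n s) \<omega> * ennreal (path_tail \<Delta> b s (Suc j) n (s n) \<omega>) \<partial>M)
      = emeasure M (cylinder n s) * (\<integral>\<^sup>+\<omega>. ennreal (path_tail \<Delta> b s (Suc j) n (s n) \<omega>) \<partial>M)"
    by (rule cylinder_integral)
  also have "\<dots> = (\<Sum>y\<in>UNIV. emeasure M (cylinder (Suc n) (?s y)) *
      (\<integral>\<^sup>+\<omega>. ennreal (path_tail \<Delta> b (?s y) j (Suc n) y \<omega>) \<partial>M))"
    by (simp only: path_tail_step sum_distrib_left mult.assoc[symmetric] step)
  also have "\<dots> = (\<Sum>y\<in>UNIV. \<integral>\<^sup>+\<omega>. indicator (cylinder (Suc n) (?s y)) \<omega> *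
      ennreal (path_tail \<Delta> b (?s y) j (Suc n) (?s y (Suc n)) \<omega>) \<partial>M)"
    by (simp only: cylinder_integral fun_upd_same)
  also have "\<dots> = (\<Sum>y\<in>UNIV. \<integral>\<^sup>+\<omega>. indicator (cylinder (Suc n) (?s y)) \<omega> *
      indicator {\<omega>. b < nom_D \<Delta> (n + Suc j) \<omega>} \<omega> \<partial>M)"
    by (simp only: Suc add_Suc add_Suc_right)
  also have "\<dots> = (\<integral>\<^sup>+\<omega>. (\<Sum>y\<in>UNIV. indicator (cylinder (Suc n) (?s y)) \<omega> *
      indicator {\<omega>. b < nom_D \<Delta> (n + Suc j) \<omega>} \<omega>) \<partial>M)"
    by (rule nn_integral_sum[symmetric]) measurable
  also have "\<dots> = (\<integral>\<^sup>+\<omega>. indicator (cylinder n s) \<omega> * indicator {\<omega>. b < nom_D \<Delta> (n + Suc j) \<omega>} \<omega> \<partial>M)"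
    by (rule nn_integral_cong) (rule split)
  finally show ?case .
qed

theorem nominal_tail: "measure M {\<omega> \<in> space M. b < nom_D \<Delta> n \<omega>} = exceed n x0 \<Delta> b"
proof -
  have AE0: "AE \<omega> in M. indicator (cylinder 0 (\<lambda>_. x0)) \<omega> = (1 :: ennreal)"
  proof -
    have "AE \<omega> in M. X 0 \<omega> = x0" using chain by (simp add: markov_chain_def)
    then show ?thesis using AE_space by eventually_elim simp
  qed
  have "ennreal (exceed n x0 \<Delta> b) = (\<integral>\<^sup>+\<omega>. indicator (cylinder 0 (\<lambda>_. x0)) \<omega> *
      ennreal (path_tail \<Delta> b (\<lambda>_. x0) n 0 x0 \<omega>) \<partial>M)"
  proof -
    have "(\<integral>\<^sup>+\<omega>. indicator (cylinder 0 (\<lambda>_. x0)) \<omega> * ennreal (path_tail \<Delta> b (\<lambda>_. x0) n 0 x0 \<omega>) \<partial>M)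
        = (\<integral>\<^sup>+\<omega>. ennreal (exceed n x0 \<Delta> b) \<partial>M)"
      by (rule nn_integral_cong_AE) (use AE0 in eventually_elim, simp)
    then show ?thesis by (simp add: emeasure_space_1)
  qed
  also have "\<dots> = (\<integral>\<^sup>+\<omega>. indicator (cylinder 0 (\<lambda>_. x0)) \<omega> * indicator {\<omega>. b < nom_D \<Delta> (0 + n) \<omega>} \<omega> \<partial>M)"
    by (rule nominal_cylinder_tail)
  also have "\<dots> = (\<integral>\<^sup>+\<omega>. indicator {\<omega> \<in> space M. b < nom_D \<Delta> n \<omega>} \<omega> \<partial>M)"
    by (rule nn_integral_cong_AE) (use AE0 AE_space in eventually_elim, simp add: indicator_def)
  also have "\<dots> = emeasure M {\<omega> \<in> space M. b < nom_D \<Delta> n \<omega>}"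
    by (rule nn_integral_indicator) measurable
  finally show ?thesis by (simp add: emeasure_eq_measure exceed_bounds)
qed

text \<open>\<open>D\<close> increases to its limit, which therefore exceeds \<open>1\<close> if and only if some \<open>D\<^sub>n\<close> does.\<close>

theorem phi_limit:
  assumes \<Delta>: "0 < \<Delta>"
  shows "(\<lambda>n. exceed n x0 \<Delta> 1) \<longlonglongrightarrow> phi M X \<xi> \<eta> \<gamma> lam \<Delta>"
proof -
  let ?A = "\<lambda>n. {\<omega> \<in> space M. 1 < nom_D \<Delta> n \<omega>}"
  have "(\<lambda>n. measure M (?A n)) \<longlonglongrightarrow> measure M (\<Union>n. ?A n)"
  proof (rule finite_Lim_measure_incseq)
    show "range ?A \<subseteq> sets M" by auto
    show "incseq ?A"
      using D_path_mono[OF less_imp_le[OF \<Delta>] lam_nonneg] by (auto simp: incseq_def intro: less_le_trans)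
  qed
  moreover have "(\<Union>n. ?A n) = {\<omega> \<in> space M. 1 < D_inf \<Delta> (\<lambda>k. \<gamma> (X k \<omega>) (\<xi> k \<omega>)) (\<lambda>k. lam (X k \<omega>) (\<eta> k \<omega>))}"
    using D_inf_greater_iff[OF less_imp_le[OF \<Delta>], of _ 1] lam_nonneg by (auto simp: one_ereal_def)
  ultimately show ?thesis by (simp only: nominal_tail phi_def)
qed

end

section \<open>Strong efficiency\<close>

lemma irreducible_matrix_rtrancl:
  assumes "irreducible_matrix K" and K: "\<And>x y. 0 \<le> K x y"
  shows "(x, y) \<in> {(x, y). 0 < K x y}\<^sup>*"
proof -
  obtain n where "0 < matrix_pow K n x y" using assms(1) unfolding irreducible_matrix_def by blast
  then show ?thesis
  proof (induction n arbitrary: x)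
    case 0
    then show ?case by (simp split: if_splits)
  next
    case (Suc n)
    have "\<exists>z. 0 < K x z * matrix_pow K n z y"
    proof (rule ccontr)
      assume "\<not> ?thesis"
      then have "matrix_pow K (Suc n) x y \<le> 0" by (auto intro!: sum_nonpos simp: not_less)
      then show False using Suc.prems by linarith
    qed
    then obtain z where z: "0 < K x z * matrix_pow K n z y" by blast
    then have "0 < K x z" "0 < matrix_pow K n z y"
      using K[of x z] by (auto simp: zero_less_mult_iff)
    then show ?case using Suc.IH by (meson CollectI case_prodI converse_rtrancl_into_rtrancl)
  qed
qed

text \<open>Without loads the residual level never changes.\<close>

lemma (in additive_kernel) exceed_null_load:
  assumes null: "\<And>x. measure (P x) {w. 0 < load w} = 0" and e: "0 \<le> e"
  shows "exceed n x c e = 0"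
proof (induction n arbitrary: x c)
  case 0
  then show ?case using e by simp
next
  case (Suc n)
  interpret prob_space "P x" by (rule prob_P)
  have "AE w in P x. w \<notin> {w. 0 < load w}"
    using null[of x] AE_iff_null_sets[OF load_sets[of 0 x]] by (simp add: null_sets_def load_sets emeasure_eq_measure)
  then have "AE w in P x. exceed_next n c e w = 0"
    using load_range[of x]
  proof eventually_elim
    case (elim w)
    then have "load w = 0" by simp
    then show ?case using Suc by simp
  qed
  then show ?case unfolding exceed.simps(2) by (rule integral_eq_zero_AE)
qed


theorem theorem2:
  fixes M :: "'a measure" and N :: "real \<Rightarrow> 'w measure"
    and K :: "'x::finite \<Rightarrow> 'x \<Rightarrow> real" and x0 :: 'x
    and X :: "nat \<Rightarrow> 'a \<Rightarrow> 'x" and \<xi> \<eta> :: "nat \<Rightarrow> 'a \<Rightarrow> real"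
    and \<gamma> lam :: "'x \<Rightarrow> real \<Rightarrow> real"
    and \<theta>s a :: real and u :: "'x \<Rightarrow> real"
    and \<kappa> :: "'x \<Rightarrow> real \<Rightarrow> real measure"
    and Y :: "real \<Rightarrow> nat \<Rightarrow> 'w \<Rightarrow> 'x" and G L :: "real \<Rightarrow> nat \<Rightarrow> 'w \<Rightarrow> real"
  assumes model: "nominal_model M K x0 X \<xi> \<eta>"
    and gamma_measurable: "\<And>x. \<gamma> x \<in> borel_measurable borel"
    and lam_measurable: "\<And>x. lam x \<in> borel_measurable borel"
    and lam_nonneg: "\<And>x z. 0 \<le> lam x z"
    and assumption1_irreducible: "irreducible_matrix K"
    and assumption1_moments:
      "\<exists>U. open U \<and> 0 \<in> U \<and> (SUP (x, \<theta>) \<in> UNIV \<times> U. mgf M (\<xi> 1) \<gamma> x \<theta>) < \<infinity>"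
    and assumption2_root: "0 < \<theta>s" "psi M (\<xi> 1) \<gamma> K \<theta>s = 0"
    and assumption2_finite: "\<exists>\<theta>>\<theta>s. psi M (\<xi> 1) \<gamma> K \<theta> < \<infinity>"
    and lam_bounded: "\<exists>m>0. \<forall>x. AE \<omega> in M. lam x (\<eta> 1 \<omega>) < m"
    and a: "0 < a" "a < 1"
    and eigenvector: "positive_eigenvector M (\<xi> 1) \<gamma> K \<theta>s u"
    and conditional_law: "conditional_lam_law M (\<xi> 1) (\<eta> 1) \<gamma> lam \<kappa>"
    and sampling: "\<And>\<Delta>. 0 < \<Delta> \<Longrightarrow>
      sampled_process (N \<Delta>)
        (tilted_step M (\<xi> 1) \<gamma> K \<theta>s u \<kappa>) (nominal_step M (\<xi> 1) (\<eta> 1) \<gamma> lam K)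
        a \<Delta> x0 (Y \<Delta>) (G \<Delta>) (L \<Delta>)"
  shows "strongly_efficient N (\<lambda>\<Delta>. Z1 \<theta>s u x0 a \<Delta> (Y \<Delta>) (G \<Delta>) (L \<Delta>))
           (phi M X \<xi> \<eta> \<gamma> lam)"
proof -
  define P where "P = nominal_step M (\<xi> 1) (\<eta> 1) \<gamma> lam K"
  have M: "prob_space M" and K: "stochastic_matrix K"
    and indep: "prob_space.indep_vars M (\<lambda>_. borel) (\<lambda>n \<omega>. (\<xi> n \<omega>, \<eta> n \<omega>)) {1..}"
    using model unfolding nominal_model_def by blast+
  have "(\<lambda>\<omega>. (\<xi> 1 \<omega>, \<eta> 1 \<omega>)) \<in> borel_measurable M"
    using indep by (simp add: prob_space.indep_vars_def[OF M])
  then have meas: "\<xi> 1 \<in> borel_measurable M" "\<eta> 1 \<in> borel_measurable M"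
    by (simp_all add: borel_prod[symmetric] measurable_pair_iff comp_def)
  have finite_s: "mgf M (\<xi> 1) \<gamma> x \<theta>s < \<infinity>" for x
    using assumption2_root(2) by (auto simp: psi_def split: if_splits)
  obtain \<theta>' where \<theta>': "\<theta>s < \<theta>'" "\<And>x. mgf M (\<xi> 1) \<gamma> x \<theta>' < \<infinity>"
    using assumption2_finite by (auto simp: psi_def split: if_splits)
  interpret tilt: tilting_model M "\<xi> 1" "\<eta> 1" \<gamma> lam K \<theta>s u \<kappa>
    by (intro tilting_model.intro increment_model.intro increment_model_axioms.intro
        tilting_model_axioms.intro M meas gamma_measurable lam_measurable K finite_s
        assumption2_root eigenvector conditional_law)
  obtain m where m: "\<And>x. AE \<omega> in M. lam x (\<eta> 1 \<omega>) < m" using lam_bounded by blast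
  have kernel: "additive_kernel P m"
  proof (rule additive_kernel.intro)
    fix x y
    show "prob_space (P x)" unfolding P_def by (rule tilt.prob_space_nominal)
    show "sets (P x) = sets step_space" unfolding P_def by (rule tilt.sets_nominal)
    show "(x, y) \<in> {(x, y). 0 < measure (P x) {w. fst w = y}}\<^sup>*"
      unfolding P_def tilt.nominal_next_prob
      using irreducible_matrix_rtrancl[OF assumption1_irreducible tilt.K_nonneg] .
    show "AE w in P x. 0 \<le> load w \<and> load w < m"
      unfolding P_def by (rule tilt.AE_nominal) (use m lam_nonneg in simp_all)
  qed
  interpret kernel: additive_kernel P m by (rule kernel)
  have cramer: "cramer_kernel P m \<theta>s \<theta>' u"
  proof (intro cramer_kernel.intro kernel cramer_kernel_axioms.intro assumption2_root(1) \<theta>'(1) tilt.u_pos)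
    fix x
    have "(\<integral>w. exp (\<theta>s * jump w) * u (fst w) \<partial>P x)
        = enn2real (\<integral>\<^sup>+w. ennreal (exp (\<theta>s * jump w) * u (fst w)) \<partial>P x)"
      using tilt.u_pos by (intro integral_eq_nn_integral) (auto simp: less_imp_le)
    then show "(\<integral>w. exp (\<theta>s * jump w) * u (fst w) \<partial>P x) = u x"
      using tilt.nominal_harmonic[of x] tilt.u_pos[of x] by (simp add: P_def)
    have "(\<integral>\<^sup>+w. ennreal (exp (\<theta>' * jump w)) \<partial>P x)
        = (\<Sum>y\<in>UNIV. ennreal (K x y) * mgf M (\<xi> 1) \<gamma> y \<theta>')"
      unfolding P_def mgf_def by (subst tilt.nn_integral_nominal) simp_all
    also have "\<dots> < \<infinity>" using \<theta>'(2) by (simp add: ennreal_mult_less_top)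
    finally show "integrable (P x) (\<lambda>w. exp (\<theta>' * jump w))"
      by (intro integrableI_nonneg) auto
  qed
  interpret cramer: cramer_kernel P m \<theta>s \<theta>' u by (rule cramer)
  interpret nominal: nominal_process M \<xi> \<eta> \<gamma> lam K m x0 X
    by (intro nominal_process.intro nominal_process_axioms.intro kernel[unfolded P_def] model
        gamma_measurable lam_measurable lam_nonneg)
  let ?\<phi> = "phi M X \<xi> \<eta> \<gamma> lam"
  let ?Z = "\<lambda>\<Delta>. Z1 \<theta>s u x0 a \<Delta> (Y \<Delta>) (G \<Delta>) (L \<Delta>)"
  have \<phi>_limit: "(\<lambda>n. kernel.exceed n x0 \<Delta> 1) \<longlonglongrightarrow> ?\<phi> \<Delta>" if "0 < \<Delta>" for \<Delta>
    using nominal.phi_limit[OF that] unfolding P_def .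
  have sampling_model: "sampling_model P m \<theta>s \<theta>' u (N \<Delta>) a \<Delta> x0 (Y \<Delta>) (G \<Delta>) (L \<Delta>)" if "0 < \<Delta>" for \<Delta>
  proof (intro sampling_model.intro cramer sampling_model_axioms.intro that a(1))
    have "tilted_step M (\<xi> 1) \<gamma> K \<theta>s u \<kappa>
        = (\<lambda>x. density (P x) (\<lambda>w. ennreal (exp (\<theta>s * jump w) * u (fst w) / u x)))"
      unfolding P_def by (rule ext) (rule tilt.tilted_eq_density)
    then show "sampled_process (N \<Delta>)
        (\<lambda>x. density (P x) (\<lambda>w. ennreal (exp (\<theta>s * jump w) * u (fst w) / u x)))
        P a \<Delta> x0 (Y \<Delta>) (G \<Delta>) (L \<Delta>)"
      using sampling[OF that] unfolding P_def by (simp only: eta_contract_eq)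
  qed
  note unbiased = sampling_model.estimator_expectation[OF sampling_model a(2) \<phi>_limit]
  have \<phi>_ge: "kernel.exceed n x0 \<Delta> 1 \<le> ?\<phi> \<Delta>" if "0 < \<Delta>" for n \<Delta>
  proof (rule incseq_le[OF _ \<phi>_limit[OF that]])
    show "incseq (\<lambda>n. kernel.exceed n x0 \<Delta> 1)"
      using kernel.exceed_mono that by (auto simp: incseq_def)
  qed
  have pos: "\<forall>\<^sub>F \<Delta> in at_right 0. (0::real) < \<Delta>" by (rule eventually_at_right_less)
  have second: "(\<forall>\<^sub>F \<Delta> in at_right 0. integrable (N \<Delta>) (\<lambda>\<omega>. (?Z \<Delta> \<omega>)\<^sup>2)) \<and>
     (\<lambda>\<Delta>. LINT \<omega>|N \<Delta>. (?Z \<Delta> \<omega>)\<^sup>2) \<in> O[at_right 0](\<lambda>\<Delta>. (?\<phi> \<Delta>)\<^sup>2)"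
  proof -
    have "\<exists>C c0. 0 < c0 \<and> (\<forall>\<Delta>. 0 < \<Delta> \<longrightarrow> \<Delta> \<le> c0 \<longrightarrow> integrable (N \<Delta>) (\<lambda>\<omega>. (?Z \<Delta> \<omega>)\<^sup>2)
        \<and> (LINT \<omega>|N \<Delta>. (?Z \<Delta> \<omega>)\<^sup>2) \<le> C * (?\<phi> \<Delta>)\<^sup>2)"
    (* Null loads make both sides 0; a constant martingale with a nonnull load makes both sides 1.
       In the remaining case the two tail bounds compare the second moment with phi^2. *)
    proof (cases "\<forall>x. measure (P x) {w. 0 < load w} = 0")
      case True
      have "integrable (N \<Delta>) (\<lambda>\<omega>. (?Z \<Delta> \<omega>)\<^sup>2) \<and> (LINT \<omega>|N \<Delta>. (?Z \<Delta> \<omega>)\<^sup>2) \<le> 1 * (?\<phi> \<Delta>)\<^sup>2"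
        if \<Delta>: "0 < \<Delta>" for \<Delta>
      proof -
        interpret sampling_model P m \<theta>s \<theta>' u "N \<Delta>" a \<Delta> x0 "Y \<Delta>" "G \<Delta>" "L \<Delta>"
          by (rule sampling_model[OF \<Delta>])
        have "(\<lambda>n. kernel.exceed n x0 \<Delta> 1) \<longlonglongrightarrow> 0"
          using kernel.exceed_null_load[of 1] True by simp
        then have "?\<phi> \<Delta> = 0" using \<phi>_limit[OF \<Delta>] by (rule LIMSEQ_unique[rotated])
        then have "AE \<omega> in N \<Delta>. ?Z \<Delta> \<omega> = 0"
          using unbiased[OF \<Delta> \<Delta>] integral_nonneg_eq_0_iff_AE[of "N \<Delta>" "?Z \<Delta>"] estimator_nonneg by simp
        then have zero: "AE \<omega> in N \<Delta>. (?Z \<Delta> \<omega>)\<^sup>2 = 0" by eventually_elim simp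
        have "integrable (N \<Delta>) (\<lambda>\<omega>. (?Z \<Delta> \<omega>)\<^sup>2)"
          using integrable_cong_AE[OF _ _ zero] by simp
        then show ?thesis using integral_eq_zero_AE[OF zero] by simp
      qed
      then show ?thesis by (intro exI[of _ 1]) auto
    next
      case False
      then obtain x' where "measure (P x') {w. 0 < load w} \<noteq> 0" by blast
      then have load: "0 < measure (P x') {w. 0 < load w}"
        by (simp add: less_le)
      show ?thesis
      proof (cases cramer.degenerate)
        case True
        have "integrable (N \<Delta>) (\<lambda>\<omega>. (?Z \<Delta> \<omega>)\<^sup>2) \<and> (LINT \<omega>|N \<Delta>. (?Z \<Delta> \<omega>)\<^sup>2) \<le> 1 * (?\<phi> \<Delta>)\<^sup>2"
          if \<Delta>: "0 < \<Delta>" for \<Delta>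
        proof -
          interpret sampling_model P m \<theta>s \<theta>' u "N \<Delta>" a \<Delta> x0 "Y \<Delta>" "G \<Delta>" "L \<Delta>"
            by (rule sampling_model[OF \<Delta>])
          have "?\<phi> \<Delta> = 1"
            using cramer.exceed_tendsto_1_degenerate[OF True load \<Delta>] \<phi>_limit[OF \<Delta>]
            by (rule LIMSEQ_unique[rotated])
          moreover have sq: "AE \<omega> in N \<Delta>. (?Z \<Delta> \<omega>)\<^sup>2 = ?Z \<Delta> \<omega>"
            by (rule degenerate_estimator[OF True a(2)])
          have "integrable (N \<Delta>) (\<lambda>\<omega>. (?Z \<Delta> \<omega>)\<^sup>2)"
            using integrable_cong_AE[OF _ _ sq] unbiased(1)[OF \<Delta> \<Delta>] by simp
          moreover have "(LINT \<omega>|N \<Delta>. (?Z \<Delta> \<omega>)\<^sup>2) = (LINT \<omega>|N \<Delta>. ?Z \<Delta> \<omega>)"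
            by (rule integral_cong_AE[OF _ _ sq]) simp_all
          ultimately show ?thesis using unbiased(2)[OF \<Delta> \<Delta>] by simp
        qed
        then show ?thesis by (intro exI[of _ 1]) auto
      next
        case False
        obtain C0 where C0: "0 < C0"
          "\<And>n x c e. 0 < c \<Longrightarrow> 0 < e \<Longrightarrow> kernel.exceed n x c e \<le> C0 * (c / e) powr \<theta>s"
          by (rule cramer.exceed_upper_bound[OF False], rule that)
        obtain k c0 where k: "0 < k" "0 < c0" "\<And>x c \<phi>. 0 < c \<Longrightarrow> c \<le> c0 \<Longrightarrow>
            \<forall>n. kernel.exceed n x c 1 \<le> \<phi> \<Longrightarrow> k * c powr \<theta>s \<le> \<phi>"
          by (rule cramer.exceed_lower_bound[OF False load]) (erule that)
        obtain u0 where u0: "0 < u0" "\<And>x. u0 \<le> u x"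
          using finite_pos_lower_bound[of u] tilt.u_pos by blast
        define A where "A = u x0 / u0 * max (C0 * (2 / (1 - a)) powr \<theta>s) ((2 * m / (1 - a)) powr \<theta>s)"
        have A: "0 \<le> A"
          using C0(1) u0(1) tilt.u_pos[of x0] unfolding A_def
          by (intro mult_nonneg_nonneg) (auto intro: max.coboundedI1)
        define C where "C = A * (C0 * (1 / a) powr \<theta>s) / k\<^sup>2"
        have "integrable (N \<Delta>) (\<lambda>\<omega>. (?Z \<Delta> \<omega>)\<^sup>2) \<and> (LINT \<omega>|N \<Delta>. (?Z \<Delta> \<omega>)\<^sup>2) \<le> C * (?\<phi> \<Delta>)\<^sup>2"
          if \<Delta>: "0 < \<Delta>" "\<Delta> \<le> c0" for \<Delta>
        proof -
          note moment = sampling_model.estimator_second_moment[OF sampling_model[OF \<Delta>(1)] a(2) C0 u0]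
          have lower: "k * \<Delta> powr \<theta>s \<le> ?\<phi> \<Delta>" by (rule k(3)[OF \<Delta>]) (use \<phi>_ge[OF \<Delta>(1)] in blast)
          have "(LINT \<omega>|N \<Delta>. (?Z \<Delta> \<omega>)\<^sup>2) \<le> A * \<Delta> powr \<theta>s * (C0 * (\<Delta> / a) powr \<theta>s)"
            unfolding A_def by (rule moment(2))
          also have "\<dots> = C * (k * \<Delta> powr \<theta>s)\<^sup>2"
            using k(1) \<Delta>(1) a(1) by (simp add: C_def powr_divide power2_eq_square)
          also have "\<dots> \<le> C * (?\<phi> \<Delta>)\<^sup>2"
            using lower k(1) A C0(1) by (intro mult_left_mono power_mono) (auto simp: C_def)
          finally show ?thesis using moment(1) by blast
        qed
        then show ?thesis using k(2) by blast
      qed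
    qed
    then obtain C c0 where c0: "0 < c0" and C: "\<And>\<Delta>. 0 < \<Delta> \<Longrightarrow> \<Delta> \<le> c0 \<Longrightarrow> integrable (N \<Delta>) (\<lambda>\<omega>. (?Z \<Delta> \<omega>)\<^sup>2)
        \<and> (LINT \<omega>|N \<Delta>. (?Z \<Delta> \<omega>)\<^sup>2) \<le> C * (?\<phi> \<Delta>)\<^sup>2"
      by blast
    have small: "\<forall>\<^sub>F \<Delta> in at_right 0. 0 < \<Delta> \<and> \<Delta> \<le> c0"
      using eventually_at_right_real[OF c0] by eventually_elim auto
    show ?thesis
    proof
      show "\<forall>\<^sub>F \<Delta> in at_right 0. integrable (N \<Delta>) (\<lambda>\<omega>. (?Z \<Delta> \<omega>)\<^sup>2)"
        using small by eventually_elim (use C in blast)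
      show "(\<lambda>\<Delta>. LINT \<omega>|N \<Delta>. (?Z \<Delta> \<omega>)\<^sup>2) \<in> O[at_right 0](\<lambda>\<Delta>. (?\<phi> \<Delta>)\<^sup>2)"
      proof (rule bigoI)
        show "\<forall>\<^sub>F \<Delta> in at_right 0. norm (LINT \<omega>|N \<Delta>. (?Z \<Delta> \<omega>)\<^sup>2) \<le> C * norm ((?\<phi> \<Delta>)\<^sup>2)"
          using small by eventually_elim (use C in simp)
      qed
    qed
  qed
  show ?thesis
    unfolding strongly_efficient_def using unbiased second by blast
qed

end
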